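(* Let $n\ge 1$ be an integer and let $\mathbf{S}_n$ be the symmetric group of degree $n$. Then: (i) $\mathcal{P}_v(\mathbf{S}_n)=0$ if $n=1,2$; (ii) $\mathcal{P}_v(\mathbf{S}_n)=1/2$ if $n=3$; (iii) $\mathcal{P}_v(\mathbf{S}_n)=5/6$ if $n=4$; (iv) $\mathcal{P}_v(\mathbf{S}_n)\ge \mathcal{P}_v(\mathbf{S}_7)=2327/2520$ if $n\ge 5$.
   Context: For a finite group $G$, let $\mathrm{Irr}(G)$ be the set of irreducible complex characters of $G$. An element $g\in G$ is a vanishing element of $G$ if there exists $\chi\in\mathrm{Irr}(G)$ with $\chi(g)=0$. Let $\mathcal{V}(G)$ be the set of vanishing elements of $G$. The proportion of vanishing elements is $\mathcal{P}_v(G)=|\mathcal{V}(G)|/|G|$. *)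

theory Defs
  imports
    Complex_Main
    "HOL-Algebra.Sym_Groups"
    "Jordan_Normal_Form.VS_Connect"
begin

definition mat_trace :: "complex mat \<Rightarrow> complex" where
  "mat_trace A = (\<Sum>i<dim_row A. A $$ (i, i))"

text \<open>The third argument \<open>()\<close> of \<open>ring_mat\<close> only fills an unused extension slot of the record;
  the units of this ring are the group of invertible \<open>d \<times> d\<close> matrices.\<close>

definition representation :: "('a, 'b) monoid_scheme \<Rightarrow> nat \<Rightarrow> ('a \<Rightarrow> complex mat) \<Rightarrow> bool" where
  "representation G d \<rho> \<longleftrightarrow> \<rho> \<in> hom G (units_of (ring_mat TYPE(complex) d ()))"

definition invariant_subspace ::
    "('a, 'b) monoid_scheme \<Rightarrow> nat \<Rightarrow> ('a \<Rightarrow> complex mat) \<Rightarrow> complex vec set \<Rightarrow> bool" where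
  "invariant_subspace G d \<rho> W \<longleftrightarrow>
     subspace class_ring W (module_vec TYPE(complex) d) \<and>
     (\<forall>g\<in>carrier G. \<forall>w\<in>W. \<rho> g *\<^sub>v w \<in> W)"

definition irreducible_representation ::
    "('a, 'b) monoid_scheme \<Rightarrow> nat \<Rightarrow> ('a \<Rightarrow> complex mat) \<Rightarrow> bool" where
  "irreducible_representation G d \<rho> \<longleftrightarrow>
     representation G d \<rho> \<and> d > 0 \<and>
     (\<forall>W. invariant_subspace G d \<rho> W \<longrightarrow> W = {0\<^sub>v d} \<or> W = carrier_vec d)"

text \<open>Characters are extensional functions on the carrier, so that two characters are equal
  exactly when they agree on the group.\<close>

definition Irr :: "('a, 'b) monoid_scheme \<Rightarrow> ('a \<Rightarrow> complex) set" where
  "Irr G = {\<chi>. \<exists>d \<rho>. irreducible_representation G d \<rho> \<and>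
                   \<chi> = restrict (\<lambda>g. mat_trace (\<rho> g)) (carrier G)}"

definition vanishing_elements :: "('a, 'b) monoid_scheme \<Rightarrow> 'a set" where
  "vanishing_elements G = {g \<in> carrier G. \<exists>\<chi>\<in>Irr G. \<chi> g = 0}"

definition vanishing_proportion :: "('a, 'b) monoid_scheme \<Rightarrow> real" where
  "vanishing_proportion G = real (card (vanishing_elements G)) / real (Coset.order G)"

end

theory Submission
  imports Defs "Jordan_Normal_Form.Spectral_Radius" "HOL-Combinatorics.Orbits"
begin

text \<open>
  Permutation characters on subsets, their products and the sign generate a ring of virtual characters
  of \<open>S\<^sub>n\<close> that are polynomials in the numbers \<open>c\<^sub>1, c\<^sub>2, c\<^sub>3\<close> of cycles of length 1, 2, 3. A virtual character of
  norm 1 and positive degree is irreducible, so no Specht modules are needed: the characters of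
  \<open>(n-1,1)\<close>, \<open>(n-2,2)\<close> and \<open>(n-2,1,1)\<close> arise in this way, and they vanish when \<open>c\<^sub>1 = 1\<close> or
  \<open>(c\<^sub>1, c\<^sub>2)\<close> is one of \<open>(0,0), (0,1), (2,0), (2,1), (3,0), (3,1)\<close>. The proportion of such permutations
  tends to \<open>e\<^sup>-\<^sup>1 + 5/2 e\<^sup>-\<^sup>3\<^sup>/\<^sup>2 = 0.9257...\<close>, which exceeds \<open>2327/2520 = 0.9234...\<close>, and the convergence is so fast
  that only \<open>n = 6\<close> needs a further character and only \<open>n = 7\<close> needs the exact answer. For \<open>n = 7\<close> and
  for \<open>n \<le> 4\<close> all irreducible characters are listed; the list is complete because it exhausts the
  regular character.
\<close>

section \<open>Matrix representations as functions\<close>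

text \<open>Characters are paired by means of \<open>g\<close> and \<open>inv g\<close> rather than
  by complex conjugation, so unitarity never enters; in a symmetric group a permutation and its
  inverse have the same cycle type, and the norm of a real class function is simply the mean of its
  square. Norms and proportions are therefore averages of functions of the cycle type, and one
  recursion, inserting the point \<open>n + 1\<close> into a permutation of \<open>n\<close> points,
  computes them all. The limit has a probabilistic origin: the numbers of 1-cycles and 2-cycles
  behave like independent Poisson variables of means 1 and 1/2. Having exactly one fixed point has
  weight e^-1, and a pair (a, b) has weight e^(-3/2) / (a! b! 2^b); the six pairs contribute 1 + 1/2
  + 1/2 + 1/4 + 1/6 + 1/12 = 5/2. A lower bound needs only some irreducible characters. An exact
  value also needs that no further character vanishes elsewhere, which is why completeness of the
  list matters in degree 7 and in degrees up to 4.\<close>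

definition matrix_rep :: "('a, 'b) monoid_scheme \<Rightarrow> nat \<Rightarrow> ('a \<Rightarrow> nat \<Rightarrow> nat \<Rightarrow> complex) \<Rightarrow> bool" where
  "matrix_rep G d r \<longleftrightarrow>
     (\<forall>i<d. \<forall>j<d. r \<one>\<^bsub>G\<^esub> i j = (if i = j then 1 else 0)) \<and>
     (\<forall>g\<in>carrier G. \<forall>h\<in>carrier G. \<forall>i<d. \<forall>j<d. r (g \<otimes>\<^bsub>G\<^esub> h) i j = (\<Sum>k<d. r g i k * r h k j))"

text \<open>Vectors are functions on all of \<open>nat\<close> of which only the first
  \<open>d\<close> coordinates matter. Closure under changing the other coordinates makes these sets
  correspond to the subspaces in dimension \<open>d\<close>: the full space is \<open>UNIV\<close>,
  and the zero space consists of the functions vanishing below \<open>d\<close>.\<close>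

definition function_subspace :: "nat \<Rightarrow> (nat \<Rightarrow> complex) set \<Rightarrow> bool" where
  "function_subspace d W \<longleftrightarrow> (\<forall>v w. v \<in> W \<longrightarrow> (\<forall>i<d. v i = w i) \<longrightarrow> w \<in> W) \<and> (\<lambda>_. 0) \<in> W \<and>
     (\<forall>v\<in>W. \<forall>w\<in>W. (\<lambda>i. v i + w i) \<in> W) \<and> (\<forall>c. \<forall>v\<in>W. (\<lambda>i. c * v i) \<in> W)"

definition matrix_irr :: "('a, 'b) monoid_scheme \<Rightarrow> nat \<Rightarrow> ('a \<Rightarrow> nat \<Rightarrow> nat \<Rightarrow> complex) \<Rightarrow> bool" where
  "matrix_irr G d r \<longleftrightarrow> matrix_rep G d r \<and> d > 0 \<and>
     (\<forall>W. function_subspace d W \<longrightarrow> (\<forall>g\<in>carrier G. \<forall>w\<in>W. (\<lambda>i. \<Sum>j<d. r g i j * w j) \<in> W) \<longrightarrow>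
        (\<forall>w\<in>W. \<forall>i<d. w i = 0) \<or> W = UNIV)"

lemma matrix_repD:
  assumes "matrix_rep G d r"
  shows "i < d \<Longrightarrow> j < d \<Longrightarrow> r \<one>\<^bsub>G\<^esub> i j = (if i = j then 1 else 0)"
    and "g \<in> carrier G \<Longrightarrow> h \<in> carrier G \<Longrightarrow> i < d \<Longrightarrow> j < d \<Longrightarrow>
      r (g \<otimes>\<^bsub>G\<^esub> h) i j = (\<Sum>k<d. r g i k * r h k j)"
  using assms unfolding matrix_rep_def by auto

lemma matrix_irrD:
  assumes "matrix_irr G d r" "function_subspace d W"
    and "\<And>g w. g \<in> carrier G \<Longrightarrow> w \<in> W \<Longrightarrow> (\<lambda>i. \<Sum>j<d. r g i j * w j) \<in> W"
    and "w \<in> W" "i < d" "w i \<noteq> 0"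
  shows "W = UNIV"
  using assms unfolding matrix_irr_def by blast

lemma module_vec_subspace_iff:
  "VectorSpace.subspace class_ring W (module_vec TYPE(complex) d) \<longleftrightarrow>
     W \<subseteq> carrier_vec d \<and> 0\<^sub>v d \<in> W \<and> (\<forall>v\<in>W. \<forall>w\<in>W. v + w \<in> W) \<and> (\<forall>c. \<forall>v\<in>W. c \<cdot>\<^sub>v v \<in> W)"
proof -
  interpret vec_space "TYPE(complex)" d .
  have 1: "vectorspace class_ring V" by unfold_locales
  have 2: "Module.module class_ring V" by unfold_locales
  show ?thesis
    unfolding VectorSpace.subspace_def submodule_def using 1 2 by (auto simp: module_vec_simps)
qed

lemma representation_matrix_rep:
  assumes G: "group G" and \<rho>: "representation G d \<rho>"
  shows "matrix_rep G d (\<lambda>g i j. \<rho> g $$ (i, j))" and "\<And>g. g \<in> carrier G \<Longrightarrow> \<rho> g \<in> carrier_mat d d"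
proof -
  interpret G: group G by fact
  let ?R = "ring_mat TYPE(complex) d ()"
  interpret R: Ring.ring ?R by (rule ring_mat)
  have hom: "\<rho> \<in> hom G (units_of ?R)" using \<rho> by (simp add: representation_def)
  have U: "group (units_of ?R)" by (rule R.units_group)
  have c: "\<rho> g \<in> Units ?R" if "g \<in> carrier G" for g
    using hom that by (auto simp: hom_def units_of_def)
  then show c': "\<rho> g \<in> carrier_mat d d" if "g \<in> carrier G" for g
    using that by (auto simp: Units_def ring_mat_simps)
  have m: "\<rho> (g \<otimes>\<^bsub>G\<^esub> h) = \<rho> g * \<rho> h" if "g \<in> carrier G" "h \<in> carrier G" for g h
    using hom that by (auto simp: hom_def units_of_def ring_mat_simps)
  have "\<rho> \<one>\<^bsub>G\<^esub> = \<one>\<^bsub>units_of ?R\<^esub>"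
    using hom_one[OF hom G U] .
  then have o: "\<rho> \<one>\<^bsub>G\<^esub> = 1\<^sub>m d" by (simp add: units_of_def ring_mat_simps)
  show "matrix_rep G d (\<lambda>g i j. \<rho> g $$ (i, j))"
    unfolding matrix_rep_def
  proof (intro conjI ballI allI impI)
    fix g h i j assume "g \<in> carrier G" "h \<in> carrier G" "i < d" "j < d"
    then show "\<rho> (g \<otimes>\<^bsub>G\<^esub> h) $$ (i, j) = (\<Sum>k<d. \<rho> g $$ (i, k) * \<rho> h $$ (k, j))"
      using c'[of g] c'[of h] by (simp add: m scalar_prod_def lessThan_atLeast0)
  qed (simp add: o)
qed

lemma matrix_rep_representation:
  assumes G: "group G" and r: "matrix_rep G d r"
  shows "representation G d (\<lambda>g. mat d d (\<lambda>(i, j). r g i j))"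
proof -
  interpret G: group G by fact
  let ?R = "ring_mat TYPE(complex) d ()"
  let ?\<rho> = "\<lambda>g. mat d d (\<lambda>(i, j). r g i j)"
  have m: "?\<rho> (g \<otimes>\<^bsub>G\<^esub> h) = ?\<rho> g * ?\<rho> h" if "g \<in> carrier G" "h \<in> carrier G" for g h
    using matrix_repD(2)[OF r] that by (intro eq_matI) (auto simp: scalar_prod_def lessThan_atLeast0)
  have o: "?\<rho> \<one>\<^bsub>G\<^esub> = 1\<^sub>m d"
    using matrix_repD(1)[OF r] by (intro eq_matI) auto
  have u: "?\<rho> g \<in> Units ?R" if g: "g \<in> carrier G" for g
    unfolding Units_def ring_mat_simps
    using m[of g "inv\<^bsub>G\<^esub> g"] m[of "inv\<^bsub>G\<^esub> g" g] g o
    by (auto intro!: bexI[of _ "?\<rho> (inv\<^bsub>G\<^esub> g)"])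
  show ?thesis
    unfolding representation_def hom_def using u m by (auto simp: units_of_def ring_mat_simps)
qed

lemma irreducible_representation_matrix_irr:
  assumes G: "group G" and irr: "irreducible_representation G d \<rho>"
  shows "matrix_irr G d (\<lambda>g i j. \<rho> g $$ (i, j))"
  unfolding matrix_irr_def
proof (intro conjI allI impI)
  have rep: "representation G d \<rho>" using irr by (simp add: irreducible_representation_def)
  show "matrix_rep G d (\<lambda>g i j. \<rho> g $$ (i, j))" by (rule representation_matrix_rep(1)[OF G rep])
  note c = representation_matrix_rep(2)[OF G rep]
  show "0 < d" using irr by (simp add: irreducible_representation_def)
  fix W assume W: "function_subspace d W"
    and inv: "\<forall>g\<in>carrier G. \<forall>w\<in>W. (\<lambda>i. \<Sum>j<d. \<rho> g $$ (i, j) * w j) \<in> W"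
  \<comment> \<open>The space of genuine vectors belonging to \<open>W\<close>; the values of
    \<open>v $ i\<close> for \<open>i \<ge> d\<close> are unspecified, but membership in
    \<open>W\<close> does not depend on them.\<close>
  let ?V = "{v \<in> carrier_vec d. (\<lambda>i. v $ i) \<in> W}"
  have mem: "w \<in> W" if "v \<in> W" "\<And>i. i < d \<Longrightarrow> v i = w i" for v w
    using W that unfolding function_subspace_def by blast
  have "invariant_subspace G d \<rho> ?V"
    unfolding invariant_subspace_def module_vec_subspace_iff
  proof (intro conjI ballI allI)
    have "(\<lambda>_. 0) \<in> W" using W by (simp add: function_subspace_def)
    from mem[OF this, of "\<lambda>i. 0\<^sub>v d $ i"] show "0\<^sub>v d \<in> ?V" by simp
    fix v w assume v: "v \<in> ?V" and w: "w \<in> ?V"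
    then have "(\<lambda>i. v $ i + w $ i) \<in> W" using W by (auto simp: function_subspace_def)
    from mem[OF this, of "\<lambda>i. (v + w) $ i"] show "v + w \<in> ?V" using v w by auto
  next
    fix c v assume v: "v \<in> ?V"
    then have "(\<lambda>i. c * v $ i) \<in> W" using W by (auto simp: function_subspace_def)
    from mem[OF this, of "\<lambda>i. (c \<cdot>\<^sub>v v) $ i"] show "c \<cdot>\<^sub>v v \<in> ?V" using v by auto
  next
    fix g w assume g: "g \<in> carrier G" and w: "w \<in> ?V"
    then have "(\<lambda>i. \<Sum>j<d. \<rho> g $$ (i, j) * w $ j) \<in> W" using inv by auto
    moreover have "(\<Sum>j<d. \<rho> g $$ (i, j) * w $ j) = (\<rho> g *\<^sub>v w) $ i" if "i < d" for i
      using c[OF g] w that by (auto simp: scalar_prod_def lessThan_atLeast0)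
    ultimately have "(\<lambda>i. (\<rho> g *\<^sub>v w) $ i) \<in> W" by (rule mem)
    then show "\<rho> g *\<^sub>v w \<in> ?V" using w c[OF g] by simp
  qed auto
  then have "?V = {0\<^sub>v d} \<or> ?V = carrier_vec d"
    using irr by (auto simp: irreducible_representation_def)
  then show "(\<forall>w\<in>W. \<forall>i<d. w i = 0) \<or> W = UNIV"
  proof
    assume V: "?V = {0\<^sub>v d}"
    have "w i = 0" if "w \<in> W" "i < d" for w i
    proof -
      have "vec d w \<in> ?V" using mem[OF \<open>w \<in> W\<close>, of "\<lambda>i. vec d w $ i"] by simp
      then have "vec d w = 0\<^sub>v d" using V by auto
      then show ?thesis using \<open>i < d\<close> by (metis index_vec index_zero_vec(1))
    qed
    then show ?thesis by blast
  next
    assume V: "?V = carrier_vec d"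
    have "w \<in> W" for w
    proof -
      have "vec d w \<in> ?V" unfolding V by simp
      then have "(\<lambda>i. vec d w $ i) \<in> W" by simp
      from mem[OF this, of w] show ?thesis by simp
    qed
    then show ?thesis by auto
  qed
qed

lemma matrix_irr_irreducible_representation:
  assumes G: "group G" and irr: "matrix_irr G d r"
  shows "irreducible_representation G d (\<lambda>g. mat d d (\<lambda>(i, j). r g i j))"
  unfolding irreducible_representation_def
proof (intro conjI allI impI)
  have r: "matrix_rep G d r" using irr by (simp add: matrix_irr_def)
  show "representation G d (\<lambda>g. mat d d (\<lambda>(i, j). r g i j))" by (rule matrix_rep_representation[OF G r])
  show "0 < d" using irr by (simp add: matrix_irr_def)
  fix V assume "invariant_subspace G d (\<lambda>g. mat d d (\<lambda>(i, j). r g i j)) V"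
  then have V: "V \<subseteq> carrier_vec d" "0\<^sub>v d \<in> V" "\<And>v w. v \<in> V \<Longrightarrow> w \<in> V \<Longrightarrow> v + w \<in> V"
      "\<And>c v. v \<in> V \<Longrightarrow> c \<cdot>\<^sub>v v \<in> V"
    and inv: "\<And>g v. g \<in> carrier G \<Longrightarrow> v \<in> V \<Longrightarrow> mat d d (\<lambda>(i, j). r g i j) *\<^sub>v v \<in> V"
    unfolding invariant_subspace_def module_vec_subspace_iff by auto
  let ?W = "{w. vec d w \<in> V}"
  have sub: "function_subspace d ?W"
    unfolding function_subspace_def
  proof (intro conjI allI impI ballI)
    fix v w assume "v \<in> ?W" "\<forall>i<d. v i = w i"
    moreover from this have "vec d v = vec d w" by auto
    ultimately show "w \<in> ?W" by auto
  next
    have "vec d (\<lambda>_. 0) = (0\<^sub>v d :: complex vec)" by auto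
    then show "(\<lambda>_. 0) \<in> ?W" using V(2) by simp
  next
    fix v w assume "v \<in> ?W" "w \<in> ?W"
    moreover have "vec d (\<lambda>i. v i + w i) = vec d v + vec d w" by auto
    ultimately show "(\<lambda>i. v i + w i) \<in> ?W" using V(3) by simp
  next
    fix c v assume "v \<in> ?W"
    moreover have "vec d (\<lambda>i. c * v i) = c \<cdot>\<^sub>v vec d v" by auto
    ultimately show "(\<lambda>i. c * v i) \<in> ?W" using V(4) by simp
  qed
  have "(\<lambda>i. \<Sum>j<d. r g i j * w j) \<in> ?W" if "g \<in> carrier G" "w \<in> ?W" for g w
  proof -
    have "vec d (\<lambda>i. \<Sum>j<d. r g i j * w j) = mat d d (\<lambda>(i, j). r g i j) *\<^sub>v vec d w"
      by (intro eq_vecI) (auto simp: scalar_prod_def lessThan_atLeast0)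
    then show ?thesis using inv that by auto
  qed
  then have "(\<forall>w\<in>?W. \<forall>i<d. w i = 0) \<or> ?W = UNIV"
    using irr sub unfolding matrix_irr_def by blast
  then show "V = {0\<^sub>v d} \<or> V = carrier_vec d"
  proof
    assume z: "\<forall>w\<in>?W. \<forall>i<d. w i = 0"
    have "v = 0\<^sub>v d" if "v \<in> V" for v
    proof -
      have d: "dim_vec v = d" using that V(1) by auto
      then have "vec d (\<lambda>i. v $ i) = v" by auto
      then have "(\<lambda>i. v $ i) \<in> ?W" using that by simp
      then show ?thesis using z d by (intro eq_vecI) auto
    qed
    then show ?thesis using V(2) by blast
  next
    assume u: "?W = UNIV"
    have "v \<in> V" if "v \<in> carrier_vec d" for v
    proof -
      have "vec d (\<lambda>i. v $ i) \<in> V" using u by auto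
      moreover have "vec d (\<lambda>i. v $ i) = v" using that by auto
      ultimately show ?thesis by simp
    qed
    then show ?thesis using V(1) by blast
  qed
qed

lemma Irr_iff_matrix_irr:
  assumes G: "group G"
  shows "\<chi> \<in> Irr G \<longleftrightarrow> (\<exists>d r. matrix_irr G d r \<and> \<chi> = restrict (\<lambda>g. \<Sum>i<d. r g i i) (carrier G))"
proof
  assume "\<chi> \<in> Irr G"
  then obtain d \<rho> where irr: "irreducible_representation G d \<rho>"
    and \<chi>: "\<chi> = restrict (\<lambda>g. mat_trace (\<rho> g)) (carrier G)"
    by (auto simp: Irr_def)
  have "representation G d \<rho>" using irr by (simp add: irreducible_representation_def)
  from representation_matrix_rep(2)[OF G this]
  have "\<chi> = restrict (\<lambda>g. \<Sum>i<d. \<rho> g $$ (i, i)) (carrier G)"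
    unfolding \<chi> by (intro restrict_ext) (auto simp: mat_trace_def)
  then show "\<exists>d r. matrix_irr G d r \<and> \<chi> = restrict (\<lambda>g. \<Sum>i<d. r g i i) (carrier G)"
    using irreducible_representation_matrix_irr[OF G irr] by blast
next
  assume "\<exists>d r. matrix_irr G d r \<and> \<chi> = restrict (\<lambda>g. \<Sum>i<d. r g i i) (carrier G)"
  then obtain d r where irr: "matrix_irr G d r" and \<chi>: "\<chi> = restrict (\<lambda>g. \<Sum>i<d. r g i i) (carrier G)"
    by blast
  have "\<chi> = restrict (\<lambda>g. mat_trace (mat d d (\<lambda>(i, j). r g i j))) (carrier G)"
    unfolding \<chi> by (intro restrict_ext) (auto simp: mat_trace_def)
  then show "\<chi> \<in> Irr G"
    using matrix_irr_irreducible_representation[OF G irr] unfolding Irr_def by blast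
qed

section \<open>Schur orthogonality\<close>

lemma function_subspace_kernel: "function_subspace e {v. \<forall>i<d. (\<Sum>l<e. N i l * v l) = 0}"
  unfolding function_subspace_def
proof (intro conjI allI impI ballI CollectI)
  fix v w i assume "v \<in> {v. \<forall>i<d. (\<Sum>l<e. N i l * v l) = 0}" "\<forall>i<e. v i = w i" "i < d"
  moreover from this have "(\<Sum>l<e. N i l * w l) = (\<Sum>l<e. N i l * v l)"
    by (intro sum.cong) auto
  ultimately show "(\<Sum>l<e. N i l * w l) = 0" by simp
next
  fix c v i assume "v \<in> {v. \<forall>i<d. (\<Sum>l<e. N i l * v l) = 0}" "i < d"
  moreover have "(\<Sum>l<e. N i l * (c * v l)) = c * (\<Sum>l<e. N i l * v l)"
    by (simp add: sum_distrib_left mult_ac)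
  ultimately show "(\<Sum>l<e. N i l * (c * v l)) = 0" by simp
qed (auto simp: distrib_left sum.distrib)

lemma function_subspace_image: "function_subspace d {w. \<exists>v. \<forall>i<d. w i = (\<Sum>l<e. N i l * v l)}"
  unfolding function_subspace_def
proof (intro conjI allI impI ballI)
  show "(\<lambda>_. 0) \<in> {w. \<exists>v. \<forall>i<d. w i = (\<Sum>l<e. N i l * v l)}"
    by (auto intro!: exI[of _ "\<lambda>_. 0"])
next
  fix v w assume "v \<in> {w. \<exists>v. \<forall>i<d. w i = (\<Sum>l<e. N i l * v l)}"
    "w \<in> {w. \<exists>v. \<forall>i<d. w i = (\<Sum>l<e. N i l * v l)}"
  then obtain v' w' where "\<forall>i<d. v i = (\<Sum>l<e. N i l * v' l)" "\<forall>i<d. w i = (\<Sum>l<e. N i l * w' l)"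
    by auto
  then have "\<forall>i<d. v i + w i = (\<Sum>l<e. N i l * (v' l + w' l))"
    by (simp add: distrib_left sum.distrib)
  then show "(\<lambda>i. v i + w i) \<in> {w. \<exists>v. \<forall>i<d. w i = (\<Sum>l<e. N i l * v l)}" by (auto intro!: exI)
next
  fix c v assume "v \<in> {w. \<exists>v. \<forall>i<d. w i = (\<Sum>l<e. N i l * v l)}"
  then obtain v' where "\<forall>i<d. v i = (\<Sum>l<e. N i l * v' l)" by auto
  then have "\<forall>i<d. c * v i = (\<Sum>l<e. N i l * (c * v' l))"
    by (simp add: sum_distrib_left mult_ac)
  then show "(\<lambda>i. c * v i) \<in> {w. \<exists>v. \<forall>i<d. w i = (\<Sum>l<e. N i l * v l)}" by (auto intro!: exI)
qed auto

lemma sum_if_eq: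
  fixes f :: "nat \<Rightarrow> complex"
  assumes "i < d"
  shows "(\<Sum>k<d. (if i = k then 1 else 0) * f k) = f i"
    and "(\<Sum>k<d. (if k = i then 1 else 0) * f k) = f i"
    and "(\<Sum>k<d. f k * (if i = k then 1 else 0)) = f i"
    and "(\<Sum>k<d. f k * (if k = i then 1 else 0)) = f i"
  using assms by (simp_all add: if_distrib [of "\<lambda>x. x * _"] if_distrib [of "\<lambda>x. _ *
      x"] sum.delta sum.delta' cong: if_cong)

lemma sum_mult_assoc:
  fixes a :: "nat \<Rightarrow> complex"
  shows "(\<Sum>x<d. a x * (\<Sum>y<e. b x y * c y)) = (\<Sum>y<e. (\<Sum>x<d. a x * b x y) * c y)"
proof -
  have "(\<Sum>x<d. a x * (\<Sum>y<e. b x y * c y)) = (\<Sum>x<d. \<Sum>y<e. a x * b x y * c y)"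
    by (simp add: sum_distrib_left mult_ac)
  also have "\<dots> = (\<Sum>y<e. \<Sum>x<d. a x * b x y * c y)" by (rule sum.swap)
  finally show ?thesis by (simp add: sum_distrib_right)
qed

text \<open>A nonzero intertwiner has zero kernel and full image, hence a two-sided inverse
  \<open>R\<close>, and then tr r = tr (r N R) = tr (N s R) = tr (s R N) = tr s. Orthogonality needs
  only this equality of traces, not an isomorphism of representations.\<close>

lemma schur_intertwiner:
  assumes r: "matrix_irr G d r" and s: "matrix_irr G e s"
    and tw: "\<And>h i l. h \<in> carrier G \<Longrightarrow> i < d \<Longrightarrow> l < e \<Longrightarrow>
      (\<Sum>x<d. r h i x * N x l) = (\<Sum>x<e. N i x * s h x l)"
    and nz: "i0 < d" "l0 < e" "N i0 l0 \<noteq> 0"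
    and h: "h \<in> carrier G"
  shows "(\<Sum>i<d. r h i i) = (\<Sum>i<e. s h i i)"
proof -
  let ?K = "{v. \<forall>i<d. (\<Sum>l<e. N i l * v l) = 0}"
  let ?I = "{w. \<exists>v. \<forall>i<d. w i = (\<Sum>l<e. N i l * v l)}"
  let ?e = "\<lambda>l l'. if l' = l then 1 else (0 :: complex)"
  have tw': "(\<Sum>x<d. r h i x * (\<Sum>l<e. N x l * v l)) = (\<Sum>x<e. N i x * (\<Sum>l<e. s h x l * v l))"
    if "h \<in> carrier G" "i < d" for h i v
    unfolding sum_mult_assoc using tw that by (intro sum.cong) auto
  have mem: "(\<lambda>i. N i l0) \<in> ?I"
    using sum_if_eq(4)[OF nz(2)] by (intro CollectI exI[of _ "?e l0"]) simp
  have inv: "(\<lambda>i. \<Sum>j<d. r g i j * w j) \<in> ?I" if g: "g \<in> carrier G" and "w \<in> ?I" for g w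
  proof -
    from that obtain v where v: "\<forall>i<d. w i = (\<Sum>l<e. N i l * v l)" by auto
    have "(\<Sum>j<d. r g i j * w j) = (\<Sum>x<e. N i x * (\<Sum>l<e. s g x l * v l))" if "i < d" for i
      unfolding tw'[OF g that, symmetric] using v by (intro sum.cong) simp_all
    then show ?thesis
      by (intro CollectI exI[of _ "\<lambda>x. \<Sum>l<e. s g x l * v l"]) simp
  qed
  have I: "?I = UNIV"
    by (rule matrix_irrD[OF r function_subspace_image[where d = d and e = e and N = N] inv mem nz(1,3)])
  have K: "?K \<noteq> UNIV"
  proof
    assume K: "?K = UNIV"
    have "?e l0 \<in> ?K" unfolding K by (rule UNIV_I)
    then have "(\<Sum>l<e. N i0 l * ?e l0 l) = 0" using nz(1) by simp
    then show False unfolding sum_if_eq(4)[OF nz(2)] using nz(3) by simp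
  qed
  have K0: "v l = 0" if "v \<in> ?K" "l < e" for v l
  proof (rule ccontr)
    assume "v l \<noteq> 0"
    have inv: "(\<lambda>i. \<Sum>j<e. s g i j * w j) \<in> ?K" if g: "g \<in> carrier G" and w: "w \<in> ?K" for g w
    proof -
      have "(\<Sum>x<e. N i x * (\<Sum>l<e. s g x l * w l)) = 0" if "i < d" for i
        unfolding tw'[OF g that, symmetric] using w by simp
      then show ?thesis by simp
    qed
    have "?K = UNIV"
      by (rule matrix_irrD[OF s function_subspace_kernel[where d = d and e = e and N = N] inv that \<open>v l \<noteq> 0\<close>])
    with K show False by simp
  qed
  have "?e m \<in> ?I" for m unfolding I by simp
  then have "\<exists>v. \<forall>i<d. ?e m i = (\<Sum>l<e. N i l * v l)" for m by simp
  \<comment> \<open>\<open>R m\<close> is a preimage of the \<open>m\<close>-th unit vector, so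
    \<open>R\<close> is a right inverse of \<open>N\<close>. It is a left inverse as well, because N
    (R N - 1) = 0 and the kernel of \<open>N\<close> is zero.\<close>
  then obtain R where R: "\<And>m i. i < d \<Longrightarrow> ?e m i = (\<Sum>l<e. N i l * R m l)" by metis
  have RN: "(\<Sum>m<d. R m l * N m k) = (if l = k then 1 else 0)" if "l < e" "k < e" for l k
  proof -
    let ?v = "\<lambda>l. (\<Sum>m<d. R m l * N m k) - (if l = k then 1 else 0)"
    have v: "(\<Sum>l<e. N i l * ?v l) = 0" if i: "i < d" for i
    proof -
      have "(\<Sum>l<e. N i l * (\<Sum>m<d. R m l * N m k)) = (\<Sum>m<d. (\<Sum>l<e. N i l * R m l) * N m k)"
        by (rule sum_mult_assoc)
      also have "\<dots> = N i k"
        using i R[OF i, symmetric] by (simp add: sum_if_eq)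
      finally show ?thesis
        using sum_if_eq(4)[OF \<open>k < e\<close>, of "N i"] by (simp only: right_diff_distrib sum_subtractf diff_self)
    qed
    have "?v \<in> ?K" by (intro CollectI allI impI v)
    from K0[OF this \<open>l < e\<close>] show ?thesis by simp
  qed
  have "(\<Sum>i<d. r h i i) = (\<Sum>i<d. \<Sum>x<d. r h i x * (\<Sum>l<e. N x l * R i l))"
    by (intro sum.cong) (simp_all add: R[symmetric] sum_if_eq)
  also have "\<dots> = (\<Sum>i<d. \<Sum>x<e. N i x * (\<Sum>l<e. s h x l * R i l))"
    using h by (intro sum.cong refl tw') simp_all
  also have "\<dots> = (\<Sum>x<e. \<Sum>i<d. N i x * (\<Sum>l<e. s h x l * R i l))" by (rule sum.swap)
  also have "\<dots> = (\<Sum>x<e. \<Sum>l<e. s h x l * (\<Sum>i<d. R i l * N i x))"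
  proof (rule sum.cong[OF refl])
    fix x
    have "(\<Sum>i<d. N i x * (\<Sum>l<e. s h x l * R i l)) = (\<Sum>i<d. \<Sum>l<e. s h x l * (R i l * N i x))"
      by (simp add: sum_distrib_left mult_ac)
    also have "\<dots> = (\<Sum>l<e. \<Sum>i<d. s h x l * (R i l * N i x))" by (rule sum.swap)
    finally show "(\<Sum>i<d. N i x * (\<Sum>l<e. s h x l * R i l)) = (\<Sum>l<e. s h x l * (\<Sum>i<d. R i l * N i x))"
      by (simp add: sum_distrib_left)
  qed
  also have "\<dots> = (\<Sum>x<e. s h x x)"
    by (intro sum.cong) (simp_all add: RN sum_if_eq)
  finally show "(\<Sum>i<d. r h i i) = (\<Sum>i<e. s h i i)" .
qed

text \<open>Algebraic closedness of the complex numbers enters here, through the nonempty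
  spectrum.\<close>

lemma eigenvector_exists:
  fixes N :: "nat \<Rightarrow> nat \<Rightarrow> complex"
  assumes d: "d > 0"
  shows "\<exists>k v. (\<exists>i<d. v i \<noteq> 0) \<and> (\<forall>i<d. (\<Sum>j<d. N i j * v j) = k * v i)"
proof -
  let ?N = "mat d d (\<lambda>(i, j). N i j)"
  have "spectrum ?N \<noteq> {}" using d by (intro spectrum_non_empty) auto
  then obtain k where "eigenvalue ?N k" by (auto simp: spectrum_def)
  then obtain v where v: "v \<in> carrier_vec d" "v \<noteq> 0\<^sub>v d" "?N *\<^sub>v v = k \<cdot>\<^sub>v v"
    by (auto simp: eigenvalue_def eigenvector_def)
  have "\<exists>i<d. v $ i \<noteq> 0"
  proof (rule ccontr)
    assume "\<not> (\<exists>i<d. v $ i \<noteq> 0)"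
    then have "v = 0\<^sub>v d" using v(1) by (intro eq_vecI) auto
    then show False using v(2) by simp
  qed
  moreover have "(\<Sum>j<d. N i j * v $ j) = k * v $ i" if i: "i < d" for i
  proof -
    have "(?N *\<^sub>v v) $ i = (k \<cdot>\<^sub>v v) $ i" using v(3) by simp
    then show ?thesis using i v(1) by (auto simp: scalar_prod_def lessThan_atLeast0)
  qed
  ultimately show ?thesis by blast
qed

text \<open>For an eigenvalue \<open>k\<close> of \<open>N\<close>, the kernel of N - k is a nonzero
  invariant subspace, hence everything.\<close>

lemma schur_scalar:
  assumes r: "matrix_irr G d r"
    and tw: "\<And>h i l. h \<in> carrier G \<Longrightarrow> i < d \<Longrightarrow> l < d \<Longrightarrow>
      (\<Sum>x<d. r h i x * N x l) = (\<Sum>x<d. N i x * r h x l)"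
  shows "\<exists>k. \<forall>i<d. \<forall>j<d. N i j = (if i = j then k else 0)"
proof -
  have "d > 0" using r by (simp add: matrix_irr_def)
  then obtain k v where v: "\<exists>i<d. v i \<noteq> 0" "\<And>i. i < d \<Longrightarrow> (\<Sum>j<d. N i j * v j) = k * v i"
    using eigenvector_exists by blast
  let ?N = "\<lambda>i j. N i j - (if i = j then k else 0)"
  let ?K = "{v. \<forall>i<d. (\<Sum>l<d. ?N i l * v l) = 0}"
  have N: "(\<Sum>l<d. ?N i l * v l) = (\<Sum>l<d. N i l * v l) - k * v i" if "i < d" for i v
    using that by (simp add: left_diff_distrib sum_subtractf if_distrib [of "\<lambda>x. x *
        _"] sum.delta cong: if_cong)
  obtain i where i: "i < d" "v i \<noteq> 0" using v(1) by blast
  have mem: "v \<in> ?K" using v(2) by (simp add: N)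
  have inv: "(\<lambda>i. \<Sum>j<d. r g i j * w j) \<in> ?K" if g: "g \<in> carrier G" and "w \<in> ?K" for g w
  proof -
    have w: "(\<Sum>l<d. N i l * w l) = k * w i" if "i < d" for i
      using \<open>w \<in> ?K\<close> that by (simp add: N)
    have "(\<Sum>x<d. N i x * (\<Sum>l<d. r g x l * w l)) = k * (\<Sum>l<d. r g i l * w l)" if "i < d" for i
    proof -
      have "(\<Sum>x<d. N i x * (\<Sum>l<d. r g x l * w l)) = (\<Sum>x<d. r g i x * (\<Sum>l<d. N x l * w l))"
        unfolding sum_mult_assoc using tw[OF g that] by (intro sum.cong) auto
      also have "\<dots> = (\<Sum>x<d. k * (r g i x * w x))"
        using w by (intro sum.cong) simp_all
      finally show ?thesis by (simp add: sum_distrib_left)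
    qed
    then show ?thesis by (simp add: N)
  qed
  have "?K = UNIV"
    by (rule matrix_irrD[OF r function_subspace_kernel[where d = d and e = d and N = ?N] inv mem i])
  have "N i j = (if i = j then k else 0)" if "i < d" "j < d" for i j
  proof -
    have "(\<lambda>l. if l = j then 1 else 0) \<in> ?K" unfolding \<open>?K = UNIV\<close> by simp
    then have "(\<Sum>l<d. ?N i l * (if l = j then 1 else 0)) = 0" using that(1) by (elim CollectE) simp
    then show ?thesis unfolding sum_if_eq(4)[OF \<open>j < d\<close>] by simp
  qed
  then show ?thesis by blast
qed

text \<open>Averaging the elementary matrix with entry \<open>(j, k)\<close> over the group yields an intertwiner.\<close>

lemma average_intertwines:
  assumes G: "group G" and r: "matrix_rep G d r" and s: "matrix_rep G e s"
    and jk: "j < d" "k < e" and h: "h \<in> carrier G" and il: "i < d" "l < e"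
  defines "N \<equiv> \<lambda>i l. \<Sum>g\<in>carrier G. r g i j * s (inv\<^bsub>G\<^esub> g) k l"
  shows "(\<Sum>x<d. r h i x * N x l) = (\<Sum>x<e. N i x * s h x l)"
proof -
  interpret G: group G by fact
  have "(\<Sum>x<d. r h i x * N x l)
      = (\<Sum>g\<in>carrier G. \<Sum>x<d. r h i x * r g x j * s (inv\<^bsub>G\<^esub> g) k l)"
    unfolding N_def sum_distrib_left by (subst sum.swap) (simp add: mult_ac)
  also have "\<dots> = (\<Sum>g\<in>carrier G. r (h \<otimes>\<^bsub>G\<^esub> g) i j * s (inv\<^bsub>G\<^esub> g) k l)"
    using h il jk by (intro sum.cong) (simp_all add: matrix_repD(2)[OF r] sum_distrib_right)
  also have "\<dots> = (\<Sum>g\<in>carrier G. r g i j * s (inv\<^bsub>G\<^esub> g \<otimes>\<^bsub>G\<^esub> h) k l)"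
  proof (rule sum.reindex_bij_witness[of _ "\<lambda>g. inv\<^bsub>G\<^esub> h \<otimes>\<^bsub>G\<^esub> g" "\<lambda>g. h \<otimes>\<^bsub>G\<^esub> g"])
    fix a assume a: "a \<in> carrier G"
    show "inv\<^bsub>G\<^esub> h \<otimes>\<^bsub>G\<^esub> (h \<otimes>\<^bsub>G\<^esub> a) = a" "h \<otimes>\<^bsub>G\<^esub> (inv\<^bsub>G\<^esub> h \<otimes>\<^bsub>G\<^esub> a) = a"
      using a h by (simp_all add: G.m_assoc[symmetric])
    have "inv\<^bsub>G\<^esub> (h \<otimes>\<^bsub>G\<^esub> a) \<otimes>\<^bsub>G\<^esub> h = inv\<^bsub>G\<^esub> a"
      using a h by (simp add: G.inv_mult_group G.m_assoc)
    then show "r (h \<otimes>\<^bsub>G\<^esub> a) i j * s (inv\<^bsub>G\<^esub> (h \<otimes>\<^bsub>G\<^esub> a) \<otimes>\<^bsub>G\<^esub> h) k l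
        = r (h \<otimes>\<^bsub>G\<^esub> a) i j * s (inv\<^bsub>G\<^esub> a) k l" by simp
  qed (use h in auto)
  also have "\<dots> = (\<Sum>g\<in>carrier G. \<Sum>x<e. r g i j * s (inv\<^bsub>G\<^esub> g) k x * s h x l)"
    using h il jk by (intro sum.cong) (simp_all add: matrix_repD(2)[OF s] sum_distrib_left mult_ac)
  also have "\<dots> = (\<Sum>x<e. N i x * s h x l)"
    unfolding N_def sum_distrib_right by (subst sum.swap) simp
  finally show ?thesis .
qed

lemma trace_one:
  assumes "matrix_rep G d r"
  shows "(\<Sum>i<d. r \<one>\<^bsub>G\<^esub> i i) = of_nat d"
  using matrix_repD(1)[OF assms] by simp

lemma sum_trace_product:
  fixes r s :: "'a \<Rightarrow> nat \<Rightarrow> nat \<Rightarrow> complex"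
  shows "(\<Sum>g\<in>A. (\<Sum>i<d. r g i i) * (\<Sum>k<e. s (t g) k k)) = (\<Sum>i<d. \<Sum>k<e. \<Sum>g\<in>A. r g i i * s (t g) k k)"
  unfolding sum_product by (subst sum.swap) (rule sum.cong[OF refl], rule sum.swap)

text \<open>If an averaged matrix had a nonzero entry, \<open>schur_intertwiner\<close> would force
  the traces to agree at \<open>h\<close>. So all averaged entries vanish, and the sum of products
  of traces is a sum of such entries.\<close>

lemma matrix_irr_orthogonal:
  assumes G: "group G" and r: "matrix_irr G d r" and s: "matrix_irr G e s"
    and ne: "h \<in> carrier G" "(\<Sum>i<d. r h i i) \<noteq> (\<Sum>i<e. s h i i)"
  shows "(\<Sum>g\<in>carrier G. (\<Sum>i<d. r g i i) * (\<Sum>k<e. s (inv\<^bsub>G\<^esub> g) k k)) = 0"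
proof -
  have r': "matrix_rep G d r" and s': "matrix_rep G e s" using r s by (auto simp: matrix_irr_def)
  have z: "(\<Sum>g\<in>carrier G. r g i i * s (inv\<^bsub>G\<^esub> g) k k) = 0" if ik: "i < d" "k < e" for i k
  proof (rule ccontr)
    assume "(\<Sum>g\<in>carrier G. r g i i * s (inv\<^bsub>G\<^esub> g) k k) \<noteq> 0"
    from schur_intertwiner[OF r s average_intertwines[OF G r' s' ik] ik this ne(1)] ne(2)
    show False by simp
  qed
  show ?thesis unfolding sum_trace_product using z by simp
qed

text \<open>The averaged matrix is a scalar matrix by Schur's lemma. Its trace collapses to the
  value of \<open>r\<close> at the identity, so the scalar times \<open>d\<close> is the group order
  if \<open>i = k\<close> and 0 otherwise.\<close>

lemma matrix_irr_norm:
  assumes G: "group G" and r: "matrix_irr G d r"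
  shows "(\<Sum>g\<in>carrier G. (\<Sum>i<d. r g i i) * (\<Sum>k<d. r (inv\<^bsub>G\<^esub> g) k k)) = of_nat (card (carrier G))"
proof -
  interpret G: group G by fact
  have r': "matrix_rep G d r" and d: "d > 0" using r by (auto simp: matrix_irr_def)
  have z: "of_nat d * (\<Sum>g\<in>carrier G. r g i i * r (inv\<^bsub>G\<^esub> g) k k)
      = (if i = k then of_nat (card (carrier G)) else 0)" if ik: "i < d" "k < d" for i k
  proof -
    define N where "N = (\<lambda>x y. \<Sum>g\<in>carrier G. r g x i * r (inv\<^bsub>G\<^esub> g) k y)"
    from schur_scalar[OF r average_intertwines[OF G r' r' ik]] obtain c
      where c: "\<And>x y. x < d \<Longrightarrow> y < d \<Longrightarrow> N x y = (if x = y then c else 0)"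
      unfolding N_def by blast
    have "of_nat d * c = (\<Sum>x<d. N x x)" using c by simp
    also have "\<dots> = (\<Sum>g\<in>carrier G. \<Sum>x<d. r (inv\<^bsub>G\<^esub> g) k x * r g x i)"
      unfolding N_def by (subst sum.swap) (simp add: mult_ac)
    also have "\<dots> = (\<Sum>g\<in>carrier G. r (inv\<^bsub>G\<^esub> g \<otimes>\<^bsub>G\<^esub> g) k i)"
      using ik by (intro sum.cong refl matrix_repD(2)[OF r', symmetric]) simp_all
    also have "\<dots> = (if i = k then of_nat (card (carrier G)) else 0)"
      using ik by (simp add: matrix_repD(1)[OF r'])
    finally show ?thesis using c[OF ik] unfolding N_def by (auto split: if_splits)
  qed
  have "of_nat d * (\<Sum>g\<in>carrier G. (\<Sum>i<d. r g i i) * (\<Sum>k<d. r (inv\<^bsub>G\<^esub> g) k k))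
      = (\<Sum>i<d. \<Sum>k<d. of_nat d * (\<Sum>g\<in>carrier G. r g i i * r (inv\<^bsub>G\<^esub> g) k k))"
    unfolding sum_trace_product by (simp only: sum_distrib_left)
  also have "\<dots> = (\<Sum>i<d. \<Sum>k<d. if i = k then of_nat (card (carrier G)) else 0)"
    using z by (intro sum.cong) auto
  also have "\<dots> = of_nat d * of_nat (card (carrier G))" by simp
  finally show ?thesis using d by simp
qed

section \<open>Splitting along an invariant subspace\<close>

text \<open>A biorthogonal system plays the role of a basis together with its dual basis; in such a basis a
  representation with an invariant subspace is block triangular, and its trace is the sum of the traces
  of the two diagonal blocks. This replaces Maschke's theorem.\<close>

definition biorthogonal :: "nat \<Rightarrow> nat \<Rightarrow> (nat \<Rightarrow> nat \<Rightarrow> complex) \<Rightarrow> (nat \<Rightarrow> nat \<Rightarrow> complex) \<Rightarrow> bool" where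
  "biorthogonal d k u l \<longleftrightarrow> (\<forall>i<k. \<forall>j<k. (\<Sum>x<d. l i x * u j x) = (if i = j then 1 else 0))"

lemma biorthogonalD: "biorthogonal d k u l \<Longrightarrow> i < k \<Longrightarrow> j < k \<Longrightarrow> (\<Sum>x<d. l i x * u j x) = (if i = j then 1 else 0)"
  by (simp add: biorthogonal_def)

text \<open>If \<open>k\<close> exceeded \<open>d\<close>, padding with zeros would turn both
  systems into square matrices of size \<open>k\<close> with product 1, although the first of them
  kills the unit vector with index \<open>d\<close>.\<close>

lemma biorthogonal_le:
  assumes b: "biorthogonal d k u l"
  shows "k \<le> d"
proof (rule ccontr)
  assume "\<not> k \<le> d"
  then have dk: "d < k" by simp
  let ?L = "mat k k (\<lambda>(i, x). if x < d then l i x else 0)"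
  let ?P = "mat k k (\<lambda>(x, j). if x < d then u j x else 0)"
  have "?L * ?P = 1\<^sub>m k"
  proof (intro eq_matI)
    fix i j assume ij: "i < dim_row (1\<^sub>m k :: complex mat)" "j < dim_col (1\<^sub>m k :: complex mat)"
    then have "(?L * ?P) $$ (i, j) = (\<Sum>x<k. (if x < d then l i x else 0) * (if x < d then u j x else 0))"
      by (simp add: scalar_prod_def lessThan_atLeast0)
    also have "\<dots> = (\<Sum>x<d. l i x * u j x)"
      using dk by (intro sum.mono_neutral_cong_right) auto
    finally show "(?L * ?P) $$ (i, j) = 1\<^sub>m k $$ (i, j)"
      using ij biorthogonalD[OF b, of i j] by simp
  qed auto
  moreover have "det (?L * ?P) = det ?L * det ?P" by (rule det_mult) auto
  ultimately have LP: "det ?L * det ?P = 1" by (simp del: index_mult_mat)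
  have L: "?L \<in> carrier_mat k k" by simp
  have "det ?L = 0"
  proof -
    have "?L *\<^sub>v unit_vec k d = 0\<^sub>v k"
      using dk by (intro eq_vecI) (auto simp: scalar_prod_def unit_vec_def intro!: sum.neutral)
    moreover have "unit_vec k d \<noteq> (0\<^sub>v k :: complex vec)" using dk by (simp add: unit_vec_nonzero)
    ultimately have "\<exists>v. v \<in> carrier_vec k \<and> v \<noteq> 0\<^sub>v k \<and> ?L *\<^sub>v v = 0\<^sub>v k"
      by (intro exI[of _ "unit_vec k d"] conjI unit_vec_carrier)
    then show ?thesis unfolding det_0_iff_vec_prod_zero_field[OF L] .
  qed
  with LP show False by simp
qed

lemma function_subspaceD:
  assumes "function_subspace d W"
  shows "v \<in> W \<Longrightarrow> (\<And>i. i < d \<Longrightarrow> v i = w i) \<Longrightarrow> w \<in> W" and "(\<lambda>_. 0) \<in> W"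
    and "v \<in> W \<Longrightarrow> w \<in> W \<Longrightarrow> (\<lambda>i. v i + w i) \<in> W" and "v \<in> W \<Longrightarrow> (\<lambda>i. c * v i) \<in> W"
  using assms unfolding function_subspace_def by blast+

lemma function_subspace_sum:
  fixes k :: nat
  assumes W: "function_subspace d W" and u: "\<And>j. j < k \<Longrightarrow> u j \<in> W"
  shows "(\<lambda>x. \<Sum>j<k. c j * u j x) \<in> W"
  using u
proof (induction k)
  case 0
  then show ?case using W by (simp add: function_subspace_def)
next
  case (Suc k)
  then have "(\<lambda>x. \<Sum>j<k. c j * u j x) \<in> W" by simp
  moreover have "(\<lambda>x. c k * u k x) \<in> W" using W Suc.prems by (auto simp: function_subspace_def)
  ultimately show ?case using W by (simp add: function_subspace_def)
qed

text \<open>A Gram-Schmidt process with a dual system in place of an inner product: while some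
  \<open>w\<close> in \<open>W\<close> is not reproduced by the system, its residual is adjoined.
  The bound \<open>k \<le> d\<close> makes the induction on \<open>d - k\<close> work.\<close>

lemma biorthogonal_extend:
  assumes W: "function_subspace d W" and b: "biorthogonal d k u l" and u: "\<And>j. j < k \<Longrightarrow> u j \<in> W"
  shows "\<exists>k' u' l'. k \<le> k' \<and> biorthogonal d k' u' l' \<and> (\<forall>j<k'. u' j \<in> W) \<and>
    (\<forall>j<k. u' j = u j \<and> l' j = l j) \<and>
    (\<forall>w\<in>W. \<forall>x<d. w x = (\<Sum>j<k'. (\<Sum>y<d. l' j y * w y) * u' j x))"
  using b u
proof (induction "d - k" arbitrary: k u l rule: less_induct)
  case less
  show ?case
  proof (cases "\<forall>w\<in>W. \<forall>x<d. w x = (\<Sum>j<k. (\<Sum>y<d. l j y * w y) * u j x)")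
    case True
    then show ?thesis using less.prems by blast
  next
    case False
    then obtain w x0 where w: "w \<in> W" "x0 < d" "w x0 \<noteq> (\<Sum>j<k. (\<Sum>y<d. l j y * w y) * u j x0)"
      by blast
    define v where "v = (\<lambda>x. w x - (\<Sum>j<k. (\<Sum>y<d. l j y * w y) * u j x))"
    have lc: "(\<Sum>x<d. l i x * (\<Sum>j<k. c j * u j x)) = c i" if "i < k" for i c
    proof -
      have "(\<Sum>x<d. l i x * (\<Sum>j<k. c j * u j x)) = (\<Sum>x<d. l i x * (\<Sum>j<k. u j x * c j))"
        by (simp add: mult.commute)
      also have "\<dots> = (\<Sum>j<k. (\<Sum>x<d. l i x * u j x) * c j)" by (rule sum_mult_assoc)
      also have "\<dots> = c i" using that biorthogonalD[OF less.prems(1)] by (simp add: sum_if_eq(1))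
      finally show ?thesis .
    qed
    have v0: "v x0 \<noteq> 0" using w by (simp add: v_def)
    have lv: "(\<Sum>x<d. l i x * v x) = 0" if "i < k" for i
      unfolding v_def right_diff_distrib sum_subtractf lc[OF that] by simp
    have vW: "v \<in> W"
    proof -
      have "(\<lambda>x. \<Sum>j<k. (\<Sum>y<d. l j y * w y) * u j x) \<in> W"
        by (rule function_subspace_sum[OF W less.prems(2)])
      from function_subspaceD(3)[OF W w(1) function_subspaceD(4)[OF W this, of "-1"]]
      show ?thesis by (simp add: v_def)
    qed
    \<comment> \<open>\<open>m\<close> reads off coordinate \<open>x0\<close> of the residual of a
      vector and divides by \<open>v x0\<close>. Hence it takes the value 1 on \<open>v\<close> and
      0 on every earlier \<open>u j\<close>.\<close>
    define m where "m = (\<lambda>x. ((if x = x0 then 1 else 0) - (\<Sum>j<k. u j x0 * l j x)) / v x0)"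
    have mv: "(\<Sum>x<d. m x * z x) = (z x0 - (\<Sum>j<k. u j x0 * (\<Sum>x<d. l j x * z x))) / v x0" for z
    proof -
      have "(\<Sum>x<d. (\<Sum>j<k. u j x0 * l j x) * z x) = (\<Sum>j<k. u j x0 * (\<Sum>x<d. l j x * z x))"
        by (rule sum_mult_assoc[symmetric])
      moreover have "(\<Sum>x<d. m x * z x)
          = ((\<Sum>x<d. (if x = x0 then 1 else 0) * z x) - (\<Sum>x<d. (\<Sum>j<k. u j x0 * l j x) * z x)) / v x0"
        by (simp only: m_def times_divide_eq_left left_diff_distrib sum_subtractf sum_divide_distrib[symmetric])
      ultimately show ?thesis using w(2) by (simp add: sum_if_eq)
    qed
    let ?u = "u(k := v)" and ?l = "l(k := m)"
    have b': "biorthogonal d (Suc k) ?u ?l"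
      unfolding biorthogonal_def
    proof (intro allI impI)
      fix i j assume ij: "i < Suc k" "j < Suc k"
      have 1: "(\<Sum>x<d. m x * v x) = 1" using v0 lv by (simp add: mv)
      have 2: "(\<Sum>x<d. m x * u j x) = 0" if "j < k" for j
      proof -
        have "(\<Sum>i<k. u i x0 * (\<Sum>x<d. l i x * u j x)) = u j x0"
          using that biorthogonalD[OF less.prems(1)] by (simp add: sum_if_eq(4))
        then show ?thesis by (simp add: mv)
      qed
      show "(\<Sum>x<d. ?l i x * ?u j x) = (if i = j then 1 else 0)"
        using ij 1 2 lv biorthogonalD[OF less.prems(1)] by (auto simp: less_Suc_eq)
    qed
    have "Suc k \<le> d" using biorthogonal_le[OF b'] .
    then have "d - Suc k < d - k" by simp
    moreover have "?u j \<in> W" if "j < Suc k" for j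
      using that vW less.prems(2) by (auto simp: less_Suc_eq)
    ultimately obtain k' u' l'
      where *: "Suc k \<le> k'" "biorthogonal d k' u' l'" "\<forall>j<k'. u' j \<in> W"
        "\<forall>j<Suc k. u' j = ?u j \<and> l' j = ?l j"
        "\<forall>w\<in>W. \<forall>x<d. w x = (\<Sum>j<k'. (\<Sum>y<d. l' j y * w y) * u' j x)"
      using less.hyps[OF _ b'] by blast
    have "\<forall>j<k. u' j = u j \<and> l' j = l j" using *(4) by auto
    then show ?thesis using *(1) by (intro exI[of _ k'] exI[of _ u'] exI[of _ l'] conjI *(2,3,5)) simp_all
  qed
qed

text \<open>Expanding unit vectors shows that the one-sided inverse is two-sided; taking the traces
  of both products then compares \<open>k\<close> with \<open>d\<close>.\<close>

lemma biorthogonal_complete: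
  assumes b: "biorthogonal d k u l"
    and sp: "\<forall>w. \<forall>x<d. w x = (\<Sum>j<k. (\<Sum>y<d. l j y * w y) * u j x)"
  shows "k = d" and "\<And>x y. x < d \<Longrightarrow> y < d \<Longrightarrow> (\<Sum>j<k. u j x * l j y) = (if x = y then 1 else 0)"
proof -
  show *: "(\<Sum>j<k. u j x * l j y) = (if x = y then 1 else 0)" if "x < d" "y < d" for x y
    using sp[THEN spec, of "\<lambda>x. if x = y then 1 else 0"] that
    by (simp add: sum_if_eq(4) mult.commute)
  have "of_nat k = (\<Sum>j<k. \<Sum>x<d. l j x * u j x)" using biorthogonalD[OF b] by simp
  also have "\<dots> = (\<Sum>x<d. \<Sum>j<k. u j x * l j x)" by (subst sum.swap) (simp add: mult.commute)
  also have "\<dots> = of_nat d" using * by simp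
  finally show "k = d" by simp
qed

text \<open>The system is built in two stages, first inside \<open>W\<close> and then in the whole
  space, so that the first \<open>k\<close> basis vectors span \<open>W\<close>. The second diagonal
  block is the action on the quotient by \<open>W\<close>; no invariant complement is
  constructed.\<close>

lemma matrix_rep_split:
  assumes r: "matrix_rep G d r" and W: "function_subspace d W"
    and inv: "\<And>g w. g \<in> carrier G \<Longrightarrow> w \<in> W \<Longrightarrow> (\<lambda>i. \<Sum>j<d. r g i j * w j) \<in> W"
    and nz: "w0 \<in> W" "i0 < d" "w0 i0 \<noteq> 0" and nu: "W \<noteq> UNIV"
  shows "\<exists>k s t. 0 < k \<and> k < d \<and> matrix_rep G k s \<and> matrix_rep G (d - k) t \<and>
    (\<forall>g\<in>carrier G. (\<Sum>i<d. r g i i) = (\<Sum>i<k. s g i i) + (\<Sum>i<d-k. t g i i))"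
proof -
  have "biorthogonal d 0 u l" for u l by (simp add: biorthogonal_def)
  from biorthogonal_extend[OF W this] obtain k u1 l1
    where 1: "biorthogonal d k u1 l1" "\<forall>j<k. u1 j \<in> W"
      "\<forall>w\<in>W. \<forall>x<d. w x = (\<Sum>j<k. (\<Sum>y<d. l1 j y * w y) * u1 j x)" by blast
  have "function_subspace d (UNIV :: (nat \<Rightarrow> complex) set)" by (simp add: function_subspace_def)
  from biorthogonal_extend[OF this 1(1)] obtain k' u l
    where 2: "k \<le> k'" "biorthogonal d k' u l" "\<forall>j<k. u j = u1 j \<and> l j = l1 j"
      "\<forall>w\<in>UNIV. \<forall>x<d. w x = (\<Sum>j<k'. (\<Sum>y<d. l j y * w y) * u j x)" by blast
  have sp: "\<forall>w. \<forall>x<d. w x = (\<Sum>j<k'. (\<Sum>y<d. l j y * w y) * u j x)"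
    by (rule allI) (rule bspec[OF 2(4) UNIV_I])
  note kd = biorthogonal_complete(1)[OF 2(2) sp]
  have id: "(\<Sum>j<d. u j x * l j y) = (if x = y then 1 else 0)" if "x < d" "y < d" for x y
    using biorthogonal_complete(2)[OF 2(2) sp] that unfolding kd by blast
  have b: "(\<Sum>x<d. l i x * u j x) = (if i = j then 1 else 0)" if "i < d" "j < d" for i j
    using biorthogonalD[OF 2(2)] that unfolding kd by blast
  have spW: "w x = (\<Sum>j<k. (\<Sum>y<d. l j y * w y) * u j x)" if "w \<in> W" "x < d" for w x
    using 1(3)[rule_format, OF that] 2(3) by simp
  \<comment> \<open>The matrix of \<open>g\<close> in the new basis: \<open>r g\<close> conjugated
    by the columns \<open>u\<close>, with the rows \<open>l\<close> as inverse.\<close>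
  define B where "B = (\<lambda>g i j. \<Sum>x<d. l i x * (\<Sum>y<d. r g x y * u j y))"
  have B: "matrix_rep G d B"
    unfolding matrix_rep_def
  proof (intro conjI allI impI ballI)
    fix i j assume ij: "i < d" "j < d"
    have "(\<Sum>y<d. r \<one>\<^bsub>G\<^esub> x y * u j y) = u j x" if "x < d" for x
      using matrix_repD(1)[OF r] that by (simp add: sum_if_eq)
    then show "B \<one>\<^bsub>G\<^esub> i j = (if i = j then 1 else 0)" using b[OF ij] by (simp add: B_def)
  next
    fix g h i j assume gh: "g \<in> carrier G" "h \<in> carrier G" and ij: "i < d" "j < d"
    define v where "v = (\<lambda>x. \<Sum>y<d. r h x y * u j y)"
    have v: "(\<Sum>k<d. u k y * B h k j) = v y" if "y < d" for y
    proof -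
      have "(\<Sum>k<d. u k y * B h k j) = (\<Sum>k<d. u k y * (\<Sum>x<d. l k x * v x))"
        by (simp add: B_def v_def)
      also have "\<dots> = (\<Sum>x<d. (\<Sum>k<d. u k y * l k x) * v x)" by (rule sum_mult_assoc)
      also have "\<dots> = v y" using id that by (simp add: sum_if_eq)
      finally show ?thesis .
    qed
    have "(\<Sum>k<d. B g i k * B h k j) = (\<Sum>k<d. (\<Sum>x<d. l i x * (\<Sum>y<d. r g x y * u k y)) * B h k j)"
      by (simp add: B_def)
    also have "\<dots> = (\<Sum>x<d. l i x * (\<Sum>k<d. (\<Sum>y<d. r g x y * u k y) * B h k j))"
      by (rule sum_mult_assoc[symmetric])
    also have "\<dots> = (\<Sum>x<d. l i x * (\<Sum>y<d. r g x y * (\<Sum>k<d. u k y * B h k j)))"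
      by (simp only: sum_mult_assoc)
    also have "\<dots> = (\<Sum>x<d. l i x * (\<Sum>y<d. r g x y * v y))"
      using v by simp
    also have "\<dots> = (\<Sum>x<d. l i x * (\<Sum>y<d. r (g \<otimes>\<^bsub>G\<^esub> h) x y * u j y))"
    proof (intro sum.cong refl)
      fix x assume "x \<in> {..<d}"
      then show "l i x * (\<Sum>y<d. r g x y * v y) = l i x * (\<Sum>y<d. r (g \<otimes>\<^bsub>G\<^esub> h) x y * u j y)"
        using matrix_repD(2)[OF r gh] unfolding v_def sum_mult_assoc by simp
    qed
    also have "\<dots> = B (g \<otimes>\<^bsub>G\<^esub> h) i j" by (simp add: B_def)
    finally show "B (g \<otimes>\<^bsub>G\<^esub> h) i j = (\<Sum>k<d. B g i k * B h k j)" by simp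
  qed
  have tr: "(\<Sum>i<d. B g i i) = (\<Sum>i<d. r g i i)" if "g \<in> carrier G" for g
  proof -
    have "(\<Sum>i<d. B g i i) = (\<Sum>i<d. \<Sum>y<d. (\<Sum>x<d. l i x * r g x y) * u i y)"
      unfolding B_def by (intro sum.cong refl sum_mult_assoc)
    also have "\<dots> = (\<Sum>y<d. \<Sum>i<d. u i y * (\<Sum>x<d. l i x * r g x y))"
      by (subst sum.swap) (simp add: mult.commute)
    also have "\<dots> = (\<Sum>y<d. \<Sum>x<d. (\<Sum>i<d. u i y * l i x) * r g x y)"
      by (intro sum.cong[OF refl] sum_mult_assoc)
    also have "\<dots> = (\<Sum>y<d. r g y y)" using id by (simp add: sum_if_eq)
    finally show ?thesis .
  qed
  \<comment> \<open>The image of a basis vector of \<open>W\<close> stays in \<open>W\<close>, so it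
    expands in the first \<open>k\<close> basis vectors, which the later dual vectors
    annihilate.\<close>
  have B0: "B g i j = 0" if g: "g \<in> carrier G" and ij: "j < k" "k \<le> i" "i < d" for g i j
  proof -
    define w where "w = (\<lambda>x. \<Sum>y<d. r g x y * u j y)"
    have "w \<in> W" unfolding w_def using inv[OF g] 1(2) 2(3) ij by auto
    define c where "c = (\<lambda>j. \<Sum>y<d. l j y * w y)"
    have wc: "w x = (\<Sum>j<k. u j x * c j)" if "x < d" for x
      unfolding c_def using spW[OF \<open>w \<in> W\<close> that] by (simp only: mult.commute)
    have "B g i j = (\<Sum>x<d. l i x * w x)" by (simp add: B_def w_def)
    also have "\<dots> = (\<Sum>x<d. l i x * (\<Sum>j<k. u j x * c j))"
      by (simp add: wc)
    also have "\<dots> = (\<Sum>j<k. (\<Sum>x<d. l i x * u j x) * c j)" by (rule sum_mult_assoc)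
    also have "\<dots> = 0" using b ij by (intro sum.neutral) auto
    finally show ?thesis .
  qed
  have "k \<noteq> 0"
  proof
    assume "k = 0"
    then show False using spW[OF nz(1,2)] nz(3) by simp
  qed
  moreover have "k \<noteq> d"
  proof
    assume "k = d"
    have "w \<in> W" for w
    proof -
      have mem: "(\<lambda>x. \<Sum>j<d. (\<Sum>y<d. l j y * w y) * u j x) \<in> W"
        by (rule function_subspace_sum[OF W]) (use 1(2) 2(3) \<open>k = d\<close> in simp)
      have "\<forall>x<d. w x = (\<Sum>j<d. (\<Sum>y<d. l j y * w y) * u j x)"
        by (rule spec[OF sp[unfolded kd]])
      from function_subspaceD(1)[OF W mem this[rule_format, symmetric]] show ?thesis .
    qed
    then show False using nu by auto
  qed
  ultimately have k: "0 < k" "k < d" using 2(1) kd by auto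
  have split: "(\<Sum>i<d. f i) = (\<Sum>i<k. f i) + (\<Sum>i<d-k. f (k + i))" for f :: "nat \<Rightarrow> complex"
  proof -
    have "(\<Sum>i<d. f i) = (\<Sum>i<k. f i) + (\<Sum>i\<in>{k..<d}. f i)"
      using k by (subst sum.union_disjoint[symmetric]) (auto simp: ivl_disj_un_one)
    also have "(\<Sum>i\<in>{k..<d}. f i) = (\<Sum>i<d-k. f (k + i))"
      by (rule sum.reindex_bij_witness[of _ "\<lambda>i. k + i" "\<lambda>i. i - k"]) auto
    finally show ?thesis .
  qed
  have s: "matrix_rep G k B"
    unfolding matrix_rep_def
  proof (intro conjI allI impI ballI)
    fix g h i j assume gh: "g \<in> carrier G" "h \<in> carrier G" and ij: "i < k" "j < k"
    then show "B (g \<otimes>\<^bsub>G\<^esub> h) i j = (\<Sum>m<k. B g i m * B h m j)"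
      using matrix_repD(2)[OF B gh, of i j] k B0[OF gh(2)] by (simp add: split)
  qed (use matrix_repD(1)[OF B] k in auto)
  have t: "matrix_rep G (d - k) (\<lambda>g i j. B g (k + i) (k + j))"
    unfolding matrix_rep_def
  proof (intro conjI allI impI ballI)
    fix g h i j assume gh: "g \<in> carrier G" "h \<in> carrier G" and ij: "i < d - k" "j < d - k"
    then show "B (g \<otimes>\<^bsub>G\<^esub> h) (k + i) (k + j) = (\<Sum>m<d-k. B g (k + i) (k + m) * B h (k + m) (k + j))"
      using matrix_repD(2)[OF B gh, of "k + i" "k + j"] k B0[OF gh(1)] by (simp add: split)
  qed (use matrix_repD(1)[OF B] k in auto)
  have "\<forall>g\<in>carrier G. (\<Sum>i<d. r g i i) = (\<Sum>i<k. B g i i) + (\<Sum>i<d-k. B g (k + i) (k + i))"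
  proof
    fix g assume "g \<in> carrier G"
    then show "(\<Sum>i<d. r g i i) = (\<Sum>i<k. B g i i) + (\<Sum>i<d-k. B g (k + i) (k + i))"
      unfolding tr[symmetric, OF \<open>g \<in> carrier G\<close>] by (intro split)
  qed
  then show ?thesis
    by (intro exI[of _ k] exI[of _ B] exI[of _ "\<lambda>g i j. B g (k + i) (k + j)"] conjI k s t)
qed

section \<open>Virtual characters\<close>

lemma IrrE:
  assumes "group G" "\<chi> \<in> Irr G"
  obtains d r where "matrix_irr G d r" "\<chi> = restrict (\<lambda>g. \<Sum>i<d. r g i i) (carrier G)"
  using assms(2) unfolding Irr_iff_matrix_irr[OF assms(1)] by (elim exE conjE) (rule that)

text \<open>The finite set \<open>S\<close> gives the integer combination a meaning without prior
  knowledge that \<open>Irr G\<close> is finite. Agreement is demanded on the carrier only, since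
  members of \<open>Irr G\<close> are extensional.\<close>

definition virtual :: "('a, 'b) monoid_scheme \<Rightarrow> ('a \<Rightarrow> complex) \<Rightarrow> bool" where
  "virtual G \<phi> \<longleftrightarrow> (\<exists>S m. finite S \<and> S \<subseteq> Irr G \<and>
     (\<forall>g\<in>carrier G. \<phi> g = (\<Sum>\<chi>\<in>S. of_int (m \<chi>) * \<chi> g)))"

lemma virtualI:
  assumes "finite S" "S \<subseteq> Irr G" "\<And>g. g \<in> carrier G \<Longrightarrow> \<phi> g = (\<Sum>\<chi>\<in>S. of_int (m \<chi>) * \<chi> g)"
  shows "virtual G \<phi>"
  using assms unfolding virtual_def by blast

lemma virtual_cong:
  assumes "virtual G \<phi>" "\<And>g. g \<in> carrier G \<Longrightarrow> \<phi> g = \<psi> g"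
  shows "virtual G \<psi>"
proof -
  obtain S m where S: "finite S" "S \<subseteq> Irr G" "\<And>g. g \<in> carrier G \<Longrightarrow> \<phi> g = (\<Sum>\<chi>\<in>S. of_int (m \<chi>) * \<chi> g)"
    using assms(1) unfolding virtual_def by blast
  show ?thesis by (rule virtualI[OF S(1,2), where m = m]) (simp add: S(3)[symmetric] assms(2))
qed

lemma virtual_Irr:
  assumes "\<chi> \<in> Irr G"
  shows "virtual G \<chi>"
  using assms by (intro virtualI[of "{\<chi>}" _ _ "\<lambda>_. 1"]) auto

lemma virtual_0: "virtual G (\<lambda>_. 0)"
  by (intro virtualI[of "{}"]) auto

lemma virtual_add:
  assumes "virtual G \<phi>" "virtual G \<psi>"
  shows "virtual G (\<lambda>g. \<phi> g + \<psi> g)"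
proof -
  obtain S m where S: "finite S" "S \<subseteq> Irr G" "\<And>g. g \<in> carrier G \<Longrightarrow> \<phi> g = (\<Sum>\<chi>\<in>S. of_int (m \<chi>) * \<chi> g)"
    using assms(1) unfolding virtual_def by blast
  obtain T k where T: "finite T" "T \<subseteq> Irr G" "\<And>g. g \<in> carrier G \<Longrightarrow> \<psi> g = (\<Sum>\<chi>\<in>T. of_int (k \<chi>) * \<chi> g)"
    using assms(2) unfolding virtual_def by blast
  let ?m = "\<lambda>\<chi>. (if \<chi> \<in> S then m \<chi> else 0) + (if \<chi> \<in> T then k \<chi> else 0)"
  show ?thesis
  proof (rule virtualI[of "S \<union> T" _ _ ?m])
    fix g assume g: "g \<in> carrier G"
    have "\<phi> g = (\<Sum>\<chi>\<in>S \<union> T. of_int (if \<chi> \<in> S then m \<chi> else 0) * \<chi> g)"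
      unfolding S(3)[OF g] using S(1) T(1) by (intro sum.mono_neutral_cong_left) auto
    moreover have "\<psi> g = (\<Sum>\<chi>\<in>S \<union> T. of_int (if \<chi> \<in> T then k \<chi> else 0) * \<chi> g)"
      unfolding T(3)[OF g] using S(1) T(1) by (intro sum.mono_neutral_cong_left) auto
    ultimately show "\<phi> g + \<psi> g = (\<Sum>\<chi>\<in>S \<union> T. of_int (?m \<chi>) * \<chi> g)"
      by (simp only: of_int_add distrib_right sum.distrib)
  qed (use S T in auto)
qed

lemma virtual_scale:
  assumes "virtual G \<phi>"
  shows "virtual G (\<lambda>g. of_int c * \<phi> g)"
proof -
  obtain S m where S: "finite S" "S \<subseteq> Irr G" "\<And>g. g \<in> carrier G \<Longrightarrow> \<phi> g = (\<Sum>\<chi>\<in>S. of_int (m \<chi>) * \<chi> g)"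
    using assms unfolding virtual_def by blast
  show ?thesis
    by (rule virtualI[OF S(1,2), of _ "\<lambda>\<chi>. c * m \<chi>"]) (simp add: S(3) sum_distrib_left mult.assoc)
qed

lemma virtual_diff:
  assumes "virtual G \<phi>" "virtual G \<psi>"
  shows "virtual G (\<lambda>g. \<phi> g - \<psi> g)"
  using virtual_add[OF assms(1) virtual_scale[OF assms(2), of "-1"]] by simp

lemma virtual_sum:
  assumes "finite A" "\<And>a. a \<in> A \<Longrightarrow> virtual G (f a)"
  shows "virtual G (\<lambda>g. \<Sum>a\<in>A. f a g)"
  using assms by (induction A rule: finite_induct) (auto intro: virtual_0 virtual_add)

lemma matrix_irr_trace_Irr:
  assumes "group G" "matrix_irr G d r"
  shows "restrict (\<lambda>g. \<Sum>i<d. r g i i) (carrier G) \<in> Irr G"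
  using assms(2) unfolding Irr_iff_matrix_irr[OF assms(1)] by blast

text \<open>Induction on the degree: a reducible representation has the trace of two representations
  of smaller positive degree.\<close>

lemma matrix_rep_virtual:
  assumes G: "group G" and r: "matrix_rep G d r"
  shows "virtual G (\<lambda>g. \<Sum>i<d. r g i i)"
  using r
proof (induction d arbitrary: r rule: less_induct)
  case (less d)
  consider "d = 0" | "matrix_irr G d r" | "d > 0" "\<not> matrix_irr G d r" by blast
  then show ?case
  proof cases
    case 1
    then show ?thesis by (simp add: virtual_0)
  next
    case 2
    then show ?thesis
      by (intro virtual_cong[OF virtual_Irr[OF matrix_irr_trace_Irr[OF G 2]]]) simp
  next
    case 3
    then obtain W w i where W: "function_subspace d W"
      "\<forall>g\<in>carrier G. \<forall>w\<in>W. (\<lambda>i. \<Sum>j<d. r g i j * w j) \<in> W"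
      "w \<in> W" "i < d" "w i \<noteq> 0" "W \<noteq> UNIV"
      using less.prems unfolding matrix_irr_def by blast
    have "\<exists>k s t. 0 < k \<and> k < d \<and> matrix_rep G k s \<and> matrix_rep G (d - k) t \<and>
      (\<forall>g\<in>carrier G. (\<Sum>i<d. r g i i) = (\<Sum>i<k. s g i i) + (\<Sum>i<d-k. t g i i))"
      by (rule matrix_rep_split[OF less.prems W(1) _ W(3-6)]) (use W(2) in blast)
    then obtain k s t where st: "0 < k" "k < d" "matrix_rep G k s" "matrix_rep G (d - k) t"
      "\<And>g. g \<in> carrier G \<Longrightarrow> (\<Sum>i<d. r g i i) = (\<Sum>i<k. s g i i) + (\<Sum>i<d-k. t g i i)"
      by blast
    have "virtual G (\<lambda>g. (\<Sum>i<k. s g i i) + (\<Sum>i<d-k. t g i i))"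
      using st by (intro virtual_add less.IH) auto
    then show ?thesis by (rule virtual_cong) (simp add: st(5))
  qed
qed

lemma sum_div_mod:
  fixes f :: "nat \<Rightarrow> nat \<Rightarrow> complex"
  shows "(\<Sum>k<d*e. f (k div e) (k mod e)) = (\<Sum>a<d. \<Sum>b<e. f a b)"
proof (cases "e = 0")
  case False
  have lt: "a * e + b < d * e" if "a < d" "b < e" for a b
  proof -
    have "a * e + b < Suc a * e" using that by simp
    also have "\<dots> \<le> d * e" using that by (intro mult_le_mono1) simp
    finally show ?thesis .
  qed
  have "(\<Sum>k<d*e. f (k div e) (k mod e)) = (\<Sum>(a, b)\<in>{..<d} \<times> {..<e}. f a b)"
    using False
    by (intro sum.reindex_bij_witness[of _ "\<lambda>(a, b). a * e + b" "\<lambda>k. (k div e, k mod e)"])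
      (auto simp: less_mult_imp_div_less lt)
  then show ?thesis by (simp add: sum.cartesian_product)
qed simp

text \<open>The Kronecker product, where the index \<open>i\<close> encodes the pair
  \<open>(i div e, i mod e)\<close>.\<close>

lemma matrix_rep_tensor:
  assumes r: "matrix_rep G d r" and s: "matrix_rep G e s"
  shows "matrix_rep G (d * e) (\<lambda>g i j. r g (i div e) (j div e) * s g (i mod e) (j mod e))"
  unfolding matrix_rep_def
proof (intro conjI allI impI ballI)
  fix i j assume ij: "i < d * e" "j < d * e"
  then have b: "i div e < d" "j div e < d" "i mod e < e" "j mod e < e"
    by (auto simp: less_mult_imp_div_less intro!: mod_less_divisor intro: Nat.gr0I)
  have "i = j \<longleftrightarrow> i div e = j div e \<and> i mod e = j mod e"
    by (metis div_mult_mod_eq)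
  then show "r \<one>\<^bsub>G\<^esub> (i div e) (j div e) * s \<one>\<^bsub>G\<^esub> (i mod e) (j mod e) = (if i = j then 1 else 0)"
    using b by (auto simp: matrix_repD(1)[OF r] matrix_repD(1)[OF s])
next
  fix g h i j assume gh: "g \<in> carrier G" "h \<in> carrier G" and ij: "i < d * e" "j < d * e"
  then have b: "i div e < d" "j div e < d" "i mod e < e" "j mod e < e"
    by (auto simp: less_mult_imp_div_less intro!: mod_less_divisor intro: Nat.gr0I)
  have "(\<Sum>k<d*e. r g (i div e) (k div e) * s g (i mod e) (k mod e) *
        (r h (k div e) (j div e) * s h (k mod e) (j mod e)))
    = (\<Sum>a<d. \<Sum>b<e. r g (i div e) a * s g (i mod e) b * (r h a (j div e) * s h b (j mod e)))"
    by (rule sum_div_mod)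
  also have "\<dots> = (\<Sum>a<d. \<Sum>b<e. (r g (i div e) a * r h a (j div e)) * (s g (i mod e) b * s h b (j mod e)))"
    by (simp add: mult_ac)
  also have "\<dots> = r (g \<otimes>\<^bsub>G\<^esub> h) (i div e) (j div e) * s (g \<otimes>\<^bsub>G\<^esub> h) (i mod e) (j mod e)"
    using b gh by (simp add: matrix_repD(2)[OF r] matrix_repD(2)[OF s] sum_product)
  finally show "r (g \<otimes>\<^bsub>G\<^esub> h) (i div e) (j div e) * s (g \<otimes>\<^bsub>G\<^esub> h) (i mod e) (j mod e) =
    (\<Sum>k<d*e. r g (i div e) (k div e) * s g (i mod e) (k mod e) *
        (r h (k div e) (j div e) * s h (k mod e) (j mod e)))" by simp
qed

lemma virtual_mult:
  assumes G: "group G" and \<phi>: "virtual G \<phi>" and \<psi>: "virtual G \<psi>"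
  shows "virtual G (\<lambda>g. \<phi> g * \<psi> g)"
proof -
  have irr: "virtual G (\<lambda>g. \<chi> g * \<xi> g)" if \<chi>: "\<chi> \<in> Irr G" and \<xi>: "\<xi> \<in> Irr G" for \<chi> \<xi>
  proof -
    obtain d r where r: "matrix_irr G d r" "\<chi> = restrict (\<lambda>g. \<Sum>i<d. r g i i) (carrier G)"
      using IrrE[OF G \<chi>] .
    obtain e s where s: "matrix_irr G e s" "\<xi> = restrict (\<lambda>g. \<Sum>i<e. s g i i) (carrier G)"
      using IrrE[OF G \<xi>] .
    have rs: "matrix_rep G d r" "matrix_rep G e s" using r s by (auto simp: matrix_irr_def)
    show ?thesis
      using matrix_rep_virtual[OF G matrix_rep_tensor[OF rs]]
    proof (rule virtual_cong)
      fix g assume "g \<in> carrier G"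
      then show "(\<Sum>i<d * e. r g (i div e) (i div e) * s g (i mod e) (i mod e)) = \<chi> g * \<xi> g"
        using sum_div_mod[where f = "\<lambda>a b. r g a a *
            s g b b" and d = d and e = e] r(2) s(2) by (simp add: sum_product)
    qed
  qed
  obtain S m where S: "finite S" "S \<subseteq> Irr G" "\<And>g. g \<in> carrier G \<Longrightarrow> \<phi> g = (\<Sum>\<chi>\<in>S. of_int (m \<chi>) * \<chi> g)"
    using \<phi> unfolding virtual_def by blast
  obtain T k where T: "finite T" "T \<subseteq> Irr G" "\<And>g. g \<in> carrier G \<Longrightarrow> \<psi> g = (\<Sum>\<chi>\<in>T. of_int (k \<chi>) * \<chi> g)"
    using \<psi> unfolding virtual_def by blast
  have "virtual G (\<lambda>g. \<Sum>\<chi>\<in>S. \<Sum>\<xi>\<in>T. of_int (m \<chi> * k \<xi>) * (\<chi> g * \<xi> g))"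
    using S(1,2) T(1,2) irr by (intro virtual_sum virtual_scale) auto
  then show ?thesis
  proof (rule virtual_cong)
    fix g assume g: "g \<in> carrier G"
    show "(\<Sum>\<chi>\<in>S. \<Sum>\<xi>\<in>T. of_int (m \<chi> * k \<xi>) * (\<chi> g * \<xi> g)) = \<phi> g * \<psi> g"
      unfolding S(3)[OF g] T(3)[OF g] sum_product by (intro sum.cong refl) simp
  qed
qed

lemma virtual_linear_character:
  assumes G: "group G" and "l \<one>\<^bsub>G\<^esub> = 1"
    and "\<And>g h. g \<in> carrier G \<Longrightarrow> h \<in> carrier G \<Longrightarrow> l (g \<otimes>\<^bsub>G\<^esub> h) = l g * l h"
  shows "virtual G l"
proof -
  have "matrix_rep G 1 (\<lambda>g i j. l g)" using assms by (simp add: matrix_rep_def)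
  from matrix_rep_virtual[OF G this] show ?thesis by simp
qed

lemma virtual_of_int:
  assumes G: "group G"
  shows "virtual G (\<lambda>_. of_int c)"
  using virtual_scale[OF virtual_linear_character[OF G, of "\<lambda>_. 1"], of c] by simp

text \<open>In the permutation matrix for an enumeration \<open>e\<close> of \<open>X\<close>, the
  diagonal ones mark the fixed points.\<close>

lemma virtual_permutation_character:
  assumes G: "group G" and X: "finite X"
    and cl: "\<And>g x. g \<in> carrier G \<Longrightarrow> x \<in> X \<Longrightarrow> act g x \<in> X"
    and one: "\<And>x. x \<in> X \<Longrightarrow> act \<one>\<^bsub>G\<^esub> x = x"
    and mult: "\<And>g h x. g \<in> carrier G \<Longrightarrow> h \<in> carrier G \<Longrightarrow> x \<in> X \<Longrightarrow> act (g \<otimes>\<^bsub>G\<^esub> h) x = act g (act h x)"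
  shows "virtual G (\<lambda>g. of_nat (card {x \<in> X. act g x = x}))"
proof -
  let ?n = "card X"
  obtain e where e: "bij_betw e {..<?n} X"
    using ex_bij_betw_nat_finite[OF X] by (auto simp: lessThan_atLeast0)
  then have eX: "e i \<in> X" if "i < ?n" for i using that by (auto simp: bij_betw_def)
  have inj: "e i = e j \<longleftrightarrow> i = j" if "i < ?n" "j < ?n" for i j
    using that e by (auto simp: bij_betw_def inj_on_def)
  let ?r = "\<lambda>g i j. if act g (e j) = e i then 1 else (0 :: complex)"
  have "matrix_rep G ?n ?r"
    unfolding matrix_rep_def
  proof (intro conjI allI impI ballI)
    fix g h i j assume gh: "g \<in> carrier G" "h \<in> carrier G" and ij: "i < ?n" "j < ?n"
    obtain k where k: "k < ?n" "act h (e j) = e k"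
      using cl[OF gh(2) eX[OF ij(2)]] e by (auto simp: bij_betw_def image_iff)
    have "(\<Sum>k<?n. ?r g i k * ?r h k j) = (\<Sum>l<?n. ?r g i l * (if l = k then 1 else 0))"
      using k inj by (intro sum.cong) auto
    then show "?r (g \<otimes>\<^bsub>G\<^esub> h) i j = (\<Sum>k<?n. ?r g i k * ?r h k j)"
      using k gh eX[OF ij(2)] by (simp add: sum_if_eq mult)
  qed (use one eX inj in auto)
  from matrix_rep_virtual[OF G this] show ?thesis
  proof (rule virtual_cong)
    fix g
    have "(\<Sum>i<?n. ?r g i i) = (\<Sum>x\<in>X. if act g x = x then 1 else 0)"
      by (rule sum.reindex_bij_betw[OF e])
    then show "(\<Sum>i<?n. ?r g i i) = of_nat (card {x \<in> X. act g x = x})"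
      using X by (simp add: sum.If_cases Int_def)
  qed
qed

lemma Irr_orthonormal:
  assumes G: "group G" and "\<chi> \<in> Irr G" "\<xi> \<in> Irr G"
  shows "(\<Sum>g\<in>carrier G. \<chi> g * \<xi> (inv\<^bsub>G\<^esub> g)) = (if \<chi> = \<xi> then of_nat (card (carrier G)) else 0)"
proof -
  interpret G: group G by fact
  obtain d r where r: "matrix_irr G d r" "\<chi> = restrict (\<lambda>g. \<Sum>i<d. r g i i) (carrier G)"
    using IrrE[OF G assms(2)] .
  obtain e s where s: "matrix_irr G e s" "\<xi> = restrict (\<lambda>g. \<Sum>i<e. s g i i) (carrier G)"
    using IrrE[OF G assms(3)] .
  show ?thesis
  proof (cases "\<chi> = \<xi>")
    case True
    then show ?thesis unfolding True[symmetric] using matrix_irr_norm[OF G r(1)] by (simp add: r(2))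
  next
    case False
    \<comment> \<open>Extensionality guarantees that distinct characters already differ at some
      group element.\<close>
    then obtain h where "h \<in> carrier G" "(\<Sum>i<d. r h i i) \<noteq> (\<Sum>i<e. s h i i)"
      unfolding r(2) s(2) by (metis (mono_tags, lifting) restrict_ext)
    from matrix_irr_orthogonal[OF G r(1) s(1) this] show ?thesis using False by (simp add: r(2) s(2))
  qed
qed

lemma Irr_one:
  assumes G: "group G" and "\<chi> \<in> Irr G"
  obtains d where "d > 0" "\<chi> \<one>\<^bsub>G\<^esub> = of_nat d"
proof -
  interpret G: group G by fact
  obtain d r where r: "matrix_irr G d r" "\<chi> = restrict (\<lambda>g. \<Sum>i<d. r g i i) (carrier G)"
    using IrrE[OF G assms(2)] .
  then have m: "matrix_rep G d r" and d: "d > 0" by (auto simp: matrix_irr_def)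
  have "\<chi> \<one>\<^bsub>G\<^esub> = of_nat d" using trace_one[OF m] r(2) by simp
  then show ?thesis by (rule that[OF d])
qed

text \<open>By orthonormality the norm is the sum of the squares of the integer multiplicities. If
  it is 1, a single multiplicity survives and equals 1 or -1; positivity at the identity excludes
  -1.\<close>

lemma virtual_norm_one_Irr:
  assumes G: "group G" and fin: "finite (carrier G)" and \<phi>: "virtual G \<phi>"
    and norm: "(\<Sum>g\<in>carrier G. \<phi> g * \<phi> (inv\<^bsub>G\<^esub> g)) = of_nat (card (carrier G))"
    and pos: "Re (\<phi> \<one>\<^bsub>G\<^esub>) > 0"
  shows "restrict \<phi> (carrier G) \<in> Irr G"
proof -
  interpret G: group G by fact
  let ?N = "of_nat (card (carrier G)) :: complex"
  have N: "?N \<noteq> 0" using fin G.one_closed by auto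
  obtain S m where S: "finite S" "S \<subseteq> Irr G" "\<And>g. g \<in> carrier G \<Longrightarrow> \<phi> g = (\<Sum>\<chi>\<in>S. of_int (m \<chi>) * \<chi> g)"
    using \<phi> unfolding virtual_def by blast
  have "?N = (\<Sum>g\<in>carrier G. (\<Sum>\<chi>\<in>S. of_int (m \<chi>) * \<chi> g) * (\<Sum>\<xi>\<in>S. of_int (m \<xi>) * \<xi> (inv\<^bsub>G\<^esub> g)))"
    unfolding norm[symmetric] by (intro sum.cong) (auto simp: S(3))
  also have "\<dots> = (\<Sum>g\<in>carrier G. \<Sum>\<chi>\<in>S. \<Sum>\<xi>\<in>S. of_int (m \<chi> * m \<xi>) * (\<chi> g * \<xi> (inv\<^bsub>G\<^esub> g)))"
    unfolding sum_product by (intro sum.cong refl) simp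
  also have "\<dots> = (\<Sum>\<chi>\<in>S. \<Sum>\<xi>\<in>S. \<Sum>g\<in>carrier G. of_int (m \<chi> * m \<xi>) * (\<chi> g * \<xi> (inv\<^bsub>G\<^esub> g)))"
    by (subst sum.swap) (rule sum.cong[OF refl], rule sum.swap)
  also have "\<dots> = (\<Sum>\<chi>\<in>S. \<Sum>\<xi>\<in>S. of_int (m \<chi> * m \<xi>) * (if \<chi> = \<xi> then ?N else 0))"
  proof (rule sum.cong[OF refl], rule sum.cong[OF refl])
    fix \<chi> \<xi> assume "\<chi> \<in> S" "\<xi> \<in> S"
    then have "\<chi> \<in> Irr G" "\<xi> \<in> Irr G" using S(2) by auto
    from Irr_orthonormal[OF G this]
    show "(\<Sum>g\<in>carrier G. of_int (m \<chi> * m \<xi>) * (\<chi> g * \<xi> (inv\<^bsub>G\<^esub> g)))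
      = of_int (m \<chi> * m \<xi>) * (if \<chi> = \<xi> then ?N else 0)"
      by (simp only: sum_distrib_left[symmetric])
  qed
  also have "\<dots> = (\<Sum>\<chi>\<in>S. \<Sum>\<xi>\<in>S. if \<chi> = \<xi> then of_int (m \<chi> * m \<xi>) * ?N else 0)"
    by (intro sum.cong refl) simp
  also have "\<dots> = (\<Sum>\<chi>\<in>S. of_int (m \<chi> * m \<chi>) * ?N)"
    using S(1) by (intro sum.cong refl) (simp only: sum.delta' if_True)
  also have "\<dots> = of_int (\<Sum>\<chi>\<in>S. m \<chi> * m \<chi>) * ?N"
    by (simp add: sum_distrib_right)
  finally have "of_int (\<Sum>\<chi>\<in>S. m \<chi> * m \<chi>) = (1 :: complex)" using N by simp
  then have sq: "(\<Sum>\<chi>\<in>S. m \<chi> * m \<chi>) = 1" by (metis of_int_eq_1_iff)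
  have "\<exists>\<chi>\<in>S. m \<chi> \<noteq> 0" using sq by (metis (no_types, lifting) mult_zero_left sum.neutral zero_neq_one)
  then obtain \<chi> where \<chi>: "\<chi> \<in> S" "m \<chi> \<noteq> 0" by blast
  have split: "m \<chi> * m \<chi> + (\<Sum>\<xi>\<in>S - {\<chi>}. m \<xi> * m \<xi>) = 1"
    using sq sum.remove[OF S(1) \<chi>(1), of "\<lambda>\<xi>. m \<xi> * m \<xi>"] by simp
  have nn: "(\<Sum>\<xi>\<in>S - {\<chi>}. m \<xi> * m \<xi>) \<ge> 0" by (intro sum_nonneg) simp
  have "m \<chi> * m \<chi> \<ge> 1" using \<chi>(2) by (metis int_one_le_iff_zero_less linorder_not_less mult_eq_0_iff order_antisym_conv zero_le_square)
  with split nn have m1: "m \<chi> * m \<chi> = 1" and z: "(\<Sum>\<xi>\<in>S - {\<chi>}. m \<xi> * m \<xi>) = 0" by linarith+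
  have z': "m \<xi> = 0" if "\<xi> \<in> S - {\<chi>}" for \<xi>
  proof -
    have "\<forall>\<xi>\<in>S - {\<chi>}. m \<xi> * m \<xi> = 0"
      using z S(1) by (subst (asm) sum_nonneg_eq_0_iff) auto
    then show ?thesis using that by simp
  qed
  have \<phi>\<chi>: "\<phi> g = of_int (m \<chi>) * \<chi> g" if "g \<in> carrier G" for g
    unfolding S(3)[OF that] using sum.remove[OF S(1) \<chi>(1), of "\<lambda>\<xi>. of_int (m \<xi>) * \<xi> g"] z' by simp
  have irr: "\<chi> \<in> Irr G" using \<chi> S by auto
  obtain d where d: "d > 0" "\<chi> \<one>\<^bsub>G\<^esub> = of_nat d" using Irr_one[OF G irr] .
  have "m \<chi> = 1"
  proof (rule ccontr)
    assume "m \<chi> \<noteq> 1"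
    then have "m \<chi> = - 1" using m1 zmult_eq_1_iff by auto
    then show False using pos \<phi>\<chi>[OF G.one_closed] d by simp
  qed
  obtain d r where r: "matrix_irr G d r" "\<chi> = restrict (\<lambda>g. \<Sum>i<d. r g i i) (carrier G)"
    using IrrE[OF G irr] .
  have "restrict \<phi> (carrier G) = restrict (\<lambda>g. \<Sum>i<d. r g i i) (carrier G)"
    using \<phi>\<chi> \<open>m \<chi> = 1\<close> r(2) by (intro restrict_ext) simp
  then show ?thesis using irr r(2) by simp
qed

text \<open>The identity assumed is column orthogonality: the \<open>\<phi> i\<close> already exhaust the regular character.\<close>

lemma Irr_exhausted:
  assumes G: "group G" and fin: "finite (carrier G)" and I: "finite I"
    and \<phi>: "\<And>i. i \<in> I \<Longrightarrow> restrict (\<phi> i) (carrier G) \<in> Irr G"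
    and reg: "\<And>g. g \<in> carrier G \<Longrightarrow>
      (\<Sum>i\<in>I. \<phi> i \<one>\<^bsub>G\<^esub> * \<phi> i g) = (if g = \<one>\<^bsub>G\<^esub> then of_nat (card (carrier G)) else 0)"
    and \<xi>: "\<xi> \<in> Irr G"
  shows "\<exists>i\<in>I. \<xi> = restrict (\<phi> i) (carrier G)"
proof (rule ccontr)
  interpret G: group G by fact
  assume ne: "\<not> (\<exists>i\<in>I. \<xi> = restrict (\<phi> i) (carrier G))"
  have z: "(\<Sum>g\<in>carrier G. \<phi> i g * \<xi> (inv\<^bsub>G\<^esub> g)) = 0" if "i \<in> I" for i
    using Irr_orthonormal[OF G \<phi>[OF that] \<xi>] ne that by auto
  have "(\<Sum>g\<in>carrier G. (\<Sum>i\<in>I. \<phi> i \<one>\<^bsub>G\<^esub> * \<phi> i g) * \<xi> (inv\<^bsub>G\<^esub> g))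
      = (\<Sum>g\<in>carrier G. \<Sum>i\<in>I. \<phi> i \<one>\<^bsub>G\<^esub> * (\<phi> i g * \<xi> (inv\<^bsub>G\<^esub> g)))"
    by (simp add: sum_distrib_right mult.assoc)
  also have "\<dots> = (\<Sum>i\<in>I. \<phi> i \<one>\<^bsub>G\<^esub> * (\<Sum>g\<in>carrier G. \<phi> i g * \<xi> (inv\<^bsub>G\<^esub> g)))"
    unfolding sum_distrib_left by (rule sum.swap)
  also have "\<dots> = 0" using z by simp
  finally have "(\<Sum>g\<in>carrier G. (\<Sum>i\<in>I. \<phi> i \<one>\<^bsub>G\<^esub> * \<phi> i g) * \<xi> (inv\<^bsub>G\<^esub> g)) = 0" .
  moreover have "(\<Sum>g\<in>carrier G. (\<Sum>i\<in>I. \<phi> i \<one>\<^bsub>G\<^esub> * \<phi> i g) * \<xi> (inv\<^bsub>G\<^esub> g))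
      = (\<Sum>g\<in>carrier G. if g = \<one>\<^bsub>G\<^esub> then of_nat (card (carrier G)) * \<xi> (inv\<^bsub>G\<^esub> g) else 0)"
    using reg by (intro sum.cong) auto
  moreover have "\<dots> = of_nat (card (carrier G)) * \<xi> \<one>\<^bsub>G\<^esub>"
    using fin by (simp add: sum.delta')
  moreover obtain d where "d > 0" "\<xi> \<one>\<^bsub>G\<^esub> = of_nat d" using Irr_one[OF G \<xi>] .
  moreover have "card (carrier G) \<noteq> 0" using fin G.one_closed by auto
  ultimately show False by simp
qed

section \<open>Cycle types\<close>

definition orbs :: "'a set \<Rightarrow> ('a \<Rightarrow> 'a) \<Rightarrow> 'a set set" where
  "orbs S p = orbit p ` S"

definition cycle_type :: "'a set \<Rightarrow> ('a \<Rightarrow> 'a) \<Rightarrow> nat multiset" where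
  "cycle_type S p = image_mset card (mset_set (orbs S p))"

text \<open>\<open>orbit p x\<close> collects the iterates of \<open>p\<close> at \<open>x\<close>
  starting from the first, so that \<open>x\<close> itself belongs to it is a consequence of
  finiteness.\<close>

lemma permutes_self_in_orbit:
  assumes "finite S" "p permutes S"
  shows "x \<in> orbit p x"
  using assms permutation_self_in_orbit permutes_imp_permutation by metis

lemma finite_orbs: "finite S \<Longrightarrow> finite (orbs S p)"
  by (simp add: orbs_def)

lemma orbs_subset:
  assumes "p permutes S" "X \<in> orbs S p"
  shows "X \<subseteq> S"
  using assms permutes_orbit_subset by (fastforce simp: orbs_def)

lemma Union_orbs:
  assumes "finite S" "p permutes S"
  shows "\<Union> (orbs S p) = S"
  using orbs_subset[OF assms(2)] permutes_self_in_orbit[OF assms] by (auto simp: orbs_def)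

lemma orbit_eq_of_mem:
  assumes "finite S" "p permutes S" "y \<in> orbit p x"
  shows "orbit p y = orbit p x"
proof -
  have "permutation p" using assms by (metis permutes_imp_permutation)
  then show ?thesis using assms(3) by (metis cyclic_on_orbit' orbit_cyclic_eq3)
qed

lemma orbs_disjoint:
  assumes "finite S" "p permutes S" "X \<in> orbs S p" "Y \<in> orbs S p" "X \<noteq> Y"
  shows "X \<inter> Y = {}"
proof (rule ccontr)
  assume "X \<inter> Y \<noteq> {}"
  then obtain z where "z \<in> X" "z \<in> Y" by blast
  moreover obtain x y where "X = orbit p x" "Y = orbit p y" using assms by (auto simp: orbs_def)
  ultimately show False using orbit_eq_of_mem[OF assms(1,2)] assms(5) by metis
qed

lemma card_Union_orbs:
  assumes "finite S" "p permutes S" "F \<subseteq> orbs S p"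
  shows "card (\<Union> F) = (\<Sum>X\<in>F. card X)"
proof (rule card_Union_disjoint)
  show "pairwise disjnt F"
    using assms orbs_disjoint[OF assms(1,2)] by (auto simp: pairwise_def disjnt_def)
  show "finite X" if "X \<in> F" for X
    using that assms orbs_subset[OF assms(2)] finite_subset by blast
qed

lemma sum_orbits:
  fixes f :: "nat \<Rightarrow> real"
  assumes "finite S" "p permutes S"
  shows "(\<Sum>b\<in>S. f (card (orbit p b))) = (\<Sum>k\<in>#cycle_type S p. of_nat k * f k)"
proof -
  have "(\<Sum>b\<in>S. f (card (orbit p b))) = (\<Sum>X\<in>orbs S p. \<Sum>b\<in>{b\<in>S. orbit p b = X}. f (card (orbit p b)))"
    using assms unfolding orbs_def by (intro sum.image_gen) simp
  also have "\<dots> = (\<Sum>X\<in>orbs S p. of_nat (card X) * f (card X))"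
  proof (rule sum.cong[OF refl])
    fix X assume X: "X \<in> orbs S p"
    have "{b\<in>S. orbit p b = X} = X"
    proof
      show "{b\<in>S. orbit p b = X} \<subseteq> X" using permutes_self_in_orbit[OF assms] by auto
      show "X \<subseteq> {b\<in>S. orbit p b = X}"
        using X orbs_subset[OF assms(2) X] orbit_eq_of_mem[OF assms] by (auto simp: orbs_def)
    qed
    moreover have "(\<Sum>b\<in>{b\<in>S. orbit p b = X}. f (card (orbit p b))) = (\<Sum>b\<in>{b\<in>S. orbit p b = X}. f (card X))"
      by (rule sum.cong) auto
    ultimately show "(\<Sum>b\<in>{b\<in>S. orbit p b = X}. f (card (orbit p b))) = of_nat (card X) * f (card X)"
      by simp
  qed
  also have "\<dots> = (\<Sum>k\<in>#cycle_type S p. of_nat k * f k)"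
    by (simp add: cycle_type_def sum_unfold_sum_mset multiset.map_comp comp_def)
  finally show ?thesis .
qed

lemma sum_mset_cycle_type:
  assumes "finite S" "p permutes S"
  shows "\<Sum>\<^sub># (cycle_type S p) = card S"
  using card_Union_orbs[OF assms subset_refl] Union_orbs[OF assms]
  by (simp add: cycle_type_def sum_unfold_sum_mset)

lemma count_cycle_type:
  assumes "finite S"
  shows "count (cycle_type S p) k = card {X \<in> orbs S p. card X = k}"
proof -
  have "count (cycle_type S p) k = card (card -` {k} \<inter> orbs S p)"
    unfolding cycle_type_def using finite_orbs[OF assms, of p] by (simp add: count_image_mset)
  also have "card -` {k} \<inter> orbs S p = {X \<in> orbs S p. card X = k}" by auto
  finally show ?thesis .
qed

lemma cycle_type_inv:
  assumes "finite S" "p permutes S"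
  shows "cycle_type S (inv' p) = cycle_type S p"
  using orbit_inv_eq[OF permutes_imp_permutation[OF assms]] by (simp add: cycle_type_def orbs_def)

lemma cycle_type_insert_fixed:
  assumes "finite S" "q permutes S" "a \<notin> S"
  shows "cycle_type (insert a S) q = add_mset 1 (cycle_type S q)"
proof -
  have "q a = a" using assms permutes_not_in by metis
  then have "orbit q a = {a}" by (simp add: orbit_eq_singleton_iff)
  then have "orbs (insert a S) q = insert {a} (orbs S q)" by (simp add: orbs_def)
  moreover have "{a} \<notin> orbs S q" using orbs_subset[OF assms(2)] assms(3) by auto
  ultimately show ?thesis using finite_orbs[OF assms(1)] by (simp add: cycle_type_def)
qed

text \<open>Since \<open>q\<close> fixes \<open>a\<close>, the product sends \<open>a\<close> to
  \<open>b\<close> and the former preimage of \<open>b\<close> to \<open>a\<close>. Thus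
  \<open>a\<close> is spliced into the cycle of \<open>b\<close> just before \<open>b\<close>, and
  all other cycles stay as they are.\<close>

lemma cycle_type_insert_transpose:
  assumes S: "finite S" and q: "q permutes S" and a: "a \<notin> S" and b: "b \<in> S"
  shows "cycle_type (insert a S) (transpose a b \<circ> q) =
    add_mset (Suc (card (orbit q b))) (cycle_type S q - {#card (orbit q b)#})"
proof -
  define p where "p = transpose a b \<circ> q"
  let ?O = "orbit q b"
  have ab: "a \<noteq> b" using a b by auto
  have qa: "q a = a" using a q permutes_not_in by metis
  have pS: "p permutes insert a S"
    unfolding p_def
  proof (rule permutes_compose)
    show "q permutes insert a S" using q by (rule permutes_subset) auto
    show "transpose a b permutes insert a S" using b by (intro permutes_swap_id) auto
  qed
  have pa: "p a = b" by (simp add: p_def qa)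
  have pq: "p x = (if q x = b then a else q x)" if "x \<noteq> a" for x
  proof -
    have "q x \<noteq> a" using qa that permutes_inj[OF q] by (metis injD)
    then show ?thesis by (simp add: p_def transpose_def)
  qed
  have bO: "b \<in> ?O" using permutes_self_in_orbit[OF S q] .
  have OS: "?O \<subseteq> S" using permutes_orbit_subset[OF q b] .
  have fin: "finite ?O" using OS S finite_subset by blast
  have aO: "a \<notin> ?O" using OS a by auto
  have pO: "orbit p a = insert a ?O"
  proof
    show "orbit p a \<subseteq> insert a ?O"
    proof
      fix y assume "y \<in> orbit p a"
      then show "y \<in> insert a ?O"
      proof induction
        case base
        show ?case unfolding pa using bO by simp
      next
        case (step y)
        show ?case
        proof (cases "y = a")
          case True
          then show ?thesis using pa bO by simp
        next
          case False
          then have "y \<in> ?O" using step by simp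
          then show ?thesis using pq[OF False] orbit.step[of y q b] by simp
        qed
      qed
    qed
    show "insert a ?O \<subseteq> orbit p a"
    proof
      fix y assume "y \<in> insert a ?O"
      moreover have aa: "a \<in> orbit p a"
        using permutes_self_in_orbit[OF _ pS] S by simp
      moreover have bb: "b \<in> orbit p a" using orbit.base[of p a] by (simp only: pa)
      moreover have "y \<in> orbit p a" if "y \<in> orbit q b" for y
        using that
      proof induction
        case base
        have "p b \<in> orbit p a" using bb by (rule orbit.step)
        then show ?case using pq[of b] ab bb by (auto split: if_splits)
      next
        case (step y)
        then have "y \<noteq> a" using aO by auto
        moreover have "p y \<in> orbit p a" using step.IH by (rule orbit.step)
        ultimately show ?case using pq[of y] bb by (auto split: if_splits)
      qed
      ultimately show "y \<in> orbit p a" by auto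
    qed
  qed
  have other: "orbit p x = orbit q x" if x: "x \<in> S" "x \<notin> ?O" for x
  proof (rule orbit_cong)
    show "x \<in> orbit q x" using permutes_self_in_orbit[OF S q] .
    fix s assume s: "s \<in> orbit q x"
    then have sS: "s \<in> S" using permutes_orbit_subset[OF q x(1)] by auto
    have "q s \<noteq> b"
    proof
      assume "q s = b"
      then have "b \<in> orbit q x" using s by (metis orbit.step)
      then have "orbit q b = orbit q x" using orbit_eq_of_mem[OF S q] by metis
      then show False using x(2) permutes_self_in_orbit[OF S q, of x] by simp
    qed
    then show "p s = q s" using pq[of s] sS a by auto
  qed
  have same: "orbit p x = insert a ?O" if "x \<in> ?O" for x
    using orbit_eq_of_mem[OF _ pS, of x a] pO S that by auto
  have "orbs (insert a S) p = insert (insert a ?O) (orbs S q - {?O})"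
  proof -
    have "orbs (insert a S) p = insert (orbit p a) (orbit p ` ?O \<union> orbit p ` (S - ?O))"
      unfolding orbs_def using OS by auto
    also have "orbit p ` ?O = {insert a ?O}" using same bO by auto
    also have "orbit p ` (S - ?O) = orbs S q - {?O}"
    proof -
      have "orbit p ` (S - ?O) = orbit q ` (S - ?O)" using other by auto
      also have "\<dots> = orbs S q - {?O}"
        unfolding orbs_def using permutes_self_in_orbit[OF S q] orbit_eq_of_mem[OF S q] by auto
      finally show ?thesis .
    qed
    finally show ?thesis by (simp add: pO)
  qed
  moreover have "insert a ?O \<notin> orbs S q - {?O}" using orbs_subset[OF q] a by auto
  moreover have "?O \<in> orbs S q" using b by (simp add: orbs_def)
  ultimately show ?thesis
    unfolding p_def[symmetric] using finite_orbs[OF S, of q] fin aO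
    by (simp add: cycle_type_def mset_set_Diff image_mset_Diff)
qed

text \<open>Every permutation of \<open>insert a S\<close> arises from one of \<open>S\<close> by making \<open>a\<close> a fixed point or by inserting
  it into a cycle, which can be done in \<open>k\<close> ways for a cycle of length \<open>k\<close>.\<close>

definition grow :: "(nat multiset \<Rightarrow> real) \<Rightarrow> nat multiset \<Rightarrow> real" where
  "grow h T = h (add_mset 1 T) + (\<Sum>k\<in>#T. of_nat k * h (add_mset (Suc k) (T - {#k#})))"

lemma sum_cycle_type_insert:
  assumes "finite S" "a \<notin> S"
  shows "(\<Sum>p | p permutes insert a S. h (cycle_type (insert a S) p)) =
    (\<Sum>q | q permutes S. grow h (cycle_type S q))"
proof -
  let ?P = "{q. q permutes S}"
  have "(\<Sum>p | p permutes insert a S. h (cycle_type (insert a S) p))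
      = (\<Sum>b\<in>insert a S. \<Sum>q\<in>?P. h (cycle_type (insert a S) (transpose a b \<circ> q)))"
    by (rule sum_over_permutations_insert[OF assms])
  also have "\<dots> = (\<Sum>q\<in>?P. \<Sum>b\<in>insert a S. h (cycle_type (insert a S) (transpose a b \<circ> q)))"
    by (rule sum.swap)
  also have "\<dots> = (\<Sum>q\<in>?P. grow h (cycle_type S q))"
  proof (rule sum.cong[OF refl])
    fix q assume "q \<in> ?P"
    then have q: "q permutes S" by simp
    have "(\<Sum>b\<in>S. h (cycle_type (insert a S) (transpose a b \<circ> q)))
        = (\<Sum>b\<in>S. h (add_mset (Suc (card (orbit q b))) (cycle_type S q - {#card (orbit q b)#})))"
      by (rule sum.cong) (simp_all add: cycle_type_insert_transpose[OF assms(1) q assms(2)])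
    also have "\<dots> = (\<Sum>k\<in>#cycle_type S q. of_nat k * h (add_mset (Suc k) (cycle_type S q - {#k#})))"
      by (rule sum_orbits[OF assms(1) q])
    finally show "(\<Sum>b\<in>insert a S. h (cycle_type (insert a S) (transpose a b \<circ> q))) = grow h (cycle_type S q)"
      using assms cycle_type_insert_fixed[OF assms(1) q assms(2)] by (simp add: grow_def)
  qed
  finally show ?thesis .
qed

text \<open>Divided by \<open>fact n\<close>, this is the expectation of \<open>h\<close> at a
  uniformly random permutation.\<close>

definition type_sum :: "nat \<Rightarrow> (nat multiset \<Rightarrow> real) \<Rightarrow> real" where
  "type_sum n h = (\<Sum>p | p permutes {1..n}. h (cycle_type {1..n} p))"

lemma type_sum_0: "type_sum 0 h = h {#}"
  by (simp add: type_sum_def cycle_type_def orbs_def)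

lemma type_sum_Suc: "type_sum (Suc n) h = type_sum n (grow h)"
proof -
  have "{1..Suc n} = insert (Suc n) {1..n}" by auto
  then show ?thesis unfolding type_sum_def using sum_cycle_type_insert[of "{1..n}" "Suc n" h] by simp
qed

lemma type_sum_cong:
  assumes "\<And>T. \<Sum>\<^sub># T = n \<Longrightarrow> h T = h' T"
  shows "type_sum n h = type_sum n h'"
  unfolding type_sum_def using assms sum_mset_cycle_type[of "{1..n}"] by (intro sum.cong) auto

lemma type_sum_linear:
  "type_sum n (\<lambda>T. h T + h' T) = type_sum n h + type_sum n h'"
  "type_sum n (\<lambda>T. c * h T) = c * type_sum n h"
  by (simp_all add: type_sum_def sum.distrib sum_distrib_left)

text \<open>A cycle of length \<open>k\<close> has sign (-1)^(k-1); the exponent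
  \<open>Suc k\<close> has the same parity and avoids subtraction.\<close>

definition type_sign :: "nat multiset \<Rightarrow> int" where
  "type_sign T = (\<Prod>k\<in>#T. (-1) ^ Suc k)"

text \<open>Induction by inserting the point \<open>a\<close>: a proper transposition reverses the
  sign, and lengthening one cycle by 1 reverses one factor of \<open>type_sign\<close>. A new fixed
  point changes neither.\<close>

lemma sign_cycle_type:
  assumes "finite S" "p permutes S"
  shows "sign p = type_sign (cycle_type S p)"
  using assms
proof (induction S arbitrary: p rule: finite_induct)
  case empty
  then show ?case by (simp add: type_sign_def cycle_type_def orbs_def)
next
  case (insert a S)
  from insert.prems obtain b q where bq: "p = transpose a b \<circ> q" "b \<in> insert a S" "q permutes S"
  proof -
    have "p \<in> {p. p permutes insert a S}" using insert.prems by simp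
    then have "p \<in> (\<lambda>(b, q). transpose a b \<circ> q) ` {(b, q). b \<in> insert a S \<and> q \<in> {q. q permutes S}}"
      unfolding permutes_insert .
    then show thesis using that by auto
  qed
  have IH: "sign q = type_sign (cycle_type S q)" using insert.IH bq(3) by simp
  show ?case
  proof (cases "b = a")
    case True
    then show ?thesis
      using bq IH cycle_type_insert_fixed[OF insert.hyps(1) bq(3) insert.hyps(2)]
      by (simp add: type_sign_def)
  next
    case False
    then have b: "b \<in> S" using bq by simp
    let ?k = "card (orbit q b)"
    have "orbit q b \<in> orbs S q" using b by (simp add: orbs_def)
    then have "?k \<in># cycle_type S q" using insert.hyps(1) by (auto simp: cycle_type_def finite_orbs)
    then obtain T where T: "cycle_type S q = add_mset ?k T" by (metis mset_add)
    have "sign p = sign (transpose a b) * sign q"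
      unfolding bq(1) using bq(3) insert.hyps(1)
      by (intro sign_compose permutation_swap_id permutes_imp_permutation)
    then have "sign p = - type_sign (add_mset ?k T)" using False IH T by (simp add: sign_swap_id)
    moreover have "cycle_type (insert a S) p = add_mset (Suc ?k) T"
      using cycle_type_insert_transpose[OF insert.hyps(1) bq(3) insert.hyps(2) b] T bq(1) by simp
    ultimately show ?thesis by (simp add: type_sign_def)
  qed
qed

section \<open>Invariant subsets and the distribution of short cycles\<close>

lemma image_Union_orbs:
  assumes "finite S" "p permutes S" "F \<subseteq> orbs S p"
  shows "p ` (\<Union> F) = \<Union> F"
proof -
  have "p ` X \<subseteq> X" if "X \<in> orbs S p" for X
    using that by (auto simp: orbs_def intro: orbit.step)
  then have "p ` (\<Union> F) \<subseteq> \<Union> F" using assms(3) by blast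
  moreover have "finite (\<Union> F)"
    using assms(3) Union_orbs[OF assms(1,2)] by (metis Union_mono assms(1) finite_subset)
  moreover have "inj_on p (\<Union> F)" using permutes_inj_on[OF assms(2)] .
  ultimately show ?thesis by (metis card_image card_subset_eq)
qed

lemma invariant_eq_Union_orbs:
  assumes "finite S" "p permutes S" "A \<subseteq> S" "p ` A = A"
  shows "A = \<Union> {X \<in> orbs S p. X \<subseteq> A}"
proof
  have "orbit p x \<subseteq> A" if "x \<in> A" for x
  proof
    fix y assume "y \<in> orbit p x"
    then show "y \<in> A" using that assms(4) by induction auto
  qed
  then show "A \<subseteq> \<Union> {X \<in> orbs S p. X \<subseteq> A}"
    using assms(3) permutes_self_in_orbit[OF assms(1,2)] by (fastforce simp: orbs_def)
qed auto

text \<open>An invariant set is the disjoint union of the orbits inside it, so forming unions is a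
  bijection with inverse "orbits contained in \<open>A\<close>".\<close>

lemma card_invariant_subsets:
  assumes S: "finite S" "p permutes S"
  shows "card {A. A \<subseteq> S \<and> card A = k \<and> p ` A = A} = card {F. F \<subseteq> orbs S p \<and> (\<Sum>X\<in>F. card X) = k}"
proof (rule bij_betw_same_card[symmetric], rule bij_betwI[where g = "\<lambda>A. {X \<in> orbs S p. X \<subseteq> A}"])
  show "\<Union> \<in> {F. F \<subseteq> orbs S p \<and> (\<Sum>X\<in>F. card X) = k} \<rightarrow> {A. A \<subseteq> S \<and> card A = k \<and> p ` A = A}"
  proof
    fix F assume F: "F \<in> {F. F \<subseteq> orbs S p \<and> (\<Sum>X\<in>F. card X) = k}"
    then have "\<Union> F \<subseteq> S" using Union_orbs[OF S] by blast
    then show "\<Union> F \<in> {A. A \<subseteq> S \<and> card A = k \<and> p ` A = A}"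
      using F card_Union_orbs[OF S, of F] image_Union_orbs[OF S, of F] by simp
  qed
next
  show "(\<lambda>A. {X \<in> orbs S p. X \<subseteq> A}) \<in> {A. A \<subseteq> S \<and> card A = k \<and> p ` A = A} \<rightarrow>
      {F. F \<subseteq> orbs S p \<and> (\<Sum>X\<in>F. card X) = k}"
  proof
    fix A assume "A \<in> {A. A \<subseteq> S \<and> card A = k \<and> p ` A = A}"
    then have A: "A \<subseteq> S" "card A = k" "p ` A = A" by auto
    have "(\<Sum>X\<in>{X \<in> orbs S p. X \<subseteq> A}. card X) = k"
      using card_Union_orbs[OF S, of "{X \<in> orbs S p. X \<subseteq> A}"] invariant_eq_Union_orbs[OF S A(1,3)] A(2)
      by simp
    then show "{X \<in> orbs S p. X \<subseteq> A} \<in> {F. F \<subseteq> orbs S p \<and> (\<Sum>X\<in>F. card X) = k}" by auto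
  qed
next
  fix F assume "F \<in> {F. F \<subseteq> orbs S p \<and> (\<Sum>X\<in>F. card X) = k}"
  then have F: "F \<subseteq> orbs S p" by auto
  show "{X \<in> orbs S p. X \<subseteq> \<Union> F} = F"
  proof
    show "{X \<in> orbs S p. X \<subseteq> \<Union> F} \<subseteq> F"
    proof
      fix X assume "X \<in> {X \<in> orbs S p. X \<subseteq> \<Union> F}"
      then have X: "X \<in> orbs S p" "X \<subseteq> \<Union> F" by auto
      have "X \<noteq> {}" using X(1) by (auto simp: orbs_def orbit_nonempty)
      then obtain x where "x \<in> X" by blast
      then obtain Y where Y: "Y \<in> F" "x \<in> Y" using X(2) by blast
      then have "X = Y" using orbs_disjoint[OF S X(1)] F \<open>x \<in> X\<close> by blast
      then show "X \<in> F" using Y by simp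
    qed
  qed (use F in auto)
next
  fix A assume "A \<in> {A. A \<subseteq> S \<and> card A = k \<and> p ` A = A}"
  then have A: "A \<subseteq> S" "p ` A = A" by auto
  show "\<Union> {X \<in> orbs S p. X \<subseteq> A} = A" using invariant_eq_Union_orbs[OF S A] by simp
qed

text \<open>Subfamilies omit \<open>x\<close> or contain it; the generating polynomial of the
  weights is multiplied by \<open>1 + t^(w x)\<close>.\<close>

lemma card_subfamilies_insert:
  fixes w :: "'a \<Rightarrow> nat"
  assumes "finite F" "x \<notin> F"
  shows "card {Q. Q \<subseteq> insert x F \<and> sum w Q = k} =
    card {Q. Q \<subseteq> F \<and> sum w Q = k} + (if w x \<le> k then card {Q. Q \<subseteq> F \<and> sum w Q = k - w x} else 0)"
proof -
  let ?A = "{Q. Q \<subseteq> F \<and> sum w Q = k}"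
  let ?B = "{Q. Q \<subseteq> F \<and> sum w Q + w x = k}"
  have "{Q. Q \<subseteq> insert x F \<and> sum w Q = k} = ?A \<union> insert x ` ?B"
  proof (intro equalityI subsetI)
    fix Q assume Q: "Q \<in> {Q. Q \<subseteq> insert x F \<and> sum w Q = k}"
    show "Q \<in> ?A \<union> insert x ` ?B"
    proof (cases "x \<in> Q")
      case True
      have "finite Q" using Q assms(1) by (auto intro: finite_subset)
      then have "sum w (Q - {x}) + w x = k" using Q True by (simp add: sum.remove add.commute)
      moreover have "Q - {x} \<subseteq> F" using Q by auto
      ultimately have "Q - {x} \<in> ?B" by simp
      moreover have "Q = insert x (Q - {x})" using True by auto
      ultimately show ?thesis by blast
    next
      case False
      then show ?thesis using Q by auto
    qed
  next
    fix Q assume "Q \<in> ?A \<union> insert x ` ?B"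
    then show "Q \<in> {Q. Q \<subseteq> insert x F \<and> sum w Q = k}"
    proof
      assume "Q \<in> insert x ` ?B"
      then obtain P where P: "Q = insert x P" "P \<subseteq> F" "sum w P + w x = k" by auto
      have "finite P" "x \<notin> P" using P assms finite_subset by auto
      then show ?thesis using P by auto
    qed auto
  qed
  moreover have "?A \<inter> insert x ` ?B = {}" using assms by auto
  moreover have "finite ?A" "finite ?B" using assms by auto
  moreover have "inj_on (insert x) ?B"
  proof (rule inj_onI)
    fix X Y assume "X \<in> ?B" "Y \<in> ?B" "insert x X = insert x Y"
    moreover from this have "x \<notin> X" "x \<notin> Y" using assms(2) by auto
    ultimately show "X = Y" by (metis insert_ident)
  qed
  ultimately have "card {Q. Q \<subseteq> insert x F \<and> sum w Q = k} = card ?A + card ?B"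
    by (simp add: card_Un_disjoint card_image)
  moreover have "?B = (if w x \<le> k then {Q. Q \<subseteq> F \<and> sum w Q = k - w x} else {})" by auto
  ultimately show ?thesis by simp
qed

lemma card_filter_insert:
  assumes "finite F" "x \<notin> F"
  shows "card {y \<in> insert x F. P y} = card {y \<in> F. P y} + (if P x then 1 else 0)"
proof -
  have "{y \<in> insert x F. P y} = (if P x then insert x {y \<in> F. P y} else {y \<in> F. P y})" by auto
  then show ?thesis using assms by simp
qed

text \<open>The first four coefficients of the product of all \<open>1 + t^(w x)\<close>. Induction
  over the factors, where a weight above 3 leaves them unchanged.\<close>

lemma card_small_subfamilies:
  fixes w :: "'a \<Rightarrow> nat"
  assumes "finite F" "\<And>x. x \<in> F \<Longrightarrow> w x > 0"
  defines "n \<equiv> \<lambda>i. real (card {x \<in> F. w x = i})"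
  shows "real (card {Q. Q \<subseteq> F \<and> sum w Q = 0}) = 1"
    and "real (card {Q. Q \<subseteq> F \<and> sum w Q = 1}) = n 1"
    and "real (card {Q. Q \<subseteq> F \<and> sum w Q = 2}) = n 1 * (n 1 - 1) / 2 + n 2"
    and "real (card {Q. Q \<subseteq> F \<and> sum w Q = 3}) = n 1 * (n 1 - 1) * (n 1 - 2) / 6 + n 1 * n 2 + n 3"
proof -
  let ?N = "\<lambda>F k. real (card {Q. Q \<subseteq> F \<and> sum w Q = k})"
  let ?n = "\<lambda>F i. real (card {x \<in> F. w x = i})"
  have "?N F 0 = 1 \<and> ?N F 1 = ?n F 1 \<and> ?N F 2 = ?n F 1 * (?n F 1 - 1) / 2 + ?n F 2 \<and>
    ?N F 3 = ?n F 1 * (?n F 1 - 1) * (?n F 1 - 2) / 6 + ?n F 1 * ?n F 2 + ?n F 3"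
    using assms(1,2)
  proof (induction F rule: finite_induct)
    case empty
    have "{Q. Q = {} \<and> sum w Q = 0} = {{}}" "\<And>k. k > 0 \<Longrightarrow> {Q. Q = {} \<and> sum w Q = k} = {}"
      by auto
    then show ?case by simp
  next
    case (insert x F)
    have wx: "w x > 0" using insert.prems by simp
    note IH = insert.IH[OF insert.prems]
    have n: "?n (insert x F) i = ?n F i + (if w x = i then 1 else 0)" for i
      unfolding card_filter_insert[OF insert.hyps] by simp
    have N: "?N (insert x F) k = ?N F k + (if w x \<le> k then ?N F (k - w x) else 0)" for k
      unfolding card_subfamilies_insert[OF insert.hyps] by simp
    consider "w x = 1" | "w x = 2" | "w x = 3" | "w x > 3" using wx by linarith
    then show ?case
    proof cases
      case 1
      then show ?thesis unfolding n N using IH by (simp add: field_simps)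
    next
      case 2
      then show ?thesis unfolding n N using IH by (simp add: field_simps)
    next
      case 3
      then show ?thesis unfolding n N using IH by (simp add: field_simps)
    next
      case 4
      then show ?thesis unfolding n N using IH by simp
    qed
  qed
  then show "?N F 0 = 1" "?N F 1 = n 1" "?N F 2 = n 1 * (n 1 - 1) / 2 + n 2"
    "?N F 3 = n 1 * (n 1 - 1) * (n 1 - 2) / 6 + n 1 * n 2 + n 3" unfolding n_def by auto
qed

abbreviation cnt :: "nat multiset \<Rightarrow> nat \<Rightarrow> real" where
  "cnt T k \<equiv> real (count T k)"

lemma invariant_subsets_cycle_type:
  assumes S: "finite S" "p permutes S"
  defines "T \<equiv> cycle_type S p"
  shows "real (card {A. A \<subseteq> S \<and> card A = 1 \<and> p ` A = A}) = cnt T 1"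
    and "real (card {A. A \<subseteq> S \<and> card A = 2 \<and> p ` A = A}) = cnt T 1 * (cnt T 1 - 1) / 2 + cnt T 2"
    and "real (card {A. A \<subseteq> S \<and> card A = 3 \<and> p ` A = A}) =
      cnt T 1 * (cnt T 1 - 1) * (cnt T 1 - 2) / 6 + cnt T 1 * cnt T 2 + cnt T 3"
proof -
  have pos: "card X > 0" if X: "X \<in> orbs S p" for X
  proof -
    have "finite X" using X orbs_subset[OF S(2)] S(1) finite_subset by blast
    moreover have "X \<noteq> {}" using X by (auto simp: orbs_def orbit_nonempty)
    ultimately show ?thesis by (simp add: card_gt_0_iff)
  qed
  note * = card_small_subfamilies[where w = card, OF finite_orbs[OF S(1)] pos, of p]
  show "real (card {A. A \<subseteq> S \<and> card A = 1 \<and> p ` A = A}) = cnt T 1"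
    "real (card {A. A \<subseteq> S \<and> card A = 2 \<and> p ` A = A}) = cnt T 1 * (cnt T 1 - 1) / 2 + cnt T 2"
    "real (card {A. A \<subseteq> S \<and> card A = 3 \<and> p ` A = A}) =
      cnt T 1 * (cnt T 1 - 1) * (cnt T 1 - 2) / 6 + cnt T 1 * cnt T 2 + cnt T 3"
    unfolding card_invariant_subsets[OF S] T_def count_cycle_type[OF S(1)] using *(2-4) by simp_all
qed

section \<open>Inserting a point: effect on the numbers of 1-cycles and 2-cycles\<close>

lemma sum_weighted_counts:
  "(\<Sum>k\<in>#T. real k * (if k = 1 then A else if k = 2 then B else C)) =
    cnt T 1 * A + 2 * cnt T 2 * B + (real (\<Sum>\<^sub># T) - cnt T 1 - 2 * cnt T 2) * C"
  by (induction T) (auto simp: algebra_simps)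

text \<open>The new point becomes fixed, joins a fixed point and makes a 2-cycle, joins a 2-cycle
  and makes a 3-cycle, or joins a longer cycle and changes neither count. The weights are the
  numbers of points in cycles of each kind.\<close>

lemma grow_counts_nat:
  assumes "\<Sum>\<^sub># T = n"
  shows "grow (\<lambda>T. H (count T 1) (count T 2)) T =
    H (count T 1 + 1) (count T 2) + cnt T 1 * H (count T 1 - 1) (count T 2 + 1) +
    2 * cnt T 2 * H (count T 1) (count T 2 - 1) +
    (real n - cnt T 1 - 2 * cnt T 2) * H (count T 1) (count T 2)"
proof -
  let ?A = "H (count T 1 - 1) (count T 2 + 1)" and ?B = "H (count T 1) (count T 2 - 1)"
    and ?C = "H (count T 1) (count T 2)"
  have "(\<Sum>k\<in>#T. real k * H (count (add_mset (Suc k) (T - {#k#})) 1) (count (add_mset (Suc k) (T - {#k#})) 2))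
     = (\<Sum>k\<in>#T. real k * (if k = 1 then ?A else if k = 2 then ?B else ?C))"
    by (intro arg_cong[where f = sum_mset] image_mset_cong) auto
  then show ?thesis unfolding grow_def sum_weighted_counts using assms by simp
qed

text \<open>Truncated and real subtraction differ only when the count is 0, and there the
  coefficient vanishes. In this form \<open>H\<close> may be a polynomial.\<close>

lemma grow_counts:
  assumes "\<Sum>\<^sub># T = n"
  shows "grow (\<lambda>T. H (cnt T 1) (cnt T 2)) T =
    H (cnt T 1 + 1) (cnt T 2) + cnt T 1 * H (cnt T 1 - 1) (cnt T 2 + 1) +
    2 * cnt T 2 * H (cnt T 1) (cnt T 2 - 1) + (real n - cnt T 1 - 2 * cnt T 2) * H (cnt T 1) (cnt T 2)"
proof -
  have 1: "cnt T 1 * H (real (count T 1 - 1)) (real (count T 2 + 1)) = cnt T 1 * H (cnt T 1 - 1) (cnt T 2 + 1)"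
    by (cases "count T 1 = 0") (auto simp: of_nat_diff add.commute)
  have 2: "2 * cnt T 2 * H (cnt T 1) (real (count T 2 - 1)) = 2 * cnt T 2 * H (cnt T 1) (cnt T 2 - 1)"
    by (cases "count T 2 = 0") (auto simp: of_nat_diff)
  show ?thesis
    using grow_counts_nat[OF assms, of "\<lambda>a b. H (real a) (real b)"] unfolding 1 2 by (simp add: add.commute)
qed

text \<open>At \<open>n = w\<close> the coefficient of \<open>h\<close> vanishes, so the induction needs no base value.\<close>

lemma moment_step:
  assumes "\<And>n T. \<Sum>\<^sub># T = n \<Longrightarrow> grow h T = (real n + 1 - real (Suc w)) * h T + g T"
    and "\<And>n. n \<ge> w \<Longrightarrow> type_sum n g = c * real (Suc w) * fact n"
    and "n \<ge> Suc w"
  shows "type_sum n h = c * fact n"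
proof -
  have step: "type_sum (Suc n) h = (real n + 1 - real (Suc w)) * type_sum n h + type_sum n g" for n
    unfolding type_sum_Suc type_sum_linear[symmetric] by (intro type_sum_cong assms(1))
  show ?thesis using assms(3)
  proof (induction n rule: dec_induct)
    case base
    then show ?case using step[of w] assms(2)[of w] by (simp add: algebra_simps)
  next
    case (step n)
    then show ?case using \<open>\<And>n. type_sum (Suc n) h = _ n\<close>[of n] assms(2)[of n] by (simp add: algebra_simps)
  qed
qed

section \<open>Conjugacy class sizes in degrees up to 7\<close>

lemma type_sum_1: "type_sum 1 h = 1 * h {#1#}"
  using type_sum_Suc[of 0 h] by (simp add: type_sum_0 grow_def)
text \<open>The coefficients are class sizes; each table results from evaluating the preceding one
  at \<open>grow h\<close>.\<close>

lemma type_sum_2: "type_sum 2 h = 1 * h {#2#} + 1 * h {#1, 1#}"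
  using type_sum_Suc[of 1 h] unfolding type_sum_1 by (simp add: grow_def add_mset_commute numeral_2_eq_2[symmetric])

lemma type_sum_3: "type_sum 3 h = 2 * h {#3#} + 3 * h {#2, 1#} + 1 * h {#1, 1, 1#}"
  using type_sum_Suc[of 2 h] unfolding type_sum_2 by (simp add: grow_def add_mset_commute numeral_2_eq_2[symmetric])

lemma type_sum_4: "type_sum 4 h = 6 * h {#4#} + 8 * h {#3, 1#} + 3 * h {#2, 2#} + 6 * h {#2, 1, 1#} + 1 *
    h {#1, 1, 1, 1#}"
  using type_sum_Suc[of 3 h] unfolding type_sum_3 by (simp add: grow_def add_mset_commute numeral_2_eq_2[symmetric])

lemma type_sum_5: "type_sum 5 h = 24 * h {#5#} + 30 * h {#4, 1#} + 20 * h {#3, 2#} + 20 * h {#3, 1, 1#} +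
    15 * h {#2, 2, 1#} + 10 * h {#2, 1, 1, 1#} + 1 * h {#1, 1, 1, 1, 1#}"
  using type_sum_Suc[of 4 h] unfolding type_sum_4 by (simp add: grow_def add_mset_commute numeral_2_eq_2[symmetric])

lemma type_sum_6: "type_sum 6 h = 120 * h {#6#} + 144 * h {#5, 1#} + 90 * h {#4, 2#} + 90 * h {#4, 1, 1#} +
    40 * h {#3, 3#} + 120 * h {#3, 2, 1#} + 40 * h {#3, 1, 1, 1#} + 15 * h {#2, 2, 2#} + 45 * h {#2, 2, 1,
    1#} + 15 * h {#2, 1, 1, 1, 1#} + 1 * h {#1, 1, 1, 1, 1, 1#}"
  using type_sum_Suc[of 5 h] unfolding type_sum_5 by (simp add: grow_def add_mset_commute numeral_2_eq_2[symmetric])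

lemma type_sum_7: "type_sum 7 h = 720 * h {#7#} + 840 * h {#6, 1#} + 504 * h {#5, 2#} + 504 * h {#5, 1,
    1#} + 420 * h {#4, 3#} + 630 * h {#4, 2, 1#} + 210 * h {#4, 1, 1, 1#} + 280 * h {#3, 3, 1#} + 210 *
    h {#3, 2, 2#} + 420 * h {#3, 2, 1, 1#} + 70 * h {#3, 1, 1, 1, 1#} + 105 * h {#2, 2, 2, 1#} + 105 *
    h {#2, 2, 1, 1, 1#} + 21 * h {#2, 1, 1, 1, 1, 1#} + 1 * h {#1, 1, 1, 1, 1, 1, 1#}"
  using type_sum_Suc[of 6 h] unfolding type_sum_6 by (simp add: grow_def add_mset_commute numeral_2_eq_2[symmetric])

section \<open>Factorial moments of the numbers of 1-cycles and 2-cycles\<close>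

lemma type_sum_const: "type_sum n (\<lambda>_. c) = c * fact n"
  using card_permutations[of "{1..n}" n] by (simp add: type_sum_def)

text \<open>Write \<open>x\<close> and \<open>y\<close> for the numbers of 1-cycles and 2-cycles.
  The falling factorial of order \<open>a\<close> in \<open>x\<close> times that of order
  \<open>b\<close> in \<open>y\<close> has mean \<open>1/2^b\<close> once
  \<open>n \<ge> a + 2 * b\<close>, as for independent Poisson variables. Here \<open>Suc w\<close>
  is the weight \<open>a + 2 * b\<close>, and \<open>g\<close> collects the terms of
  \<open>grow h\<close> of lower weight, already known.\<close>

lemma moment_x:
  assumes "n \<ge> 1"
  shows "type_sum n (\<lambda>T. cnt T 1) = 1 * fact n"
proof (rule moment_step[where w = 0 and g = "\<lambda>T. 1"])
  fix n and T :: "nat multiset" assume T: "\<Sum>\<^sub># T = n"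
  show "grow (\<lambda>T. cnt T 1) T = (real n + 1 - real (Suc 0)) * (cnt T 1) + (1)"
    using grow_counts[OF T, of "\<lambda>x y. x"] by (simp add: algebra_simps)
next
  fix n :: nat assume "0 \<le> n"
  then show "type_sum n (\<lambda>T. 1) = 1 * real (Suc 0) * fact n"
    by (simp add: type_sum_linear type_sum_const)
qed (use assms in simp)

lemma moment_xx:
  assumes "n \<ge> 2"
  shows "type_sum n (\<lambda>T. cnt T 1 * (cnt T 1 - 1)) = 1 * fact n"
proof (rule moment_step[where w = 1 and g = "\<lambda>T. 2 * cnt T 1"])
  fix n and T :: "nat multiset" assume T: "\<Sum>\<^sub># T = n"
  show "grow (\<lambda>T. cnt T 1 * (cnt T 1 - 1)) T = (real n + 1 - real (Suc 1)) * (cnt T 1 * (cnt T 1 - 1)) +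
      (2 * cnt T 1)"
    using grow_counts[OF T, of "\<lambda>x y. x * (x - 1)"] by (simp add: algebra_simps)
next
  fix n :: nat assume "1 \<le> n"
  then show "type_sum n (\<lambda>T. 2 * cnt T 1) = 1 * real (Suc 1) * fact n"
    by (simp add: type_sum_linear type_sum_const moment_x[unfolded One_nat_def])
qed (use assms in simp)

lemma moment_xxx:
  assumes "n \<ge> 3"
  shows "type_sum n (\<lambda>T. cnt T 1 * (cnt T 1 - 1) * (cnt T 1 - 2)) = 1 * fact n"
proof (rule moment_step[where w = 2 and g = "\<lambda>T. 3 * (cnt T 1 * (cnt T 1 - 1))"])
  fix n and T :: "nat multiset" assume T: "\<Sum>\<^sub># T = n"
  show "grow (\<lambda>T. cnt T 1 * (cnt T 1 - 1) * (cnt T 1 - 2)) T = (real n + 1 - real (Suc 2)) * (cnt T 1 *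
      (cnt T 1 - 1) * (cnt T 1 - 2)) + (3 * (cnt T 1 * (cnt T 1 - 1)))"
    using grow_counts[OF T, of "\<lambda>x y. x * (x - 1) * (x - 2)"] by (simp add: algebra_simps)
next
  fix n :: nat assume "2 \<le> n"
  then show "type_sum n (\<lambda>T. 3 * (cnt T 1 * (cnt T 1 - 1))) = 1 * real (Suc 2) * fact n"
    by (simp add: type_sum_linear type_sum_const moment_xx[unfolded One_nat_def])
qed (use assms in simp)

lemma moment_xxxx:
  assumes "n \<ge> 4"
  shows "type_sum n (\<lambda>T. cnt T 1 * (cnt T 1 - 1) * (cnt T 1 - 2) * (cnt T 1 - 3)) = 1 * fact n"
proof (rule moment_step[where w = 3 and g = "\<lambda>T. 4 * (cnt T 1 * (cnt T 1 - 1) * (cnt T 1 - 2))"])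
  fix n and T :: "nat multiset" assume T: "\<Sum>\<^sub># T = n"
  show "grow (\<lambda>T. cnt T 1 * (cnt T 1 - 1) * (cnt T 1 - 2) * (cnt T 1 - 3)) T = (real n + 1 - real (Suc 3)) *
      (cnt T 1 * (cnt T 1 - 1) * (cnt T 1 - 2) * (cnt T 1 - 3)) + (4 * (cnt T 1 * (cnt T 1 - 1) *
      (cnt T 1 - 2)))"
    using grow_counts[OF T, of "\<lambda>x y. x * (x - 1) * (x - 2) * (x - 3)"] by (simp add: algebra_simps)
next
  fix n :: nat assume "3 \<le> n"
  then show "type_sum n (\<lambda>T. 4 * (cnt T 1 * (cnt T 1 - 1) * (cnt T 1 - 2))) = 1 * real (Suc 3) * fact n"
    by (simp add: type_sum_linear type_sum_const moment_xxx[unfolded One_nat_def])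
qed (use assms in simp)

lemma moment_y:
  assumes "n \<ge> 2"
  shows "type_sum n (\<lambda>T. cnt T 2) = (1 / 2) * fact n"
proof (rule moment_step[where w = 1 and g = "\<lambda>T. cnt T 1"])
  fix n and T :: "nat multiset" assume T: "\<Sum>\<^sub># T = n"
  show "grow (\<lambda>T. cnt T 2) T = (real n + 1 - real (Suc 1)) * (cnt T 2) + (cnt T 1)"
    using grow_counts[OF T, of "\<lambda>x y. y"] by (simp add: algebra_simps)
next
  fix n :: nat assume "1 \<le> n"
  then show "type_sum n (\<lambda>T. cnt T 1) = (1 / 2) * real (Suc 1) * fact n"
    by (simp add: type_sum_linear type_sum_const moment_x[unfolded One_nat_def])
qed (use assms in simp)

lemma moment_xy:
  assumes "n \<ge> 3"
  shows "type_sum n (\<lambda>T. cnt T 1 * cnt T 2) = (1 / 2) * fact n"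
proof (rule moment_step[where w = 2 and g = "\<lambda>T. cnt T 2 + cnt T 1 * (cnt T 1 - 1)"])
  fix n and T :: "nat multiset" assume T: "\<Sum>\<^sub># T = n"
  show "grow (\<lambda>T. cnt T 1 * cnt T 2) T = (real n + 1 - real (Suc 2)) * (cnt T 1 * cnt T 2) + (cnt T 2 +
      cnt T 1 * (cnt T 1 - 1))"
    using grow_counts[OF T, of "\<lambda>x y. x * y"] by (simp add: algebra_simps)
next
  fix n :: nat assume "2 \<le> n"
  then show "type_sum n (\<lambda>T. cnt T 2 + cnt T 1 * (cnt T 1 - 1)) = (1 / 2) * real (Suc 2) * fact n"
    by (simp add: type_sum_linear type_sum_const moment_y[unfolded One_nat_def] moment_xx[unfolded One_nat_def])
qed (use assms in simp)

lemma moment_xxy: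
  assumes "n \<ge> 4"
  shows "type_sum n (\<lambda>T. cnt T 1 * (cnt T 1 - 1) * cnt T 2) = (1 / 2) * fact n"
proof (rule moment_step[where w = 3 and g = "\<lambda>T. 2 * (cnt T 1 * cnt T 2) + cnt T 1 * (cnt T 1 - 1) *
    (cnt T 1 - 2)"])
  fix n and T :: "nat multiset" assume T: "\<Sum>\<^sub># T = n"
  show "grow (\<lambda>T. cnt T 1 * (cnt T 1 - 1) * cnt T 2) T = (real n + 1 - real (Suc 3)) * (cnt T 1 *
      (cnt T 1 - 1) * cnt T 2) + (2 * (cnt T 1 * cnt T 2) + cnt T 1 * (cnt T 1 - 1) * (cnt T 1 - 2))"
    using grow_counts[OF T, of "\<lambda>x y. x * (x - 1) * y"] by (simp add: algebra_simps)
next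
  fix n :: nat assume "3 \<le> n"
  then show "type_sum n (\<lambda>T. 2 * (cnt T 1 * cnt T 2) + cnt T 1 * (cnt T 1 - 1) * (cnt T 1 - 2)) = (1 / 2) *
      real (Suc 3) * fact n"
    by (simp add: type_sum_linear type_sum_const moment_xy[unfolded One_nat_def] moment_xxx[unfolded One_nat_def])
qed (use assms in simp)

lemma moment_yy:
  assumes "n \<ge> 4"
  shows "type_sum n (\<lambda>T. cnt T 2 * (cnt T 2 - 1)) = (1 / 4) * fact n"
proof (rule moment_step[where w = 3 and g = "\<lambda>T. 2 * (cnt T 1 * cnt T 2)"])
  fix n and T :: "nat multiset" assume T: "\<Sum>\<^sub># T = n"
  show "grow (\<lambda>T. cnt T 2 * (cnt T 2 - 1)) T = (real n + 1 - real (Suc 3)) * (cnt T 2 * (cnt T 2 - 1)) +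
      (2 * (cnt T 1 * cnt T 2))"
    using grow_counts[OF T, of "\<lambda>x y. y * (y - 1)"] by (simp add: algebra_simps)
next
  fix n :: nat assume "3 \<le> n"
  then show "type_sum n (\<lambda>T. 2 * (cnt T 1 * cnt T 2)) = (1 / 4) * real (Suc 3) * fact n"
    by (simp add: type_sum_linear type_sum_const moment_xy[unfolded One_nat_def])
qed (use assms in simp)

section \<open>Norms of the three characters available in every large enough degree\<close>

lemma norm_chi1:
  assumes "n \<ge> 2"
  shows "type_sum n (\<lambda>T. (cnt T 1 - 1)^2) = fact n"
proof -
  have "(\<lambda>T. (cnt T 1 - 1)^2) = (\<lambda>T. 1 * (cnt T 1 * (cnt T 1 - 1)) + ((- 1) * (cnt T 1) + (1 * 1)))"
    by (rule ext) (simp add: power2_eq_square field_simps)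
  then show ?thesis
    unfolding type_sum_linear using assms
    by (simp only: type_sum_linear type_sum_const moment_x moment_xx)
qed

text \<open>Expansion in falling factorials; term by term the means add up to 1/4 - 1/2 + 1 + 1/2 -
  1 + 1/4 + 1/2 = 1. The terms of weight 4 account for \<open>n \<ge> 4\<close>.\<close>

lemma norm_chi2:
  assumes "n \<ge> 4"
  shows "type_sum n (\<lambda>T. (cnt T 1 * (cnt T 1 - 3) / 2 + cnt T 2)^2) = fact n"
proof -
  have "(\<lambda>T. (cnt T 1 * (cnt T 1 - 3) / 2 + cnt T 2)^2) = (\<lambda>T. (1 / 4) * (cnt T 1 * (cnt T 1 - 1) *
      (cnt T 1 - 2) * (cnt T 1 - 3)) + ((- 1 / 2) * (cnt T 1 * (cnt T 1 - 1)) + (1 * (cnt T 1) + (1 *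
      (cnt T 1 * (cnt T 1 - 1) * cnt T 2) + ((- 2) * (cnt T 1 * cnt T 2) + (1 * (cnt T 2 * (cnt T 2 - 1)) +
      (1 * (cnt T 2))))))))"
    by (rule ext) (simp add: power2_eq_square field_simps)
  then show ?thesis
    unfolding type_sum_linear using assms
    by (simp only: type_sum_linear type_sum_const moment_x moment_xx moment_xxxx moment_y moment_xy moment_xxy moment_yy)
qed

lemma norm_chi11:
  assumes "n \<ge> 4"
  shows "type_sum n (\<lambda>T. ((cnt T 1 - 1) * (cnt T 1 - 2) / 2 - cnt T 2)^2) = fact n"
proof -
  have "(\<lambda>T. ((cnt T 1 - 1) * (cnt T 1 - 2) / 2 - cnt T 2)^2) = (\<lambda>T. (1 / 4) * (cnt T 1 * (cnt T 1 - 1) *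
      (cnt T 1 - 2) * (cnt T 1 - 3)) + ((1 / 2) * (cnt T 1 * (cnt T 1 - 1)) + ((- 1) * (cnt T 1) + (1 * 1 +
      ((- 1) * (cnt T 1 * (cnt T 1 - 1) * cnt T 2) + (2 * (cnt T 1 * cnt T 2) + ((- 1) * (cnt T 2) + (1 *
      (cnt T 2 * (cnt T 2 - 1))))))))))"
    by (rule ext) (simp add: power2_eq_square field_simps)
  then show ?thesis
    unfolding type_sum_linear using assms
    by (simp only: type_sum_linear type_sum_const moment_x moment_xx moment_xxxx moment_y moment_xy moment_xxy moment_yy)
qed

text \<open>The proportions of permutations without 1-cycles, and without 1- and 2-cycles.\<close>

fun derangement_ratio :: "nat \<Rightarrow> real" where
  "derangement_ratio 0 = 1"
| "derangement_ratio (Suc 0) = 0"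
| "derangement_ratio (Suc (Suc n)) = (real (Suc n) * derangement_ratio (Suc n) +
    derangement_ratio n) / real (Suc (Suc n))"

fun long_cycle_ratio :: "nat \<Rightarrow> real" where
  "long_cycle_ratio 0 = 1"
| "long_cycle_ratio (Suc 0) = 0"
| "long_cycle_ratio (Suc (Suc 0)) = 0"
| "long_cycle_ratio (Suc (Suc (Suc n))) = (real (Suc (Suc n)) * long_cycle_ratio (Suc (Suc n)) +
    long_cycle_ratio n) / real (Suc (Suc (Suc n)))"

text \<open>Extended by 0 to negative arguments, both recurrences hold without side conditions.\<close>

definition derangement_ratio_int :: "int \<Rightarrow> real" where "derangement_ratio_int k =
    (if k < 0 then 0 else derangement_ratio (nat k))"
definition long_cycle_ratio_int :: "int \<Rightarrow> real" where "long_cycle_ratio_int k =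
    (if k < 0 then 0 else long_cycle_ratio (nat k))"

lemma derangement_ratio_int_rec: "real_of_int k * derangement_ratio_int k = real_of_int (k - 1) *
    derangement_ratio_int (k - 1) + derangement_ratio_int (k - 2)"
proof -
  consider "k < 0" | "k = 0" | "k = 1" | n where "k = int (Suc (Suc n))"
    by (metis One_nat_def int_nat_eq linorder_not_less nat_0_iff not0_implies_Suc of_nat_0 of_nat_1)
  then show ?thesis
  proof cases
    case (4 n)
    then have "nat k = Suc (Suc n)" "nat (k - 1) = Suc n" "nat (k - 2) = n" by auto
    then show ?thesis using 4 by (simp add: derangement_ratio_int_def)
  qed (simp_all add: derangement_ratio_int_def)
qed

lemma long_cycle_ratio_int_rec: "real_of_int k * long_cycle_ratio_int k = real_of_int (k - 1) *
    long_cycle_ratio_int (k - 1) + long_cycle_ratio_int (k - 3)"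
proof -
  consider "k < 0" | "k = 0" | "k = 1" | "k = 2" | n where "k = int (Suc (Suc (Suc n)))"
  proof -
    assume *: "k < 0 \<Longrightarrow> thesis" "k = 0 \<Longrightarrow> thesis" "k = 1 \<Longrightarrow> thesis" "k = 2 \<Longrightarrow> thesis"
      "\<And>n. k = int (Suc (Suc (Suc n))) \<Longrightarrow> thesis"
    have "k = int (Suc (Suc (Suc (nat (k - 3)))))" if "k \<ge> 3" using that by simp
    then show thesis using * by fastforce
  qed
  then show ?thesis
  proof cases
    case (5 n)
    then have "nat k = Suc (Suc (Suc n))" "nat (k - 1) = Suc (Suc n)" "nat (k - 3) = n" by auto
    then show ?thesis using 5 by (simp add: long_cycle_ratio_int_def)
  qed (simp_all add: long_cycle_ratio_int_def numeral_2_eq_2)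
qed

section \<open>Exact distribution of the numbers of 1-cycles and 2-cycles\<close>

lemma type_sum_count1:
  "type_sum n (\<lambda>T. of_bool (count T 1 = a)) = fact n * derangement_ratio_int (int n - int a) / fact a"
proof (induction n arbitrary: a)
  case 0
  show ?case by (auto simp: type_sum_0 derangement_ratio_int_def)
next
  case (Suc n)
  let ?I = "\<lambda>a T. of_bool (count T 1 = a) :: real"
  let ?k = "int (Suc n) - int a"
  have collect: "x * (f * p / w) + f * q / w + f * r / w = f / w * (x * p + (r + q))" for x f p w q r :: real
    by (simp add: distrib_left add_divide_distrib)
  have g: "grow (?I a) T = (if a = 0 then 0 else ?I (a - 1) T) + (real a + 1) * ?I (a + 1) T +
      (real n - real a) * ?I a T"
    if "\<Sum>\<^sub># T = n" for T
  proof -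
    have 1: "?I a (add_mset 1 T) = (if a = 0 then 0 else ?I (a - 1) T)" by (cases a) auto
    have 2: "cnt T 1 * of_bool (count T 1 - 1 = a) = (real a + 1) * ?I (a + 1) T"
      by (cases "count T 1") auto
    have 3: "2 * cnt T 2 * ?I a T + (real n - cnt T 1 - 2 * cnt T 2) * ?I a T = (real n - real a) * ?I a T"
      by (auto simp: algebra_simps)
    show ?thesis
      using grow_counts_nat[OF that, of "\<lambda>x y. of_bool (x = a)"] 1 2 3 by simp
  qed
  have "type_sum (Suc n) (?I a) = type_sum n (\<lambda>T. (if a = 0 then 0 else ?I (a - 1) T) + (real a + 1) *
      ?I (a + 1) T + (real n - real a) * ?I a T)"
    unfolding type_sum_Suc by (intro type_sum_cong g)
  also have "\<dots> = type_sum n (\<lambda>T. if a = 0 then 0 else ?I (a - 1) T) + (real a + 1) * type_sum n (?I (a +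
      1)) + (real n - real a) * type_sum n (?I a)"
    by (simp only: type_sum_linear)
  \<comment> \<open>For \<open>a = 0\<close> both sides are 0: the factor \<open>real a\<close>
    absorbs the case distinction. The number of remaining points is \<open>?k\<close> when one comes
    from \<open>a - 1\<close> fixed points, \<open>?k - 2\<close> from \<open>a + 1\<close>, and
    \<open>?k - 1\<close> from \<open>a\<close>, which are the arguments of the derangement
    recurrence.\<close>
  also have "type_sum n (\<lambda>T. if a = 0 then 0 else ?I (a - 1) T) = real a * (fact n *
      derangement_ratio_int ?k / fact a)"
  proof (cases a)
    case (Suc b)
    have "int n - int b = ?k" using Suc by simp
    moreover have "real a * (z / fact a) = z / fact b" for z :: real
      unfolding Suc fact_Suc by (simp del: of_nat_Suc)
    ultimately show ?thesis using Suc.IH[of b] Suc by simp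
  qed (simp add: type_sum_const)
  also have "(real a + 1) * type_sum n (?I (a + 1)) = fact n * derangement_ratio_int (?k - 2) / fact a"
  proof -
    have k: "int n - int (Suc a) = ?k - 2" by simp
    have "(real a + 1) * (z / fact (Suc a)) = z / fact a" for z :: real
    proof -
      have e: "real a + 1 = real (Suc a)" by simp
      show ?thesis unfolding e fact_Suc by (simp del: of_nat_Suc)
    qed
    then show ?thesis unfolding Suc_eq_plus1[symmetric] Suc.IH k .
  qed
  also have "(real n - real a) * type_sum n (?I a) = fact n * (real_of_int (?k - 1) *
      derangement_ratio_int (?k - 1)) / fact a"
  proof -
    have "int n - int a = ?k - 1" by simp
    then show ?thesis unfolding Suc.IH by simp
  qed
  finally have "type_sum (Suc n) (?I a) = fact n / fact a * (real a * derangement_ratio_int ?k +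
      (real_of_int (?k - 1) * derangement_ratio_int (?k - 1) + derangement_ratio_int (?k - 2)))"
    by (simp only: collect)
  also have "real_of_int (?k - 1) * derangement_ratio_int (?k - 1) + derangement_ratio_int (?k - 2) =
      real_of_int ?k * derangement_ratio_int ?k" by (rule derangement_ratio_int_rec[symmetric])
  also have "fact n / fact a * (real a * derangement_ratio_int ?k + real_of_int ?k *
      derangement_ratio_int ?k) = fact (Suc n) * derangement_ratio_int ?k / fact a"
    by (simp add: field_simps)
  finally show ?case .
qed

text \<open>The denominator is the centralizer order of \<open>a\<close> fixed points and
  \<open>b\<close> 2-cycles, and the remaining points carry only longer cycles. The induction
  inserts a point: sources with one fixed point fewer, or with one 2-cycle fewer and one fixed point
  more, keep the argument \<open>?k\<close>; a 2-cycle turned into a 3-cycle gives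
  \<open>?k - 3\<close>, and the unchanged counts give \<open>?k - 1\<close>.\<close>

lemma type_sum_count12:
  "type_sum n (\<lambda>T. of_bool (count T 1 = a \<and> count T 2 = b)) =
    fact n * long_cycle_ratio_int (int n - int a - 2 * int b) / (fact a * fact b * 2 ^ b)"
proof (induction n arbitrary: a b)
  case 0
  show ?case by (cases "a = 0 \<and> b = 0") (auto simp: type_sum_0 long_cycle_ratio_int_def)
next
  case (Suc n)
  let ?I = "\<lambda>a b T. of_bool (count T 1 = a \<and> count T 2 = b) :: real"
  let ?k = "int (Suc n) - int a - 2 * int b"
  let ?W = "fact a * fact b * 2 ^ b :: real"
  have collect: "x * (f * p / w) + y * (f * p / w) + f * q / w + f * r / w = f / w * ((x + y) * p + (r + q))"
    for x y f p w q r :: real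
    by (simp add: distrib_left distrib_right add_divide_distrib mult.left_commute)
  have g: "grow (?I a b) T = (if a = 0 then 0 else ?I (a - 1) b T) +
      (real a + 1) * (if b = 0 then 0 else ?I (a + 1) (b - 1) T) +
      2 * (real b + 1) * ?I a (b + 1) T + (real n - real a - 2 * real b) * ?I a b T"
    if "\<Sum>\<^sub># T = n" for T
  proof -
    have 1: "?I a b (add_mset 1 T) = (if a = 0 then 0 else ?I (a - 1) b T)"
      by (cases a) auto
    have 2: "cnt T 1 * of_bool (count T 1 - 1 = a \<and> count T 2 + 1 = b) =
      (real a + 1) * (if b = 0 then 0 else ?I (a + 1) (b - 1) T)"
      by (cases "count T 1"; cases b) auto
    have 3: "2 * cnt T 2 * of_bool (count T 1 = a \<and> count T 2 - 1 = b) = 2 * (real b + 1) * ?I a (b + 1) T"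
      by (cases "count T 2") auto
    show ?thesis
      using grow_counts_nat[OF that, of "\<lambda>x y. of_bool (x = a \<and> y = b)"] 1 2 3
      by (auto simp: of_bool_def)
  qed
  have "type_sum (Suc n) (?I a b) = type_sum n (\<lambda>T. (if a = 0 then 0 else ?I (a - 1) b T) +
      (real a + 1) * (if b = 0 then 0 else ?I (a + 1) (b - 1) T) +
      2 * (real b + 1) * ?I a (b + 1) T + (real n - real a - 2 * real b) * ?I a b T)"
    unfolding type_sum_Suc by (intro type_sum_cong g)
  also have "\<dots> = type_sum n (\<lambda>T. if a = 0 then 0 else ?I (a - 1) b T) +
      (real a + 1) * type_sum n (\<lambda>T. if b = 0 then 0 else ?I (a + 1) (b - 1) T) +
      2 * (real b + 1) * type_sum n (?I a (b + 1)) + (real n - real a - 2 * real b) * type_sum n (?I a b)"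
    by (simp only: type_sum_linear)
  also have "type_sum n (\<lambda>T. if a = 0 then 0 else ?I (a - 1) b T) = real a * (fact n *
      long_cycle_ratio_int ?k / ?W)"
  proof (cases a)
    case (Suc c)
    have "int n - int c - 2 * int b = ?k" using Suc by simp
    moreover have "real a * (z / ?W) = z / (fact c * fact b * 2 ^ b)" for z :: real
      unfolding Suc fact_Suc by (simp del: of_nat_Suc)
    ultimately show ?thesis using Suc.IH[of c b] Suc by simp
  qed (simp add: type_sum_const)
  also have "(real a + 1) * type_sum n (\<lambda>T. if b = 0 then 0 else ?I (a + 1) (b - 1) T) = 2 * real b *
      (fact n * long_cycle_ratio_int ?k / ?W)"
  proof (cases b)
    case (Suc c)
    have k: "int n - int (Suc a) - 2 * int c = ?k" using Suc by simp
    have z: "(real a + 1) * (z / (fact (Suc a) * fact c * 2 ^ c)) = 2 * real b * (z / ?W)" for z :: real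
    proof -
      have e: "real a + 1 = real (Suc a)" by simp
      show ?thesis unfolding e Suc fact_Suc power_Suc by (simp del: of_nat_Suc)
    qed
    have "type_sum n (\<lambda>T. if b = 0 then 0 else ?I (a + 1) (b - 1) T) = type_sum n (?I (Suc a) c)"
      using Suc by simp
    then show ?thesis unfolding Suc.IH k using z by simp
  qed (simp add: type_sum_const)
  also have "2 * (real b + 1) * type_sum n (?I a (b + 1)) = fact n * long_cycle_ratio_int (?k - 3) / ?W"
  proof -
    have k: "int n - int a - 2 * int (Suc b) = ?k - 3" by simp
    have "2 * (real b + 1) * (z / (fact a * fact (Suc b) * 2 ^ Suc b)) = z / ?W" for z :: real
    proof -
      have e: "real b + 1 = real (Suc b)" by simp
      show ?thesis unfolding e fact_Suc power_Suc by (simp del: of_nat_Suc)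
    qed
    then show ?thesis unfolding Suc_eq_plus1[symmetric] Suc.IH k .
  qed
  also have "(real n - real a - 2 * real b) * type_sum n (?I a b) = fact n * (real_of_int (?k - 1) *
      long_cycle_ratio_int (?k - 1)) / ?W"
  proof -
    have k: "int n - int a - 2 * int b = ?k - 1" by simp
    have r: "real n - real a - 2 * real b = real_of_int (?k - 1)" by simp
    show ?thesis unfolding Suc.IH k r by (simp only: times_divide_eq_right mult.left_commute)
  qed
  finally have "type_sum (Suc n) (?I a b) = fact n / ?W * ((real a + 2 * real b) * long_cycle_ratio_int ?k +
      (real_of_int (?k - 1) * long_cycle_ratio_int (?k - 1) + long_cycle_ratio_int (?k - 3)))"
    by (simp only: collect)
  also have "real_of_int (?k - 1) * long_cycle_ratio_int (?k - 1) + long_cycle_ratio_int (?k - 3) =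
      real_of_int ?k * long_cycle_ratio_int ?k" by (rule long_cycle_ratio_int_rec[symmetric])
  also have "fact n / ?W * ((real a + 2 * real b) * long_cycle_ratio_int ?k + real_of_int ?k *
      long_cycle_ratio_int ?k) = fact (Suc n) * long_cycle_ratio_int ?k / ?W"
    by (simp add: field_simps)
  finally show ?case .
qed

text \<open>Each value is a weighted mean of the two before it, so a lower bound for two consecutive
  values persists. The constant lies just below \<open>derangement_ratio 7\<close>, which is
  0.36785...\<close>

lemma derangement_ratio_ge: "derangement_ratio (n + 6) \<ge> 3678 / 10000"
proof -
  have "derangement_ratio (n + 6) \<ge> 3678 / 10000 \<and> derangement_ratio (n + 7) \<ge> 3678 / 10000"
  proof (induction n)
    case (Suc n)
    have "derangement_ratio (n + 8) = (real (n + 7) * derangement_ratio (n + 7) + derangement_ratio (n +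
        6)) / real (n + 8)"
      using derangement_ratio.simps(3)[of "n + 6"] by (simp add: add.commute numeral_eq_Suc)
    also have "\<dots> \<ge> (real (n + 7) * (3678 / 10000) + 3678 / 10000) / real (n + 8)"
      using Suc by (intro divide_right_mono add_mono mult_left_mono) auto
    also have "(real (n + 7) * (3678 / 10000) + 3678 / 10000) / real (n + 8) = 3678 / 10000"
      by (simp add: field_simps)
    finally show ?case using Suc by (simp add: numeral_eq_Suc)
  qed (simp add: numeral_eq_Suc)
  then show ?thesis by simp
qed

text \<open>Each value is a weighted mean of those one and three places before, so a bound for three
  consecutive values persists. The constant lies just below \<open>long_cycle_ratio 9\<close>, which
  is 0.22283... and the least of the three initial values.\<close>

lemma long_cycle_ratio_ge: "long_cycle_ratio (n + 8) \<ge> 2228 / 10000"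
proof -
  have "long_cycle_ratio (n + 8) \<ge> 2228 / 10000 \<and> long_cycle_ratio (n + 9) \<ge> 2228 / 10000 \<and>
      long_cycle_ratio (n + 10) \<ge> 2228 / 10000"
  proof (induction n)
    case (Suc n)
    have "long_cycle_ratio (n + 11) = (real (n + 10) * long_cycle_ratio (n + 10) + long_cycle_ratio (n +
        8)) / real (n + 11)"
      using long_cycle_ratio.simps(4)[of "n + 8"] by (simp add: add.commute numeral_eq_Suc)
    also have "\<dots> \<ge> (real (n + 10) * (2228 / 10000) + 2228 / 10000) / real (n + 11)"
      using Suc by (intro divide_right_mono add_mono mult_left_mono) auto
    also have "(real (n + 10) * (2228 / 10000) + 2228 / 10000) / real (n + 11) = 2228 / 10000"
      by (simp add: field_simps)
    finally show ?case using Suc by (simp add: numeral_eq_Suc)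
  qed (simp add: numeral_eq_Suc)
  then show ?thesis by simp
qed

section \<open>Characters of symmetric groups\<close>

declare One_nat_def [simp del]

definition class_fun :: "nat \<Rightarrow> (nat multiset \<Rightarrow> real) \<Rightarrow> (nat \<Rightarrow> nat) \<Rightarrow> complex" where
  "class_fun n f p = of_real (f (cycle_type {1..n} p))"

definition class_virtual :: "nat \<Rightarrow> (nat multiset \<Rightarrow> real) \<Rightarrow> bool" where
  "class_virtual n f \<longleftrightarrow> virtual (sym_group n) (class_fun n f)"

lemma finite_sym_group: "finite (carrier (sym_group n))"
  by (simp add: sym_group_def finite_permutations)

lemma card_sym_group: "card (carrier (sym_group n)) = fact n"
  by (rule sym_group_card_carrier)

lemma class_virtual_cong:
  assumes "class_virtual n f" "\<And>T. f T = g T"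
  shows "class_virtual n g"
proof -
  have "f = g" using assms(2) by (rule ext)
  then show ?thesis using assms(1) by simp
qed

lemma class_virtual_add: "class_virtual n f \<Longrightarrow> class_virtual n g \<Longrightarrow> class_virtual n (\<lambda>T. f T + g T)"
  unfolding class_virtual_def class_fun_def of_real_add by (rule virtual_add)

lemma class_virtual_diff: "class_virtual n f \<Longrightarrow> class_virtual n g \<Longrightarrow> class_virtual n (\<lambda>T. f T - g T)"
  unfolding class_virtual_def class_fun_def of_real_diff by (rule virtual_diff)

lemma class_virtual_mult: "class_virtual n f \<Longrightarrow> class_virtual n g \<Longrightarrow> class_virtual n (\<lambda>T. f T * g T)"
  unfolding class_virtual_def class_fun_def of_real_mult by (rule virtual_mult[OF sym_group_is_group])

lemma class_virtual_of_int: "class_virtual n (\<lambda>T. of_int c)"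
  unfolding class_virtual_def class_fun_def of_real_of_int_eq by (rule virtual_of_int[OF sym_group_is_group])

lemma class_virtual_1: "class_virtual n (\<lambda>T. 1)"
  using class_virtual_of_int[of n 1] by simp

lemma class_virtual_numeral: "class_virtual n (\<lambda>T. numeral k)"
  using class_virtual_of_int[of n "numeral k"] by simp

lemma class_virtual_sign: "class_virtual n (\<lambda>T. of_int (type_sign T))"
proof -
  have "virtual (sym_group n) (\<lambda>p. of_int (sign p))"
  proof (rule virtual_linear_character[OF sym_group_is_group])
    show "of_int (sign \<one>\<^bsub>sym_group n\<^esub>) = (1 :: complex)" by (simp add: sym_group_one)
    fix p q assume "p \<in> carrier (sym_group n)" "q \<in> carrier (sym_group n)"
    then show "of_int (sign (p \<otimes>\<^bsub>sym_group n\<^esub> q)) = (of_int (sign p) * of_int (sign q) :: complex)"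
      using sym_group_carrier' by (simp add: sym_group_mult sign_compose)
  qed
  then show ?thesis
    unfolding class_virtual_def class_fun_def
    by (rule virtual_cong) (simp add: sym_group_carrier sign_cycle_type)
qed

lemma virtual_invariant_subsets:
  "virtual (sym_group n) (\<lambda>p. of_nat (card {A. A \<subseteq> {1..n} \<and> card A = k \<and> p ` A = A}))"
proof -
  let ?X = "{A. A \<subseteq> {1..n} \<and> card A = k}"
  have "virtual (sym_group n) (\<lambda>p. of_nat (card {A \<in> ?X. p ` A = A}))"
  proof (rule virtual_permutation_character[OF sym_group_is_group])
    show "finite ?X" by simp
    fix p A assume "p \<in> carrier (sym_group n)" and A: "A \<in> ?X"
    then have p: "p permutes {1..n}" by (simp add: sym_group_carrier)
    have "p ` A \<subseteq> {1..n}" using p A permutes_in_image[OF p] by auto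
    moreover have "card (p ` A) = k" using A permutes_inj_on[OF p, of A] by (simp add: card_image)
    ultimately show "p ` A \<in> ?X" by simp
  next
    fix A assume "A \<in> ?X"
    show "\<one>\<^bsub>sym_group n\<^esub> ` A = A" by (simp add: sym_group_one)
  next
    fix p q and A :: "nat set"
    show "(p \<otimes>\<^bsub>sym_group n\<^esub> q) ` A = p ` q ` A" by (simp add: sym_group_mult image_comp)
  qed
  moreover have "{A \<in> ?X. p ` A = A} = {A. A \<subseteq> {1..n} \<and> card A = k \<and> p ` A = A}" for p
    by auto
  ultimately show ?thesis by simp
qed

text \<open>The permutation character on 2-subsets: an invariant pair consists of two fixed points
  or is a 2-cycle.\<close>

definition pairs_fixed :: "nat multiset \<Rightarrow> real" where
  "pairs_fixed T = cnt T 1 * (cnt T 1 - 1) / 2 + cnt T 2"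

text \<open>The permutation character on 3-subsets: three fixed points, a fixed point with a
  2-cycle, or a 3-cycle.\<close>

definition triples_fixed :: "nat multiset \<Rightarrow> real" where
  "triples_fixed T = cnt T 1 * (cnt T 1 - 1) * (cnt T 1 - 2) / 6 + cnt T 1 * cnt T 2 + cnt T 3"

lemma class_virtual_invariant_subsets:
  assumes "\<And>p. p permutes {1..n} \<Longrightarrow>
    real (card {A. A \<subseteq> {1..n} \<and> card A = k \<and> p ` A = A}) = f (cycle_type {1..n} p)"
  shows "class_virtual n f"
  unfolding class_virtual_def
proof (rule virtual_cong[OF virtual_invariant_subsets])
  fix p assume "p \<in> carrier (sym_group n)"
  then have eq: "real (card {A. A \<subseteq> {1..n} \<and> card A = k \<and> p ` A = A}) = f (cycle_type {1..n} p)"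
    using assms by (simp add: sym_group_carrier)
  show "of_nat (card {A. A \<subseteq> {1..n} \<and> card A = k \<and> p ` A = A}) = class_fun n f p"
    unfolding class_fun_def eq[symmetric] by simp
qed

lemma class_virtual_fixed:
  "class_virtual n (\<lambda>T. cnt T 1)" "class_virtual n pairs_fixed" "class_virtual n triples_fixed"
proof -
  show "class_virtual n (\<lambda>T. cnt T 1)"
    by (rule class_virtual_invariant_subsets[where k = 1]) (rule invariant_subsets_cycle_type(1)[OF finite_atLeastAtMost])
  show "class_virtual n pairs_fixed"
    by (rule class_virtual_invariant_subsets[where k = 2], unfold pairs_fixed_def)
      (rule invariant_subsets_cycle_type(2)[OF finite_atLeastAtMost])
  show "class_virtual n triples_fixed"
    by (rule class_virtual_invariant_subsets[where k = 3], unfold triples_fixed_def)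
      (rule invariant_subsets_cycle_type(3)[OF finite_atLeastAtMost])
qed

lemmas class_virtual_intros = class_virtual_fixed class_virtual_sign class_virtual_1 class_virtual_numeral
  class_virtual_add class_virtual_diff class_virtual_mult

lemma cycle_type_id: "finite S \<Longrightarrow> cycle_type S id = replicate_mset (card S) 1"
proof -
  assume "finite S"
  have "orbit id x = {x}" for x :: 'a by (simp add: orbit_eq_singleton_iff)
  then have "orbs S id = (\<lambda>x. {x}) ` S" by (auto simp: orbs_def)
  moreover have "image_mset card (mset_set ((\<lambda>x. {x}) ` S)) = image_mset (\<lambda>x. 1) (mset_set S)"
    by (subst image_mset_mset_set[symmetric]) (simp_all add: multiset.map_comp comp_def One_nat_def)
  ultimately show ?thesis by (simp add: cycle_type_def image_mset_const_eq)
qed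

text \<open>The norm criterion for irreducibility, expressed on cycle types. Inverse permutations
  have equal cycle types, so the pairing of \<open>f\<close> with itself is the sum of its squares;
  the last conjunct is positivity of the degree.\<close>

definition class_irr :: "nat \<Rightarrow> (nat multiset \<Rightarrow> real) \<Rightarrow> bool" where
  "class_irr n f \<longleftrightarrow> class_virtual n f \<and> type_sum n (\<lambda>T. (f T)^2) = fact n \<and> f (replicate_mset n 1) > 0"

lemma class_fun_Irr:
  assumes "class_irr n f"
  shows "restrict (class_fun n f) (carrier (sym_group n)) \<in> Irr (sym_group n)"
proof (rule virtual_norm_one_Irr[OF sym_group_is_group finite_sym_group])
  have v: "class_virtual n f" and norm: "type_sum n (\<lambda>T. (f T)^2) = fact n"
    and pos: "f (replicate_mset n 1) > 0"
    using assms by (auto simp: class_irr_def)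
  show "virtual (sym_group n) (class_fun n f)" using v by (simp add: class_virtual_def)
  have "(\<Sum>p\<in>carrier (sym_group n). class_fun n f p * class_fun n f (inv\<^bsub>sym_group n\<^esub> p))
      = (\<Sum>p | p permutes {1..n}. of_real ((f (cycle_type {1..n} p))^2))"
  proof (rule sum.cong)
    fix p assume "p \<in> {p. p permutes {1..n}}"
    then have p: "p permutes {1..n}" by simp
    then have "inv\<^bsub>sym_group n\<^esub> p = inv' p" by (simp add: sym_group_carrier)
    then show "class_fun n f p * class_fun n f (inv\<^bsub>sym_group n\<^esub> p) = of_real ((f (cycle_type {1..n} p))^2)"
      using cycle_type_inv[OF _ p] by (simp add: class_fun_def power2_eq_square)
  qed (simp add: sym_group_def)
  also have "\<dots> = of_real (fact n)" unfolding norm[symmetric] type_sum_def by simp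
  finally show "(\<Sum>p\<in>carrier (sym_group n). class_fun n f p * class_fun n f (inv\<^bsub>sym_group n\<^esub> p))
      = of_nat (card (carrier (sym_group n)))" by (simp add: card_sym_group)
  show "Re (class_fun n f \<one>\<^bsub>sym_group n\<^esub>) > 0"
    using pos by (simp add: class_fun_def sym_group_one cycle_type_id)
qed

lemma class_fun_vanishing:
  assumes irr: "class_irr n f"
    and p: "p permutes {1..n}" "f (cycle_type {1..n} p) = 0"
  shows "p \<in> vanishing_elements (sym_group n)"
proof -
  let ?\<chi> = "restrict (class_fun n f) (carrier (sym_group n))"
  have pc: "p \<in> carrier (sym_group n)" using p by (simp add: sym_group_carrier)
  then have "?\<chi> p = 0" using p by (simp add: class_fun_def)
  then show ?thesis
    unfolding vanishing_elements_def using pc class_fun_Irr[OF irr] by blast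
qed

lemma type_sum_of_bool:
  "type_sum n (\<lambda>T. of_bool (Z T)) = real (card {p. p permutes {1..n} \<and> Z (cycle_type {1..n} p)})"
proof -
  have "finite {p. p permutes {1..n}}" by (simp add: finite_permutations)
  then show ?thesis
    unfolding type_sum_def of_bool_def by (simp add: sum.If_cases Int_def conj_commute)
qed

lemma vanishing_proportion_ge:
  assumes "\<And>p. p permutes {1..n} \<Longrightarrow> Z (cycle_type {1..n} p) \<Longrightarrow> p \<in> vanishing_elements (sym_group n)"
  shows "vanishing_proportion (sym_group n) \<ge> type_sum n (\<lambda>T. of_bool (Z T)) / fact n"
proof -
  have "finite (vanishing_elements (sym_group n))"
    using finite_sym_group by (rule rev_finite_subset) (auto simp: vanishing_elements_def)
  then have "card {p. p permutes {1..n} \<and> Z (cycle_type {1..n} p)} \<le> card (vanishing_elements (sym_group n))"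
    using assms by (intro card_mono) auto
  then show ?thesis
    unfolding vanishing_proportion_def type_sum_of_bool Coset.order_def card_sym_group
    by (simp add: divide_right_mono)
qed

text \<open>\<open>L\<close> exhausts the irreducible characters because of \<open>reg\<close>, the
  relation for the regular character tested once per cycle type. The assumptions
  \<open>types\<close> (no permutation has a type outside \<open>Ts\<close>) and \<open>id\<close>
  (only the identity has \<open>n\<close> fixed points) are phrased through \<open>type_sum\<close>
  so that the class tables decide them.\<close>

lemma vanishing_elements_complete:
  fixes L :: "(nat multiset \<Rightarrow> real) list" and n :: nat
  defines "e \<equiv> replicate_mset n (1 :: nat)"
  assumes irr: "\<And>f. f \<in> set L \<Longrightarrow> class_irr n f"
    and types: "type_sum n (\<lambda>T. of_bool (T \<notin> set Ts)) = 0"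
    and id: "type_sum n (\<lambda>T. of_bool (count T 1 = n)) = 1"
    and reg: "\<And>T. T \<in> set Ts \<Longrightarrow> sum_list (map (\<lambda>f. f e * f T) L) = (if count T 1 = n then fact n else 0)"
    and p: "p permutes {1..n}"
  shows "p \<in> vanishing_elements (sym_group n) \<longleftrightarrow> (\<exists>f\<in>set L. f (cycle_type {1..n} p) = 0)"
proof
  let ?G = "sym_group n"
  have eid: "cycle_type {1..n} id = e" by (simp add: cycle_type_id e_def)
  have Ts: "cycle_type {1..n} q \<in> set Ts" if "q permutes {1..n}" for q
  proof (rule ccontr)
    assume "cycle_type {1..n} q \<notin> set Ts"
    then have "q \<in> {p. p permutes {1..n} \<and> cycle_type {1..n} p \<notin> set Ts}" using that by simp
    moreover have "finite {p. p permutes {1..n} \<and> cycle_type {1..n} p \<notin> set Ts}"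
      by (rule finite_subset[OF _ finite_permutations[of "{1..n}"]]) auto
    moreover have "card {p. p permutes {1..n} \<and> cycle_type {1..n} p \<notin> set Ts} = 0"
      using types unfolding type_sum_of_bool by simp
    ultimately show False by (metis card_0_eq empty_iff)
  qed
  have e_iff: "count (cycle_type {1..n} q) 1 = n \<longleftrightarrow> q = id" if "q permutes {1..n}" for q
  proof
    assume q: "count (cycle_type {1..n} q) 1 = n"
    have "card {p. p permutes {1..n} \<and> count (cycle_type {1..n} p) 1 = n} = 1"
      using id unfolding type_sum_of_bool by simp
    then obtain r where r: "{p. p permutes {1..n} \<and> count (cycle_type {1..n} p) 1 = n} = {r}"
      by (rule card_1_singletonE)
    have "id \<in> {r}" unfolding r[symmetric] by (simp add: eid e_def permutes_id)
    moreover have "q \<in> {r}" unfolding r[symmetric] using q that by simp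
    ultimately show "q = id" by simp
  qed (simp add: eid e_def)
  have L: "L ! i \<in> set L" if "i \<in> {..<length L}" for i using that by simp
  assume "p \<in> vanishing_elements ?G"
  then obtain \<xi> where \<xi>: "\<xi> \<in> Irr ?G" "\<xi> p = 0" by (auto simp: vanishing_elements_def)
  have "\<exists>i\<in>{..<length L}. \<xi> = restrict (class_fun n (L ! i)) (carrier ?G)"
  proof (rule Irr_exhausted[OF sym_group_is_group finite_sym_group])
    show "restrict (class_fun n (L ! i)) (carrier ?G) \<in> Irr ?G" if "i \<in> {..<length L}" for i
      using irr[OF L[OF that]] by (rule class_fun_Irr)
    fix g assume "g \<in> carrier ?G"
    then have g: "g permutes {1..n}" by (simp add: sym_group_carrier)
    have "(\<Sum>i<length L. class_fun n (L ! i) \<one>\<^bsub>?G\<^esub> * class_fun n (L ! i) g)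
        = of_real (\<Sum>i<length L. (L ! i) e * (L ! i) (cycle_type {1..n} g))"
      by (simp add: class_fun_def sym_group_one eid)
    also have "(\<Sum>i<length L. (L ! i) e * (L ! i) (cycle_type {1..n} g))
        = sum_list (map (\<lambda>f. f e * f (cycle_type {1..n} g)) L)"
      by (simp add: sum_list_sum_nth lessThan_atLeast0)
    also have "\<dots> = (if g = id then fact n else 0)"
      using reg[OF Ts[OF g]] e_iff[OF g] by simp
    finally have *: "(\<Sum>i<length L. class_fun n (L ! i) \<one>\<^bsub>?G\<^esub> * class_fun n (L ! i) g)
        = of_real (if g = id then fact n else 0)" .
    show "(\<Sum>i<length L. class_fun n (L ! i) \<one>\<^bsub>?G\<^esub> * class_fun n (L ! i) g)
        = (if g = \<one>\<^bsub>?G\<^esub> then of_nat (card (carrier ?G)) else 0)"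
      unfolding * by (simp add: card_sym_group sym_group_one)
  qed (use \<xi> in auto)
  then obtain i where i: "i < length L" "\<xi> = restrict (class_fun n (L ! i)) (carrier ?G)" by auto
  have "class_fun n (L ! i) p = 0" using \<xi>(2) i(2) p by (simp add: sym_group_carrier)
  then show "\<exists>f\<in>set L. f (cycle_type {1..n} p) = 0"
    using i(1) by (intro bexI[of _ "L ! i"]) (auto simp: class_fun_def)
next
  assume "\<exists>f\<in>set L. f (cycle_type {1..n} p) = 0"
  then obtain f where "f \<in> set L" "f (cycle_type {1..n} p) = 0" by blast
  then show "p \<in> vanishing_elements (sym_group n)"
    using irr p by (intro class_fun_vanishing[of n f]) auto
qed

lemma vanishing_proportion_complete:
  fixes L :: "(nat multiset \<Rightarrow> real) list"
  assumes irr: "\<And>f. f \<in> set L \<Longrightarrow> class_irr n f"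
    and types: "type_sum n (\<lambda>T. of_bool (T \<notin> set Ts)) = 0"
    and id: "type_sum n (\<lambda>T. of_bool (count T 1 = n)) = 1"
    and reg: "\<And>T. T \<in> set Ts \<Longrightarrow> sum_list (map (\<lambda>f. f (replicate_mset n 1) * f T) L) =
      (if count T 1 = n then fact n else 0)"
  shows "vanishing_proportion (sym_group n) = type_sum n (\<lambda>T. of_bool (\<exists>f\<in>set L. f T = 0)) / fact n"
proof -
  have "vanishing_elements (sym_group n) = {p. p permutes {1..n} \<and> (\<exists>f\<in>set L. f (cycle_type {1..n} p) = 0)}"
  proof (intro equalityI subsetI)
    fix p assume p: "p \<in> vanishing_elements (sym_group n)"
    then have "p permutes {1..n}" by (simp add: vanishing_elements_def sym_group_carrier)
    then show "p \<in> {p. p permutes {1..n} \<and> (\<exists>f\<in>set L. f (cycle_type {1..n} p) = 0)}"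
      using p vanishing_elements_complete[OF assms] by simp
  next
    fix p assume "p \<in> {p. p permutes {1..n} \<and> (\<exists>f\<in>set L. f (cycle_type {1..n} p) = 0)}"
    then show "p \<in> vanishing_elements (sym_group n)"
      using vanishing_elements_complete[OF assms] by simp
  qed
  then show ?thesis
    unfolding vanishing_proportion_def type_sum_of_bool Coset.order_def card_sym_group by simp
qed

text \<open>The tensor product with the sign character, which transposes the partition of a Specht
  character.\<close>

definition twist :: "(nat multiset \<Rightarrow> real) \<Rightarrow> nat multiset \<Rightarrow> real" where
  "twist f T = of_int (type_sign T) * f T"

text \<open>The subscript is the partition \<open>\<mu>\<close> such that the character belongs to \<open>(n - |\<mu>|, \<mu>)\<close>; the formulas come from
  the determinantal expression of Specht characters by permutation characters.\<close>

definition chi_triv :: "nat multiset \<Rightarrow> real" where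
  "chi_triv T = 1"

definition chi_1 :: "nat multiset \<Rightarrow> real" where
  "chi_1 T = cnt T 1 - 1"

definition chi_2 :: "nat multiset \<Rightarrow> real" where
  "chi_2 T = cnt T 1 * (cnt T 1 - 3) / 2 + cnt T 2"

text \<open>The exterior square of \<open>chi_1\<close>.\<close>

definition chi_11 :: "nat multiset \<Rightarrow> real" where
  "chi_11 T = (cnt T 1 - 1) * (cnt T 1 - 2) / 2 - cnt T 2"

definition chi_3 :: "nat multiset \<Rightarrow> real" where
  "chi_3 T = triples_fixed T - pairs_fixed T"

definition chi_21 :: "nat multiset \<Rightarrow> real" where
  "chi_21 T = cnt T 1 * (cnt T 1 - 2) * (cnt T 1 - 4) / 3 - cnt T 3"

text \<open>The exterior cube of \<open>chi_1\<close>.\<close>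

definition chi_111 :: "nat multiset \<Rightarrow> real" where
  "chi_111 T = (cnt T 1 - 1) * (cnt T 1 - 2) * (cnt T 1 - 3) / 6 - (cnt T 1 - 1) * cnt T 2 + cnt T 3"

text \<open>The determinant for (n-4,3,1) contains the permutation character on 4-subsets. The term
  \<open>- triples_fixed T\<close> stands for it, which is correct for \<open>n = 7\<close> by
  complementation; the partition is then (3,3,1).\<close>

definition chi_31 :: "nat multiset \<Rightarrow> real" where
  "chi_31 T = triples_fixed T * cnt T 1 - 2 * (pairs_fixed T * cnt T 1) + 2 * (cnt T 1 * cnt T 1) - 2 * cnt T 1
     - triples_fixed T + pairs_fixed T"

lemmas chi_defs = chi_triv_def chi_1_def chi_2_def chi_11_def chi_3_def chi_21_def chi_111_def chi_31_def
  pairs_fixed_def triples_fixed_def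

text \<open>The closed formulas have denominators, so each one is rewritten as a polynomial with
  integer coefficients in \<open>cnt T 1\<close>, \<open>pairs_fixed\<close> and
  \<open>triples_fixed\<close>, which are permutation characters.\<close>

lemma class_virtual_chi:
  "class_virtual n chi_triv" "class_virtual n chi_1" "class_virtual n chi_2" "class_virtual n chi_11"
  "class_virtual n chi_3" "class_virtual n chi_21" "class_virtual n chi_111" "class_virtual n chi_31"
proof -
  let ?x = "\<lambda>T. cnt T 1"
  have "class_virtual n (\<lambda>T. 1)" by (intro class_virtual_intros)
  then show "class_virtual n chi_triv" by (rule class_virtual_cong) (simp add: chi_triv_def)
  have "class_virtual n (\<lambda>T. ?x T - 1)" by (intro class_virtual_intros)
  then show "class_virtual n chi_1" by (rule class_virtual_cong) (simp add: chi_1_def)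
  have "class_virtual n (\<lambda>T. pairs_fixed T - ?x T)" by (intro class_virtual_intros)
  then show "class_virtual n chi_2" by (rule class_virtual_cong) (simp add: chi_defs field_simps)
  have "class_virtual n (\<lambda>T. ?x T * ?x T - 2 * ?x T - pairs_fixed T + 1)" by (intro class_virtual_intros)
  then show "class_virtual n chi_11" by (rule class_virtual_cong) (simp add: chi_defs field_simps)
  have "class_virtual n (\<lambda>T. triples_fixed T - pairs_fixed T)" by (intro class_virtual_intros)
  then show "class_virtual n chi_3" by (rule class_virtual_cong) (simp add: chi_3_def)
  have "class_virtual n (\<lambda>T. pairs_fixed T * ?x T - 2 * (?x T * ?x T) + 3 * ?x T - triples_fixed T)"
    by (intro class_virtual_intros)
  then show "class_virtual n chi_21" by (rule class_virtual_cong) (simp add: chi_defs field_simps)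
  have "class_virtual n (\<lambda>T. triples_fixed T - (2 * ?x T - 1) * pairs_fixed T + (?x T - 1) * (?x T *
      ?x T - ?x T + 1))"
    by (intro class_virtual_intros)
  then show "class_virtual n chi_111" by (rule class_virtual_cong) (simp add: chi_defs field_simps)
  have "class_virtual n (\<lambda>T. triples_fixed T * ?x T - 2 * (pairs_fixed T * ?x T) + 2 * (?x T * ?x T) - 2 * ?x T
      - triples_fixed T + pairs_fixed T)"
    by (intro class_virtual_intros)
  then show "class_virtual n chi_31" by (rule class_virtual_cong) (simp add: chi_31_def)
qed

lemma type_sign_square: "type_sign T * type_sign T = 1"
proof (induction T)
  case (add k T)
  have "(-1 :: int) ^ Suc k * (-1) ^ Suc k = 1" by (simp flip: power_mult_distrib)
  moreover have "type_sign (add_mset k T) = (-1) ^ Suc k * type_sign T" by (simp add: type_sign_def)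
  ultimately show ?case using add by (simp add: mult_ac del: power_Suc)
qed (simp add: type_sign_def)

lemma twist_eq_0_iff: "twist f T = 0 \<longleftrightarrow> f T = 0"
  using type_sign_square[of T] by (auto simp: twist_def)

lemma type_sign_id: "type_sign (replicate_mset n 1) = 1"
  by (induction n) (simp_all add: type_sign_def)

lemma class_irr_twist:
  assumes "class_irr n f"
  shows "class_irr n (twist f)"
proof -
  have "class_virtual n (\<lambda>T. of_int (type_sign T) * f T)"
    using assms by (intro class_virtual_intros) (simp add: class_irr_def)
  then have "class_virtual n (twist f)" by (rule class_virtual_cong) (simp add: twist_def)
  moreover have "(twist f T)^2 = (f T)^2" for T
  proof -
    have "real_of_int (type_sign T * type_sign T) = 1" by (simp only: type_sign_square of_int_1)
    then show ?thesis by (simp add: twist_def power2_eq_square)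
  qed
  moreover have "twist f (replicate_mset n 1) = f (replicate_mset n 1)"
    by (simp add: twist_def type_sign_id)
  ultimately show ?thesis using assms by (simp add: class_irr_def)
qed

lemma class_irr_triv: "class_irr n chi_triv"
  by (simp add: class_irr_def class_virtual_chi chi_triv_def type_sum_const)

lemma class_irr_1: "n \<ge> 2 \<Longrightarrow> class_irr n chi_1"
  using norm_chi1[of n] by (simp add: class_irr_def class_virtual_chi chi_1_def)

lemma class_irr_2: "n \<ge> 4 \<Longrightarrow> class_irr n chi_2"
  using norm_chi2[of n] by (simp add: class_irr_def class_virtual_chi chi_2_def)

lemma class_irr_11: "n \<ge> 4 \<Longrightarrow> class_irr n chi_11"
  using norm_chi11[of n] by (simp add: class_irr_def class_virtual_chi chi_11_def)

text \<open>The character of the partition (3,2,1); it serves to catch the type with two fixed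
  points and two 2-cycles.\<close>

lemma class_irr_6: "class_irr 6 chi_21"
  unfolding class_irr_def type_sum_6
  by (simp add: class_virtual_chi chi_defs fact_numeral power2_eq_square)

lemma class_irr_7:
  "class_irr 7 chi_3" "class_irr 7 chi_21" "class_irr 7 chi_111" "class_irr 7 chi_31"
  unfolding class_irr_def type_sum_7
  by (simp_all add: class_virtual_chi chi_defs fact_numeral power2_eq_square)

section \<open>Exact proportions in degrees 1 to 4 and 7\<close>

lemma vanishing_proportion_1: "vanishing_proportion (sym_group 1) = 0"
proof -
  have "vanishing_proportion (sym_group 1)
      = type_sum 1 (\<lambda>T. of_bool (\<exists>f\<in>set [chi_triv]. f T = 0)) / fact 1"
    by (rule vanishing_proportion_complete[where Ts = "[{#1#}]"])
      (auto simp: class_irr_triv type_sum_1 chi_defs)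
  then show ?thesis by (simp add: type_sum_1 chi_defs)
qed

lemma vanishing_proportion_2: "vanishing_proportion (sym_group 2) = 0"
proof -
  have "vanishing_proportion (sym_group 2)
      = type_sum 2 (\<lambda>T. of_bool (\<exists>f\<in>set [chi_triv, twist chi_triv]. f T = 0)) / fact 2"
    by (rule vanishing_proportion_complete[where Ts = "[{#2#}, {#1, 1#}]"])
      (auto simp: class_irr_triv class_irr_twist type_sum_2 chi_defs twist_def type_sign_id type_sign_def)
  then show ?thesis by (simp add: type_sum_2 chi_defs twist_def type_sign_def)
qed

lemma vanishing_proportion_3: "vanishing_proportion (sym_group 3) = 1 / 2"
proof -
  have "vanishing_proportion (sym_group 3)
      = type_sum 3 (\<lambda>T. of_bool (\<exists>f\<in>set [chi_triv, twist chi_triv, chi_1]. f T = 0)) / fact 3"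
    by (rule vanishing_proportion_complete[where Ts = "[{#3#}, {#2, 1#}, {#1, 1, 1#}]"])
      (auto simp: class_irr_triv class_irr_1 class_irr_twist type_sum_3 chi_defs twist_def type_sign_id type_sign_def fact_numeral)
  then show ?thesis by (simp add: type_sum_3 chi_defs twist_def type_sign_def fact_numeral)
qed

text \<open>The listed characters belong to (4), (1,1,1,1), (3,1), (2,1,1) and the self-conjugate
  (2,2). Only the identity and the three double transpositions escape their zeros.\<close>

lemma vanishing_proportion_4: "vanishing_proportion (sym_group 4) = 5 / 6"
proof -
  have "vanishing_proportion (sym_group 4)
      = type_sum 4 (\<lambda>T. of_bool (\<exists>f\<in>set [chi_triv, twist chi_triv, chi_1, twist chi_1, chi_2]. f T = 0)) / fact 4"
    by (rule vanishing_proportion_complete[where Ts = "[{#4#}, {#3, 1#}, {#2, 2#}, {#2, 1, 1#}, {#1, 1, 1,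
        1#}]"])
      (auto simp: class_irr_triv class_irr_1 class_irr_2 class_irr_twist type_sum_4 chi_defs twist_def type_sign_id type_sign_def fact_numeral)
  then show ?thesis by (simp add: type_sum_4 chi_defs twist_def type_sign_def fact_numeral)
qed

lemma vanishing_proportion_7: "vanishing_proportion (sym_group 7) = 2327 / 2520"
proof -
  \<comment> \<open>One character for each of the 15 partitions of 7. The partition (4,1,1,1) of
    \<open>chi_111\<close> is self-conjugate, so \<open>chi_111\<close> is its own twist and is
    listed once.\<close>
  let ?L = "[chi_triv, chi_1, chi_2, chi_11, chi_3, chi_21, chi_31, chi_111, twist chi_triv, twist chi_1,
    twist chi_2, twist chi_11, twist chi_3, twist chi_21, twist chi_31]"
  let ?Ts = "[{#7#}, {#6, 1#}, {#5, 2#}, {#5, 1, 1#}, {#4, 3#}, {#4, 2, 1#}, {#4, 1, 1, 1#}, {#3, 3, 1#},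
    {#3, 2, 2#}, {#3, 2, 1, 1#}, {#3, 1, 1, 1, 1#}, {#2, 2, 2, 1#}, {#2, 2, 1, 1, 1#},
    {#2, 1, 1, 1, 1, 1#}, {#1, 1, 1, 1, 1, 1, 1#}]"
  have "vanishing_proportion (sym_group 7) = type_sum 7 (\<lambda>T. of_bool (\<exists>f\<in>set ?L. f T = 0)) / fact 7"
  proof (rule vanishing_proportion_complete[where Ts = ?Ts])
    show "class_irr 7 f" if "f \<in> set ?L" for f
      using that class_irr_1[of 7] class_irr_2[of 7] class_irr_11[of 7]
      by (auto intro: class_irr_triv class_irr_7 class_irr_twist)
    show "type_sum 7 (\<lambda>T. of_bool (T \<notin> set ?Ts)) = 0"
      by (simp add: type_sum_7)
    show "type_sum 7 (\<lambda>T. of_bool (count T 1 = 7)) = 1"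
      by (simp add: type_sum_7)
    fix T :: "nat multiset" assume "T \<in> set ?Ts"
    then show "sum_list (map (\<lambda>f. f (replicate_mset 7 1) * f T) ?L) = (if count T 1 = 7 then fact 7 else 0)"
      unfolding list.set insert_iff empty_iff
      by (elim disjE; simp add: chi_defs twist_def type_sign_id type_sign_def fact_numeral)
  qed
  \<comment> \<open>A twist has the zeros of the original character and \<open>chi_triv\<close> has
    none, so seven conditions remain to be evaluated on the class table.\<close>
  moreover have "(\<exists>f\<in>set ?L. f T = 0) \<longleftrightarrow> chi_1 T = 0 \<or> chi_2 T = 0 \<or> chi_11 T = 0 \<or> chi_3 T = 0 \<or>
      chi_21 T = 0 \<or> chi_31 T = 0 \<or> chi_111 T = 0" for T
    by (auto simp: twist_eq_0_iff chi_triv_def)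
  ultimately have "vanishing_proportion (sym_group 7) = type_sum 7 (\<lambda>T. of_bool (chi_1 T = 0 \<or>
      chi_2 T = 0 \<or> chi_11 T = 0 \<or> chi_3 T = 0 \<or> chi_21 T = 0 \<or> chi_31 T = 0 \<or> chi_111 T = 0)) / fact 7"
    by (simp only:)
  also have "\<dots> = 2327 / 2520" unfolding type_sum_7 by (simp add: chi_defs fact_numeral)
  finally show ?thesis .
qed

section \<open>Lower bound from three characters\<close>

definition zero_type :: "nat multiset \<Rightarrow> bool" where
  "zero_type T \<longleftrightarrow> count T 1 = 1 \<or>
     (count T 1, count T 2) \<in> {(0, 0), (0, 1), (2, 0), (2, 1), (3, 0), (3, 1)}"

text \<open>\<open>chi_1\<close> accounts for a single fixed point, \<open>chi_2\<close> for the
  pairs (0,0), (2,1), (3,0), and \<open>chi_11\<close> for (0,1), (2,0), (3,1).\<close>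

lemma zero_type_vanishing:
  assumes n: "n \<ge> 4" and p: "p permutes {1..n}" and z: "zero_type (cycle_type {1..n} p)"
  shows "p \<in> vanishing_elements (sym_group n)"
proof -
  let ?T = "cycle_type {1..n} p"
  have "chi_1 ?T = 0 \<or> chi_2 ?T = 0 \<or> chi_11 ?T = 0"
    using z by (auto simp: zero_type_def chi_defs)
  then show ?thesis
    using class_fun_vanishing[OF _ p] class_irr_1[of n] class_irr_2[of n] class_irr_11[of n] n by auto
qed

text \<open>The seven events are disjoint, as none of the six pairs has first entry 1; the
  denominators 2, 2, 4, 6, 12 are the values of \<open>a! b! 2^b\<close>.\<close>

lemma type_sum_zero_type:
  "type_sum n (\<lambda>T. of_bool (zero_type T)) = fact n *
    (derangement_ratio_int (int n - 1) + long_cycle_ratio_int (int n) + long_cycle_ratio_int (int n - 2) / 2 + long_cycle_ratio_int (int n - 2) / 2 + long_cycle_ratio_int (int n - 4) / 4 +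
     long_cycle_ratio_int (int n - 3) / 6 + long_cycle_ratio_int (int n - 5) / 12)"
proof -
  let ?I = "\<lambda>a b T. of_bool (count T 1 = a \<and> count T 2 = b) :: real"
  have eq: "(\<lambda>T. of_bool (zero_type T) :: real) = (\<lambda>T. of_bool (count T 1 = 1) +
      (?I 0 0 T + (?I 0 1 T + (?I 2 0 T + (?I 2 1 T + (?I 3 0 T + ?I 3 1 T))))))"
  proof
    fix T :: "nat multiset"
    have "of_bool (x = 1 \<or> (x, y) \<in> {(0, 0), (0, 1), (2, 0), (2, 1), (3, 0), (3, 1)}) = (of_bool (x = 1) +
        (of_bool (x = 0 \<and> y = 0) + (of_bool (x = 0 \<and> y = 1) + (of_bool (x = 2 \<and> y = 0) +
        (of_bool (x = 2 \<and> y = 1) + (of_bool (x = 3 \<and> y = 0) + of_bool (x = 3 \<and> y = 1)))))) :: real)"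
      for x y :: nat
      by (cases "x = 0"; cases "x = 1"; cases "x = 2"; cases "x = 3"; cases "y = 0"; cases "y = 1"; simp)
    then show "(of_bool (zero_type T) :: real) = of_bool (count T 1 = 1) +
      (?I 0 0 T + (?I 0 1 T + (?I 2 0 T + (?I 2 1 T + (?I 3 0 T + ?I 3 1 T)))))"
      unfolding zero_type_def .
  qed
  have k: "int n - int 1 = int n - 1" "int n - int 0 - 2 * int 0 = int n" "int n - int 0 - 2 * int 1 =
      int n - 2"
    "int n - int 2 - 2 * int 0 = int n - 2" "int n - int 2 - 2 * int 1 = int n - 4"
    "int n - int 3 - 2 * int 0 = int n - 3" "int n - int 3 - 2 * int 1 = int n - 5" by simp_all
  show ?thesis
    unfolding eq type_sum_linear(1) type_sum_count1 type_sum_count12 k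
    by (simp add: fact_numeral distrib_left)
qed

lemma derangement_ratio_values:
  "derangement_ratio 4 = 3 / 8" "derangement_ratio 7 = 103 / 280" "derangement_ratio 8 =
      2119 / 5760" "derangement_ratio 9 = 16687 / 45360" "derangement_ratio 10 =
      16481 / 44800" "derangement_ratio 11 = 1468457 / 3991680"
  by (simp_all add: numeral_eq_Suc)

lemma long_cycle_ratio_values:
  "long_cycle_ratio 0 = 1" "long_cycle_ratio 1 = 0" "long_cycle_ratio 2 = 0" "long_cycle_ratio 3 =
      1 / 3" "long_cycle_ratio 4 = 1 / 4" "long_cycle_ratio 5 = 1 / 5" "long_cycle_ratio 6 =
      2 / 9" "long_cycle_ratio 7 = 19 / 84" "long_cycle_ratio 8 = 107 / 480" "long_cycle_ratio 9 =
      361 / 1620" "long_cycle_ratio 10 = 703 / 3150" "long_cycle_ratio 11 =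
      24743 / 110880" "long_cycle_ratio 12 = 242903 / 1088640"
  by (simp_all add: numeral_eq_Suc One_nat_def)

text \<open>Degrees 6 and 7 are excluded because there the bound fails: \<open>zero_type\<close>
  covers only 0.894... and 0.919... of the group.\<close>

lemma zero_type_proportion:
  assumes "n = 5 \<or> n \<ge> 8"
  shows "type_sum n (\<lambda>T. of_bool (zero_type T)) / fact n \<ge> 2327 / 2520"
proof -
  let ?F = "\<lambda>n. derangement_ratio_int (int n - 1) + long_cycle_ratio_int (int n) +
      long_cycle_ratio_int (int n - 2) / 2 + long_cycle_ratio_int (int n - 2) / 2 +
      long_cycle_ratio_int (int n - 4) / 4 +
     long_cycle_ratio_int (int n - 3) / 6 + long_cycle_ratio_int (int n - 5) / 12"
  have "?F n \<ge> 2327 / 2520"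
  \<comment> \<open>From 13 on the smallest argument, \<open>n - 5\<close>, is at least 8, so both
    uniform bounds apply and give 0.3678 + 5/2 * 0.2228 = 0.9248, above 2327/2520 = 0.9234... The
    remaining degrees are evaluated.\<close>
  proof (cases "n \<ge> 13")
    case True
    then obtain m where n: "n = m + 13" by (metis add.commute le_Suc_ex)
    have "nat (int n - 1) = m + 6 + 6" "nat (int n) = m + 5 + 8" "nat (int n - 2) = m + 3 + 8"
      "nat (int n - 4) = m + 1 + 8" "nat (int n - 3) = m + 2 + 8" "nat (int n - 5) = m + 8"
      using n by auto
    then have "?F n = derangement_ratio (m + 6 + 6) + long_cycle_ratio (m + 5 + 8) + long_cycle_ratio (m +
        3 + 8) / 2 + long_cycle_ratio (m + 3 + 8) / 2 +
      long_cycle_ratio (m + 1 + 8) / 4 + long_cycle_ratio (m + 2 + 8) / 6 + long_cycle_ratio (m + 8) / 12"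
      using n by (simp only: derangement_ratio_int_def long_cycle_ratio_int_def) simp
    then show ?thesis
      using derangement_ratio_ge[of "m + 6"] long_cycle_ratio_ge[of "m + 5"] long_cycle_ratio_ge[of "m +
          3"] long_cycle_ratio_ge[of "m + 1"] long_cycle_ratio_ge[of "m + 2"] long_cycle_ratio_ge[of m]
      by simp
  next
    case False
    then have "n \<in> {5, 8, 9, 10, 11, 12}" using assms by auto
    then show ?thesis
      by (elim insertE emptyE) (simp_all add: derangement_ratio_int_def long_cycle_ratio_int_def derangement_ratio_values long_cycle_ratio_values)
  qed
  then show ?thesis unfolding type_sum_zero_type by simp
qed

lemma vanishing_proportion_6: "vanishing_proportion (sym_group 6) \<ge> 2327 / 2520"
proof -
  \<comment> \<open>The added type has 45 permutations, which raises the proportion from 0.894... to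
    0.956...\<close>
  let ?Z = "\<lambda>T. zero_type T \<or> count T 1 = 2 \<and> count T 2 = 2"
  have "type_sum 6 (\<lambda>T. of_bool (?Z T)) / fact 6 \<ge> 2327 / 2520"
    unfolding type_sum_6 zero_type_def by (simp add: fact_numeral)
  also have "type_sum 6 (\<lambda>T. of_bool (?Z T)) / fact 6 \<le> vanishing_proportion (sym_group 6)"
  proof (rule vanishing_proportion_ge)
    fix p :: "nat \<Rightarrow> nat" assume p: "p permutes {1..6}" and z: "?Z (cycle_type {1..6} p)"
    let ?T = "cycle_type {1..6} p"
    show "p \<in> vanishing_elements (sym_group 6)"
    proof (cases "zero_type ?T")
      case True
      then show ?thesis using zero_type_vanishing[of 6 p] p by simp
    next
      case False
      with z have c: "count ?T 1 = 2" "count ?T 2 = 2" by auto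
      have "\<Sum>\<^sub># ?T = 6" using sum_mset_cycle_type[OF _ p] by simp
      \<comment> \<open>Two fixed points and two 2-cycles use up all 6 points. With two fixed
        points, \<open>chi_21\<close> reduces to \<open>- cnt T 3\<close>, so this makes it
        vanish.\<close>
      have "count ?T 3 = 0"
      proof (rule ccontr)
        assume "count ?T 3 \<noteq> 0"
        then have "add_mset 3 (replicate_mset 2 1 + replicate_mset 2 2) \<subseteq># ?T"
          using c by (auto simp: subseteq_mset_def)
        then obtain R where "?T = add_mset 3 (replicate_mset 2 1 + replicate_mset 2 2) + R"
          unfolding mset_subset_eq_exists_conv ..
        then show False using \<open>\<Sum>\<^sub># ?T = 6\<close> by simp
      qed
      then have "chi_21 ?T = 0" using c by (simp add: chi_21_def)
      then show ?thesis using class_fun_vanishing[OF class_irr_6 p] by simp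
    qed
  qed
  finally show ?thesis .
qed

theorem theorem1p4:
  fixes n :: nat
  assumes "n \<ge> 1"
  shows "(n = 1 \<or> n = 2 \<longrightarrow> vanishing_proportion (sym_group n) = 0) \<and>
         (n = 3 \<longrightarrow> vanishing_proportion (sym_group n) = 1 / 2) \<and>
         (n = 4 \<longrightarrow> vanishing_proportion (sym_group n) = 5 / 6) \<and>
         (n \<ge> 5 \<longrightarrow>
            vanishing_proportion (sym_group n) \<ge> vanishing_proportion (sym_group 7) \<and>
            vanishing_proportion (sym_group 7) = 2327 / 2520)"
proof -
  have "vanishing_proportion (sym_group n) \<ge> 2327 / 2520" if "n \<ge> 5"
  proof -
    consider "n = 6" | "n = 7" | "n = 5 \<or> n \<ge> 8" using \<open>n \<ge> 5\<close> by linarith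
    then show ?thesis
    proof cases
      case 3
      have "type_sum n (\<lambda>T. of_bool (zero_type T)) / fact n \<le> vanishing_proportion (sym_group n)"
        using that by (intro vanishing_proportion_ge zero_type_vanishing) auto
      with zero_type_proportion[OF 3] show ?thesis by (rule order_trans)
    qed (simp_all only: vanishing_proportion_6 vanishing_proportion_7 order_refl)
  qed
  then show ?thesis
    using vanishing_proportion_1 vanishing_proportion_2 vanishing_proportion_3 vanishing_proportion_4
      vanishing_proportion_7 by auto
qed

end
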